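(* A difference variety $X$ (over $\mathbb Q$, in $\mathbb A^n$) is toric if and only if any one of the following properties is valid (that is, being toric is equivalent to each of (1), (2), (3)): (1) $X\cong\mathrm{Spec}^\sigma(\mathbb Q\{M\})$, where $M$ is a finitely generated affine $\mathbb N[x]$-module in $\mathbb Z[x]^m$ (for some $m$) and $\mathbb Q\{M\}=\{\sum_{\alpha\in M}a_\alpha\mathbb T^\alpha\mid a_\alpha\in\mathbb Q,\ a_\alpha\ne0\text{ for finitely many }\alpha\}$ for a set of difference indeterminates $\mathbb T=\{t_1,\ldots,t_m\}$. (2) The defining ideal of $X$ is a toric difference ideal, that is, $\mathbb I(X)=[\mathbb Y^{\mathbf f^+}-\mathbb Y^{\mathbf f^-}\mid \mathbf f\in L]$, where $L\subset\mathbb Z[x]^n$ is a $\mathbb Z[x]$-saturated $\mathbb Z[x]$-lattice and $\mathbf f^+,\mathbf f^-$ are the positive and negative parts of $\mathbf f$, respectively. (3) $X$ contains a difference torus $T^*$ as a Cohn open subset and with a group action of $T^*$ on $X$ extending the natural group action of $T^*$ on itself.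
   Context: $\mathbb Q$ is regarded as a difference field (with $\sigma=\mathrm{id}$). $\mathbb Y=\{y_1,\ldots,y_n\}$ and $\mathbb T=\{t_1,\ldots,t_m\}$ are difference indeterminates; for $p=\sum_ic_ix^i\in\mathbb Z[x]$, $a^p:=\prod_i\sigma^i(a)^{c_i}$, and for $\mathbf f=(f_1,\ldots,f_n)^\tau\in\mathbb Z[x]^n$, $\mathbb Y^{\mathbf f}=\prod_iy_i^{f_i}$ (similarly $\mathbb T^\alpha$ for $\alpha\in\mathbb Z[x]^m$). $\mathbb Q\{\mathbb Y\}$ is the difference polynomial ring; $[S]$ is the difference ideal (ideal closed under $\sigma$) generated by $S$. A difference variety over $\mathbb Q$ in $\mathbb A^n$ is a functor $E\mapsto\{\eta\in E^n\mid p(\eta)=0\ \forall p\in P\}$ on difference field extensions $E$ of $\mathbb Q$, for some $P\subset\mathbb Q\{\mathbb Y\}$; these correspond bijectively to perfect difference ideals, and $\mathbb I(X)\subset\mathbb Q\{\mathbb Y\}$ denotes the defining ideal of $X$. The coordinate ring of $X$ is $\mathbb Q\{\mathbb Y\}/\mathbb I(X)$. $\mathrm{Spec}^\sigma(R)$ is the set of reflexive prime difference ideals of $R$; $X\cong\mathrm{Spec}^\sigma(R)$ means that the coordinate ring of $X$ is isomorphic to $R$. Cohn closed subsets of a difference variety are its difference subvarieties, Cohn open subsets are their complements, and the Cohn closure of a subset is the smallest difference variety containing it. Toric variety: for $\alpha=\{\alpha_1,\ldots,\alpha_n\}$, $\alpha_i\in\mathbb Z[x]^m$, let $\phi:(\mathbb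 A^* )^m\to(\mathbb A^* )^n$, $\mathbb T\mapsto(\mathbb T^{\alpha_1},\ldots,\mathbb T^{\alpha_n})$, where $(\mathbb A^* )^m(E)=(E\setminus\{0\})^m$. The functor $T_\alpha$, $T_\alpha(E)=\mathrm{Im}(\phi_E)$, is the quasi $\sigma$-torus with defining vector $\alpha$. A difference variety over $\mathbb Q$ is toric if it is the Cohn closure of a quasi $\sigma$-torus $T_\alpha$ in $\mathbb A^n$, i.e. the variety of $\mathcal I_\alpha=\{f\in\mathbb Q\{\mathbb Y\}\mid f(\mathbb T^{\alpha_1},\ldots,\mathbb T^{\alpha_n})=0\}$. It is assumed throughout that the matrix $[\alpha_1,\ldots,\alpha_n]_{m\times n}$ has no zero row (every $t_i$ appears effectively in some $\mathbb T^{\alpha_k}$) and that no $\alpha_i$ is the zero vector. A $\mathbb Z[x]$-lattice is a $\mathbb Z[x]$-submodule of $\mathbb Z[x]^n$; it is $\mathbb Z[x]$-saturated (toric) if for any nonzero $p\in\mathbb Z[x]$ and $\mathbf f\in\mathbb Z[x]^n$, $p\mathbf f\in L$ implies $\mathbf f\in L$. For $\mathbf f\in\mathbb Z[x]^n$, $\mathbf f^+,\mathbf f^-\in\mathbb N[x]^n$ are the positive and negative parts (obtained by collecting the terms with positive, respectively negative, coefficients), so $\mathbf f=\mathbf f^+-\mathbf f^-$. An affine $\mathbb N[x]$-module in $\mathbb Z[x]^m$ is a set $\{\sum_{i=1}^sa_i\beta_i\mid a_i\in\mathbb N[x]\}$ with $\beta_1,\ldots,\beta_s\in\mathbb Z[x]^m$.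 Difference torus: let $\theta:(\mathbb A^* )^n\to\mathbb A^{2n}$, $\theta(a_1,\ldots,a_n)=(a_1,\ldots,a_n,a_1^{-1},\ldots,a_n^{-1})$. For $V\subset(\mathbb A^* )^n$, the Cohn $*$-closure of $V$ is $\theta^{-1}(V_1)$, where $V_1$ is the Cohn closure of $\theta(V)$ in $\mathbb A^{2n}$. A difference torus ($\sigma$-torus) is a difference variety isomorphic to the Cohn $*$-closure of a quasi $\sigma$-torus in $(\mathbb A^* )^n$ (difference varieties in $(\mathbb A^* )^n$ being identified via $\theta$ with affine difference varieties in $\mathbb A^{2n}$); it has a group structure by componentwise multiplication, and acts on itself by multiplication. A difference torus $T^*\subseteq(\mathbb A^* )^n$ acts on a difference variety $X\subseteq\mathbb A^n$ if there is a $\varphi$ given by difference polynomials over $\mathbb Q$ in $y_1,\ldots,y_n,z_1,\ldots,z_n$ such that for every difference field extension $E$ of $\mathbb Q$, $\varphi:T^*(E)\times X(E)\to X(E)$ is a difference morphism as well as a group action of $T^*(E)$ on $X(E)$, i.e. $\varphi(\mathbf 1,h)=h$ and $\varphi(e_1\cdot e_2,h)=\varphi(e_1,\varphi(e_2,h))$.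
   Formalization: For (1), "toric" is read as isomorphic to a toric variety; (2) and (3) add that no coordinate is constantly 1 on X, and (3) also that X is irreducible; the literal converses fail otherwise. Difference fields E range over one arbitrary infinite universe. *)

theory Defs
  imports
    "HOL-Algebra.QuotRing"
    "HOL-Library.Poly_Mapping"
    "HOL-Library.FuncSet"
    "HOL-Computational_Algebra.Polynomial"
begin

section \<open>The $\mathbb{Z}[x]$-module $\mathbb{Z}[x]^n$\<close>

text \<open>
  A vector of \<open>\<int>[x]\<^sup>n\<close> is a finitely supported function from \<open>nat\<close> to \<open>int poly\<close> whose
  support lies in \<open>{..<n}\<close>; vectors of all lengths thus share one type.
\<close>

type_synonym zvec = "nat \<Rightarrow>\<^sub>0 int poly"

definition Zx :: "nat \<Rightarrow> zvec set" where
  "Zx n = {f. Poly_Mapping.keys f \<subseteq> {..<n}}"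

definition Nx_poly :: "int poly set" where
  "Nx_poly = {p. \<forall>k. 0 \<le> coeff p k}"

definition Nx :: "nat \<Rightarrow> zvec set" where
  "Nx n = {f \<in> Zx n. \<forall>i. Poly_Mapping.lookup f i \<in> Nx_poly}"

definition zscale :: "int poly \<Rightarrow> zvec \<Rightarrow> zvec" where
  "zscale p f = Poly_Mapping.map ((*) p) f"

lemma lookup_zscale: "Poly_Mapping.lookup (zscale p f) i = p * Poly_Mapping.lookup f i"
  unfolding zscale_def by transfer (simp add: when_def)

interpretation zvec: Modules.module zscale
  by unfold_locales
    (auto intro!: poly_mapping_eqI simp: lookup_zscale lookup_add algebra_simps)

definition Zx_lattice :: "nat \<Rightarrow> zvec set \<Rightarrow> bool" where
  "Zx_lattice n L \<longleftrightarrow> L \<subseteq> Zx n \<and> zvec.subspace L"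

definition Zx_saturated :: "nat \<Rightarrow> zvec set \<Rightarrow> bool" where
  "Zx_saturated n L \<longleftrightarrow> (\<forall>p f. p \<noteq> 0 \<longrightarrow> f \<in> Zx n \<longrightarrow> zscale p f \<in> L \<longrightarrow> f \<in> L)"

definition pos_part :: "zvec \<Rightarrow> zvec" where
  "pos_part f = Poly_Mapping.map (map_poly (\<lambda>c. max c 0)) f"

definition neg_part :: "zvec \<Rightarrow> zvec" where
  "neg_part f = Poly_Mapping.map (map_poly (\<lambda>c. max (- c) 0)) f"

definition affine_Nx_module :: "nat \<Rightarrow> zvec set \<Rightarrow> bool" where
  "affine_Nx_module m M \<longleftrightarrow>
     (\<exists>s \<beta>. (\<forall>i<s. \<beta> i \<in> Zx m) \<and>
       M = {(\<Sum>i<s. zscale (a i) (\<beta> i)) | a :: nat \<Rightarrow> int poly. \<forall>i<s. a i \<in> Nx_poly})"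


section \<open>Difference rings\<close>

record 'a difference_ring = "'a ring" +
  shift :: "'a \<Rightarrow> 'a"

definition difference_ideal :: "'a set \<Rightarrow> 'a difference_ring \<Rightarrow> bool" where
  "difference_ideal I R \<longleftrightarrow> ideal I R \<and> shift R ` I \<subseteq> I"

definition gen_difference_ideal :: "'a difference_ring \<Rightarrow> 'a set \<Rightarrow> 'a set" where
  "gen_difference_ideal R S = \<Inter> {I. difference_ideal I R \<and> S \<subseteq> I}"

definition difference_quotient :: "'a difference_ring \<Rightarrow> 'a set \<Rightarrow> 'a set difference_ring" where
  "difference_quotient R I =
     ring.extend (R Quot I) \<lparr>shift = (\<lambda>C. \<Union>a\<in>C. I +>\<^bsub>R\<^esub> shift R a)\<rparr>"

text \<open>
  Between \<open>\<rat>\<close>-algebras every unital ring homomorphism is \<open>\<rat>\<close>-linear, so nothing needs to be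
  said about scalars.
\<close>

definition difference_isomorphic :: "'a difference_ring \<Rightarrow> 'b difference_ring \<Rightarrow> bool" where
  "difference_isomorphic R S \<longleftrightarrow>
     (\<exists>h \<in> ring_iso R S. \<forall>a \<in> carrier R. h (shift R a) = shift S (h a))"

text \<open>
  A field homomorphism is injective; it is not required to be surjective.  Having
  characteristic 0 is the same as extending the difference field \<open>\<rat>\<close>, since
  \<open>shift E\<close> necessarily fixes the prime field.
\<close>

definition difference_field_over_Q :: "'e difference_ring \<Rightarrow> bool" where
  "difference_field_over_Q E \<longleftrightarrow>
     field E \<and> shift E \<in> ring_hom E E \<and> (\<forall>k::nat. 0 < k \<longrightarrow> [k] \<cdot>\<^bsub>E\<^esub> \<one>\<^bsub>E\<^esub> \<noteq> \<zero>\<^bsub>E\<^esub>)"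


section \<open>Difference polynomials\<close>

text \<open>
  The monomial \<open>\<T>\<^sup>\<alpha>\<close>, \<open>\<alpha> \<in> \<int>[x]\<^sup>m\<close>, is \<open>Poly_Mapping.single \<alpha> 1\<close>: the exponents form an additive
  group, and multiplication of \<open>Poly_Mapping\<close> is convolution, so the type below is the ring
  of Laurent difference polynomials in countably many indeterminates.  The shift is
  \<open>\<sigma> (\<T>\<^sup>\<alpha>) = \<T>\<^bsup>x\<alpha>\<^esup>\<close>.
\<close>

type_synonym laurent = "zvec \<Rightarrow>\<^sub>0 rat"

definition monomial :: "zvec \<Rightarrow> laurent" where
  "monomial e = Poly_Mapping.single e 1"

definition laurent_shift :: "laurent \<Rightarrow> laurent" where
  "laurent_shift f =
     (\<Sum>e\<in>Poly_Mapping.keys f. Poly_Mapping.single (zscale [:0, 1:] e) (Poly_Mapping.lookup f e))"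

definition module_ring :: "zvec set \<Rightarrow> laurent difference_ring" where
  "module_ring M =
     \<lparr>carrier = {f. Poly_Mapping.keys f \<subseteq> M}, monoid.mult = (*), one = 1, zero = 0, add = (+),
      shift = laurent_shift\<rparr>"

text \<open>\<open>\<rat>{y\<^sub>1,\<dots>,y\<^sub>n}\<close> consists of the combinations of the \<open>\<Y>\<^sup>f\<close> with \<open>f \<in> \<nat>[x]\<^sup>n\<close>.\<close>

definition dpoly_ring :: "nat \<Rightarrow> laurent difference_ring" where
  "dpoly_ring n = module_ring (Nx n)"

text \<open>
  Exponents are integers; the negative ones are only ever used at nonzero elements of a field.
\<close>

definition elem_pow :: "'e difference_ring \<Rightarrow> 'e \<Rightarrow> int poly \<Rightarrow> 'e" where
  "elem_pow E a p =
     finprod E (\<lambda>k. ((shift E ^^ k) a) [^]\<^bsub>E\<^esub> (coeff p k :: int)) {..Polynomial.degree p}"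

definition vec_pow :: "'e difference_ring \<Rightarrow> (nat \<Rightarrow> 'e) \<Rightarrow> zvec \<Rightarrow> 'e" where
  "vec_pow E a f =
     finprod E (\<lambda>i. elem_pow E (a i) (Poly_Mapping.lookup f i)) (Poly_Mapping.keys f)"

definition rat_embed :: "'e difference_ring \<Rightarrow> rat \<Rightarrow> 'e" where
  "rat_embed E q =
     ([fst (quotient_of q)] \<cdot>\<^bsub>E\<^esub> \<one>\<^bsub>E\<^esub>) \<otimes>\<^bsub>E\<^esub> inv\<^bsub>E\<^esub> ([snd (quotient_of q)] \<cdot>\<^bsub>E\<^esub> \<one>\<^bsub>E\<^esub>)"

definition eval_dpoly :: "'e difference_ring \<Rightarrow> laurent \<Rightarrow> (nat \<Rightarrow> 'e) \<Rightarrow> 'e" where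
  "eval_dpoly E f a =
     finsum E (\<lambda>e. rat_embed E (Poly_Mapping.lookup f e) \<otimes>\<^bsub>E\<^esub> vec_pow E a e)
       (Poly_Mapping.keys f)"

definition eval_map ::
  "nat \<Rightarrow> 'e difference_ring \<Rightarrow> (nat \<Rightarrow> laurent) \<Rightarrow> (nat \<Rightarrow> 'e) \<Rightarrow> (nat \<Rightarrow> 'e)" where
  "eval_map n E F a = (\<lambda>i\<in>{..<n}. eval_dpoly E (F i) a)"


section \<open>Difference varieties and the Cohn topology\<close>

text \<open>
  A subfunctor of affine space is a function assigning to every difference field \<open>E\<close> over \<open>\<rat>\<close>
  a set of points \<open>a \<in> E\<^sup>n\<close>, with \<open>E\<^sup>n = {..<n} \<rightarrow>\<^sub>E carrier E\<close> (\<open>y\<^sub>1,\<dots>,y\<^sub>n\<close> have the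
  indices \<open>0,\<dots>,n-1\<close>).  The carriers of the fields \<open>E\<close> are the subsets of the type \<open>'e\<close>,
  which acts as a universe: an infinite \<open>'e\<close> contains a copy of every countable field,
  in particular of every difference field generated by one point.
  A subfunctor is set to \<open>{}\<close> on records that are not difference fields over \<open>\<rat>\<close>, so that
  equality of subfunctors is equality of functions.
\<close>

type_synonym 'e subfunctor = "'e difference_ring \<Rightarrow> (nat \<Rightarrow> 'e) set"

definition torus_points :: "nat \<Rightarrow> 'e subfunctor" where
  "torus_points n E =
     (if difference_field_over_Q E then {..<n} \<rightarrow>\<^sub>E (carrier E - {\<zero>\<^bsub>E\<^esub>}) else {})"

definition variety_of :: "nat \<Rightarrow> laurent set \<Rightarrow> 'e subfunctor" where
  "variety_of n P E =
     (if difference_field_over_Q E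
      then {a \<in> {..<n} \<rightarrow>\<^sub>E carrier E. \<forall>p\<in>P. eval_dpoly E p a = \<zero>\<^bsub>E\<^esub>} else {})"

definition difference_variety :: "nat \<Rightarrow> 'e subfunctor \<Rightarrow> bool" where
  "difference_variety n X \<longleftrightarrow> (\<exists>P. P \<subseteq> carrier (dpoly_ring n) \<and> X = variety_of n P)"

definition defining_ideal :: "nat \<Rightarrow> 'e subfunctor \<Rightarrow> laurent set" where
  "defining_ideal n X =
     {f \<in> carrier (dpoly_ring n). \<forall>E. \<forall>a \<in> X E. eval_dpoly E f a = \<zero>\<^bsub>E\<^esub>}"

definition coordinate_ring :: "nat \<Rightarrow> 'e subfunctor \<Rightarrow> laurent set difference_ring" where
  "coordinate_ring n X = difference_quotient (dpoly_ring n) (defining_ideal n X)"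

definition irreducible_variety :: "nat \<Rightarrow> 'e subfunctor \<Rightarrow> bool" where
  "irreducible_variety n X \<longleftrightarrow> primeideal (defining_ideal n X) (dpoly_ring n)"

definition isomorphic_varieties ::
  "nat \<Rightarrow> 'e subfunctor \<Rightarrow> nat \<Rightarrow> 'e subfunctor \<Rightarrow> bool" where
  "isomorphic_varieties n X n' X' \<longleftrightarrow>
     (\<exists>F G. (\<forall>i<n'. F i \<in> carrier (dpoly_ring n)) \<and> (\<forall>i<n. G i \<in> carrier (dpoly_ring n')) \<and>
       (\<forall>E. (\<forall>a \<in> X E. eval_map n' E F a \<in> X' E \<and> eval_map n E G (eval_map n' E F a) = a) \<and>
            (\<forall>b \<in> X' E. eval_map n E G b \<in> X E \<and> eval_map n' E F (eval_map n E G b) = b)))"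

definition Cohn_closure :: "nat \<Rightarrow> 'e subfunctor \<Rightarrow> 'e subfunctor" where
  "Cohn_closure n V E = \<Inter> {X E | X. difference_variety n X \<and> (\<forall>E'. V E' \<subseteq> X E')}"

definition Cohn_open_in :: "nat \<Rightarrow> 'e subfunctor \<Rightarrow> 'e subfunctor \<Rightarrow> bool" where
  "Cohn_open_in n X U \<longleftrightarrow>
     (\<exists>Z. difference_variety n Z \<and> (\<forall>E. Z E \<subseteq> X E) \<and> (\<forall>E. U E = X E - Z E))"


section \<open>Toric difference varieties\<close>

definition defining_vector :: "nat \<Rightarrow> nat \<Rightarrow> (nat \<Rightarrow> zvec) \<Rightarrow> bool" where
  "defining_vector m n \<alpha> \<longleftrightarrow>
     (\<forall>i<n. \<alpha> i \<in> Zx m) \<and> (\<forall>i<n. \<alpha> i \<noteq> 0) \<and>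
     (\<forall>j<m. \<exists>i<n. Poly_Mapping.lookup (\<alpha> i) j \<noteq> 0)"

definition quasi_torus :: "nat \<Rightarrow> nat \<Rightarrow> (nat \<Rightarrow> zvec) \<Rightarrow> 'e subfunctor" where
  "quasi_torus m n \<alpha> E = (\<lambda>t. \<lambda>i\<in>{..<n}. vec_pow E t (\<alpha> i)) ` torus_points m E"

definition toric_variety :: "nat \<Rightarrow> 'e subfunctor \<Rightarrow> bool" where
  "toric_variety n X \<longleftrightarrow>
     (\<exists>m \<alpha>. defining_vector m n \<alpha> \<and> X = Cohn_closure n (quasi_torus m n \<alpha>))"

text \<open>
  Counterpart for \<open>X\<close> of the convention that no \<open>\<alpha>\<^sub>i\<close> is zero: on the closure of a quasi
  torus the coordinate \<open>y\<^sub>i\<close> is constantly 1 precisely if \<open>\<alpha>\<^sub>i = 0\<close>.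
\<close>

definition no_unit_coordinate :: "nat \<Rightarrow> 'e subfunctor \<Rightarrow> bool" where
  "no_unit_coordinate n X \<longleftrightarrow> (\<forall>i<n. \<exists>E. \<exists>a \<in> X E. a i \<noteq> \<one>\<^bsub>E\<^esub>)"


section \<open>Difference tori and their actions\<close>

definition theta :: "nat \<Rightarrow> 'e difference_ring \<Rightarrow> (nat \<Rightarrow> 'e) \<Rightarrow> (nat \<Rightarrow> 'e)" where
  "theta n E a = (\<lambda>i\<in>{..<2 * n}. if i < n then a i else inv\<^bsub>E\<^esub> (a (i - n)))"

definition theta_image :: "nat \<Rightarrow> 'e subfunctor \<Rightarrow> 'e subfunctor" where
  "theta_image n V E = theta n E ` V E"

definition star_closure :: "nat \<Rightarrow> 'e subfunctor \<Rightarrow> 'e subfunctor" where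
  "star_closure n V E =
     {a \<in> torus_points n E. theta n E a \<in> Cohn_closure (2 * n) (theta_image n V) E}"

definition torus_one :: "nat \<Rightarrow> 'e difference_ring \<Rightarrow> (nat \<Rightarrow> 'e)" where
  "torus_one n E = (\<lambda>i\<in>{..<n}. \<one>\<^bsub>E\<^esub>)"

definition torus_mult ::
  "nat \<Rightarrow> 'e difference_ring \<Rightarrow> (nat \<Rightarrow> 'e) \<Rightarrow> (nat \<Rightarrow> 'e) \<Rightarrow> (nat \<Rightarrow> 'e)" where
  "torus_mult n E a b = (\<lambda>i\<in>{..<n}. a i \<otimes>\<^bsub>E\<^esub> b i)"

definition torus_inv :: "nat \<Rightarrow> 'e difference_ring \<Rightarrow> (nat \<Rightarrow> 'e) \<Rightarrow> (nat \<Rightarrow> 'e)" where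
  "torus_inv n E a = (\<lambda>i\<in>{..<n}. inv\<^bsub>E\<^esub> (a i))"

text \<open>
  A difference torus is only isomorphic to the star closure of a quasi torus (in a possibly
  different dimension), so that being a group under componentwise multiplication has to be
  required: \<open>{(t, 5t)}\<close> is isomorphic to the one-dimensional torus but not a group.
\<close>

definition difference_torus :: "nat \<Rightarrow> 'e subfunctor \<Rightarrow> bool" where
  "difference_torus n T \<longleftrightarrow>
     (\<forall>E. T E \<subseteq> torus_points n E) \<and>
     difference_variety (2 * n) (theta_image n T) \<and>
     (\<exists>m k \<alpha>. defining_vector m k \<alpha> \<and>
        isomorphic_varieties (2 * n) (theta_image n T)
          (2 * k) (theta_image k (star_closure k (quasi_torus m k \<alpha>)))) \<and>
     (\<forall>E. difference_field_over_Q E \<longrightarrow>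
        torus_one n E \<in> T E \<and>
        (\<forall>a \<in> T E. \<forall>b \<in> T E. torus_mult n E a b \<in> T E) \<and>
        (\<forall>a \<in> T E. torus_inv n E a \<in> T E))"

text \<open>
  In an action \<open>\<phi>\<close>, given by difference polynomials in \<open>y\<^sub>1,\<dots>,y\<^sub>n,z\<^sub>1,\<dots>,z\<^sub>n\<close>, the \<open>y\<^sub>i\<close> are
  the coordinates of the torus and the \<open>z\<^sub>i\<close> those of \<open>X\<close>.
\<close>

definition act ::
  "nat \<Rightarrow> (nat \<Rightarrow> laurent) \<Rightarrow> 'e difference_ring \<Rightarrow> (nat \<Rightarrow> 'e) \<Rightarrow> (nat \<Rightarrow> 'e) \<Rightarrow> (nat \<Rightarrow> 'e)" where
  "act n \<phi> E a h = eval_map n E \<phi> (\<lambda>i\<in>{..<2 * n}. if i < n then a i else h (i - n))"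

definition torus_action ::
  "nat \<Rightarrow> 'e subfunctor \<Rightarrow> 'e subfunctor \<Rightarrow> (nat \<Rightarrow> laurent) \<Rightarrow> bool" where
  "torus_action n T X \<phi> \<longleftrightarrow>
     (\<forall>i<n. \<phi> i \<in> carrier (dpoly_ring (2 * n))) \<and>
     (\<forall>E. difference_field_over_Q E \<longrightarrow>
        (\<forall>a \<in> T E. \<forall>h \<in> X E. act n \<phi> E a h \<in> X E) \<and>
        (\<forall>h \<in> X E. act n \<phi> E (torus_one n E) h = h) \<and>
        (\<forall>a \<in> T E. \<forall>b \<in> T E. \<forall>h \<in> X E.
           act n \<phi> E (torus_mult n E a b) h = act n \<phi> E a (act n \<phi> E b h)))"

definition extends_torus_mult :: "nat \<Rightarrow> 'e subfunctor \<Rightarrow> (nat \<Rightarrow> laurent) \<Rightarrow> bool" where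
  "extends_torus_mult n T \<phi> \<longleftrightarrow>
     (\<forall>E. \<forall>a \<in> T E. \<forall>b \<in> T E. act n \<phi> E a b = torus_mult n E a b)"

end

theory Submission
  imports Defs "HOL-Library.Countable_Set" "HOL-Computational_Algebra.Fraction_Field"
begin

text \<open>
  The theorem rests on one object, the toric ideal of vectors \<open>\<alpha>\<^sub>1, \<dots>, \<alpha>\<^sub>n\<close>: the kernel of the
  substitution \<open>y\<^sub>i \<mapsto> \<T>\<^bsup>\<alpha>\<^sub>i\<^esup>\<close> from difference polynomials to Laurent difference polynomials.

  The substitution only moves exponents, by the linear map with columns \<open>\<alpha>\<^sub>i\<close>.  Since the exponent
  group can be ordered, the Laurent ring is a domain; its fraction field is countable and
  therefore has a copy in every infinite universe.  Its indeterminates are a generic point of the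
  torus, and so the defining ideal of the closure of a quasi torus is exactly the toric ideal
  (\<open>generic_point\<close>, \<open>defining_ideal_quasi_torus\<close>).

  Toric ideals are the same as ideals of saturated lattices.  A toric ideal is generated by the
  binomials of the lattice of syzygies of the \<open>\<alpha>\<^sub>i\<close> (\<open>toric_ideal_eq_gen\<close>), and conversely every
  saturated lattice \<open>L\<close> is such a lattice, because \<open>\<int>[x]\<^sup>n / L\<close> is torsion-free and embeds into a
  free module (\<open>saturated_lattice_syzygies\<close>).  This is the characterisation by ideals.

  For the characterisation by coordinate rings, the image of the substitution is \<open>\<rat>{M}\<close> with \<open>M\<close>
  generated by the \<open>\<alpha>\<^sub>i\<close>, and two varieties are isomorphic iff their polynomial rings map onto a
  common ring with the defining ideals as kernels (\<open>isomorphic_varieties_if_same_image\<close>,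
  \<open>presents_isomorphic\<close>).

  For the characterisation by tori, the points of a toric variety with nonzero coordinates are
  given by equations \<open>a\<^sup>f = 1\<close>, \<open>f \<in> L\<close>; they form a difference torus that acts by multiplication
  (\<open>toric_variety_has_torus\<close>).  Conversely, the coordinate functions of a dense torus are units of
  a ring inside the Laurent ring, whose units are terms \<open>c \<T>\<^sup>\<gamma>\<close> (\<open>laurent_unit_is_term\<close>).  The
  exponents \<open>\<gamma>\<^sub>i\<close> define a toric ideal, and that the torus contains the neutral element shows that
  the constants do not disturb it (\<open>toric_variety_if_torus\<close>).
\<close>

abbreviation (input) lookup where "lookup \<equiv> Poly_Mapping.lookup"
abbreviation (input) keys where "keys \<equiv> Poly_Mapping.keys"

section \<open>Exponent vectors\<close>

definition unit_vec :: "nat \<Rightarrow> zvec" where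
  "unit_vec i = Poly_Mapping.single i 1"

text \<open>
  The \<open>\<int>[x]\<close>-linear map \<open>\<int>[x]\<^sup>n \<rightarrow> \<int>[x]\<^sup>m\<close> with columns \<open>\<alpha>\<^sub>i\<close>: substituting \<open>\<T>\<^bsup>\<alpha>\<^sub>i\<^esup>\<close> for
  \<open>y\<^sub>i\<close> turns \<open>\<Y>\<^sup>e\<close> into \<open>\<T>\<close> to the power of this combination.
\<close>

definition lincomb :: "nat \<Rightarrow> (nat \<Rightarrow> zvec) \<Rightarrow> zvec \<Rightarrow> zvec" where
  "lincomb n \<alpha> e = (\<Sum>i<n. zscale (lookup e i) (\<alpha> i))"

lemma lookup_unit_vec: "lookup (unit_vec i) j = (if i = j then 1 else 0)"
  by (simp add: unit_vec_def lookup_single when_def)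

lemma Zx_iff: "e \<in> Zx n \<longleftrightarrow> (\<forall>i\<ge>n. lookup e i = 0)"
  unfolding Zx_def by (simp add: in_keys_iff subset_iff) (meson linorder_not_less)

lemma zvec_subspace_Zx: "zvec.subspace (Zx n)"
  by (auto simp: zvec.subspace_def Zx_iff lookup_add lookup_zscale)

lemma Zx_closed [simp, intro]:
  "0 \<in> Zx n"
  "e \<in> Zx n \<Longrightarrow> f \<in> Zx n \<Longrightarrow> e + f \<in> Zx n"
  "e \<in> Zx n \<Longrightarrow> f \<in> Zx n \<Longrightarrow> e - f \<in> Zx n"
  "e \<in> Zx n \<Longrightarrow> - e \<in> Zx n"
  "e \<in> Zx n \<Longrightarrow> zscale p e \<in> Zx n"
  "i < n \<Longrightarrow> unit_vec i \<in> Zx n"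
  by (auto simp: Zx_iff lookup_add lookup_minus lookup_zscale lookup_unit_vec)

lemma Zx_sum [intro]: "(\<And>i. i \<in> I \<Longrightarrow> f i \<in> Zx n) \<Longrightarrow> (\<Sum>i\<in>I. f i) \<in> Zx n"
  by (rule zvec.subspace_sum[OF zvec_subspace_Zx])

lemma Zx_mono: "n \<le> m \<Longrightarrow> Zx n \<subseteq> Zx m"
  by (auto simp: Zx_def)

lemma Nx_poly_closed [simp, intro]:
  "0 \<in> Nx_poly" "1 \<in> Nx_poly"
  "p \<in> Nx_poly \<Longrightarrow> q \<in> Nx_poly \<Longrightarrow> p + q \<in> Nx_poly"
  "p \<in> Nx_poly \<Longrightarrow> q \<in> Nx_poly \<Longrightarrow> p * q \<in> Nx_poly"
  "[:0, 1:] \<in> Nx_poly"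
  by (auto simp: Nx_poly_def coeff_mult sum_nonneg coeff_1 coeff_pCons split: nat.splits)

lemma Nx_closed [simp, intro]:
  "0 \<in> Nx n"
  "e \<in> Nx n \<Longrightarrow> f \<in> Nx n \<Longrightarrow> e + f \<in> Nx n"
  "p \<in> Nx_poly \<Longrightarrow> e \<in> Nx n \<Longrightarrow> zscale p e \<in> Nx n"
  "i < n \<Longrightarrow> unit_vec i \<in> Nx n"
  by (auto simp: Nx_def lookup_add lookup_zscale lookup_unit_vec)

lemma Nx_sum [intro]: "(\<And>i. i \<in> I \<Longrightarrow> f i \<in> Nx n) \<Longrightarrow> (\<Sum>i\<in>I. f i) \<in> Nx n"
  by (induction I rule: infinite_finite_induct) auto

lemma Nx_subset_Zx: "Nx n \<subseteq> Zx n" by (auto simp: Nx_def)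

lemma Nx_mono: "n \<le> m \<Longrightarrow> Nx n \<subseteq> Nx m"
  using Zx_mono by (auto simp: Nx_def)

lemma lincomb_add: "lincomb n \<alpha> (e + f) = lincomb n \<alpha> e + lincomb n \<alpha> f"
  by (simp add: lincomb_def lookup_add zvec.scale_left_distrib sum.distrib)

lemma lincomb_0 [simp]: "lincomb n \<alpha> 0 = 0"
  by (simp add: lincomb_def)

lemma lincomb_diff: "lincomb n \<alpha> (e - f) = lincomb n \<alpha> e - lincomb n \<alpha> f"
  by (simp add: lincomb_def lookup_minus zvec.scale_left_diff_distrib sum_subtractf)

lemma lincomb_zscale: "lincomb n \<alpha> (zscale p e) = zscale p (lincomb n \<alpha> e)"
  by (simp add: lincomb_def lookup_zscale zvec.scale_sum_right)

lemma lincomb_sum: "lincomb n \<alpha> (\<Sum>i\<in>I. f i) = (\<Sum>i\<in>I. lincomb n \<alpha> (f i))"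
  by (induction I rule: infinite_finite_induct) (auto simp: lincomb_add)

lemma lincomb_unit_vec: "i < n \<Longrightarrow> lincomb n \<alpha> (unit_vec i) = \<alpha> i"
proof -
  assume "i < n"
  have "lincomb n \<alpha> (unit_vec i) = (\<Sum>j<n. if i = j then \<alpha> j else 0)"
    unfolding lincomb_def by (rule sum.cong) (auto simp: lookup_unit_vec)
  thus ?thesis using \<open>i < n\<close> by simp
qed

lemma lincomb_cong: "(\<And>i. i < n \<Longrightarrow> \<alpha> i = \<beta> i) \<Longrightarrow> lincomb n \<alpha> e = lincomb n \<beta> e"
  by (simp add: lincomb_def)

lemma lincomb_in_Zx: "(\<And>i. i < n \<Longrightarrow> \<alpha> i \<in> Zx m) \<Longrightarrow> lincomb n \<alpha> e \<in> Zx m"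
  unfolding lincomb_def by auto

lemma lincomb_unit_vecs: "e \<in> Zx n \<Longrightarrow> lincomb n unit_vec e = e"
  by (rule poly_mapping_eqI)
    (auto simp: lincomb_def lookup_sum lookup_zscale lookup_unit_vec Zx_iff if_distrib
        sum.delta cong: if_cong)

lemma lincomb_lincomb:
  "lincomb m \<beta> (lincomb n \<alpha> e) = lincomb n (\<lambda>i. lincomb m \<beta> (\<alpha> i)) e"
  unfolding lincomb_def[of n] by (simp add: lincomb_sum lincomb_zscale)

lemma lookup_pos_part: "coeff (lookup (pos_part f) i) k = max (coeff (lookup f i) k) 0"
  unfolding pos_part_def by transfer (simp add: when_def coeff_map_poly)

lemma lookup_neg_part: "coeff (lookup (neg_part f) i) k = max (- coeff (lookup f i) k) 0"
  unfolding neg_part_def by transfer (simp add: when_def coeff_map_poly)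

lemma pos_part_minus_neg_part: "pos_part f - neg_part f = f"
  by (intro poly_mapping_eqI poly_eqI)
    (simp add: lookup_minus lookup_pos_part lookup_neg_part max_def)

lemma pos_neg_part_in_Nx:
  assumes "f \<in> Zx n" shows "pos_part f \<in> Nx n" "neg_part f \<in> Nx n"
  using assms by (auto simp: Nx_def Nx_poly_def Zx_iff poly_eq_iff lookup_pos_part lookup_neg_part)

text \<open>
  The vector \<open>c\<close> is the coefficientwise minimum of \<open>a\<close> and \<open>b\<close>.  It makes \<open>\<Y>\<^sup>a - \<Y>\<^sup>b\<close> the multiple
  by \<open>\<Y>\<^sup>c\<close> of the binomial that belongs to \<open>a - b\<close>.
\<close>

lemma common_part:
  assumes "a \<in> Nx n" "b \<in> Nx n"
  obtains c where "c \<in> Nx n" "a = pos_part (a - b) + c" "b = neg_part (a - b) + c"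
proof
  let ?c = "a - pos_part (a - b)"
  show "?c \<in> Nx n"
    using assms by (auto simp: Nx_def Nx_poly_def Zx_iff poly_eq_iff lookup_pos_part lookup_minus)
  show "a = pos_part (a - b) + ?c" by simp
  show "b = neg_part (a - b) + ?c"
    by (intro poly_mapping_eqI poly_eqI)
      (simp add: lookup_minus lookup_add lookup_pos_part lookup_neg_part max_def)
qed

section \<open>Rings spanned by monomials\<close>

text \<open>
  The \<open>\<rat>\<close>-linear extension of \<open>\<T>\<^sup>e \<mapsto> \<T>\<^bsup>A e\<^esup>\<close>.  The shift is the case where \<open>A\<close> is multiplication
  by \<open>x\<close>, the substitution that defines a toric ideal the case of \<^const>\<open>lincomb\<close>.
\<close>

definition expmap :: "(zvec \<Rightarrow> zvec) \<Rightarrow> laurent \<Rightarrow> laurent" where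
  "expmap A f = (\<Sum>e\<in>keys f. Poly_Mapping.single (A e) (lookup f e))"

lemma expmap_superset:
  assumes "finite S" "keys f \<subseteq> S"
  shows "expmap A f = (\<Sum>e\<in>S. Poly_Mapping.single (A e) (lookup f e))"
  unfolding expmap_def using assms by (intro sum.mono_neutral_left) (auto simp: in_keys_iff)

lemma expmap_add: "expmap A (f + g) = expmap A f + expmap A g"
proof -
  let ?S = "keys f \<union> keys g"
  have "expmap A (f + g) = (\<Sum>e\<in>?S. Poly_Mapping.single (A e) (lookup (f + g) e))"
    by (rule expmap_superset) (auto simp: keys_add)
  also have "\<dots> = (\<Sum>e\<in>?S. Poly_Mapping.single (A e) (lookup f e)) +
                  (\<Sum>e\<in>?S. Poly_Mapping.single (A e) (lookup g e))"
    by (simp add: lookup_add single_add sum.distrib)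
  finally show ?thesis by (simp add: expmap_superset[symmetric])
qed

lemma expmap_single [simp]: "expmap A (Poly_Mapping.single e c) = Poly_Mapping.single (A e) c"
  by (simp add: expmap_def)

lemma expmap_0 [simp]: "expmap A 0 = 0" by (simp add: expmap_def)

lemma expmap_diff: "expmap A (f - g) = expmap A f - expmap A g"
  by (metis add_diff_cancel_right' diff_add_cancel expmap_add)

lemma expmap_sum: "expmap A (\<Sum>i\<in>I. f i) = (\<Sum>i\<in>I. expmap A (f i))"
  by (induction I rule: infinite_finite_induct) (auto simp: expmap_add)

lemma laurent_expand: "(f :: laurent) = (\<Sum>e\<in>keys f. Poly_Mapping.single e (lookup f e))"
  by (rule poly_mapping_eqI)
    (auto simp: lookup_sum lookup_single when_def sum.delta in_keys_iff)

lemma laurent_induct [consumes 1, case_names zero single add]: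
  fixes f :: laurent
  assumes "keys f \<subseteq> M"
    and "P 0" and "\<And>e c. e \<in> M \<Longrightarrow> P (Poly_Mapping.single e c)"
    and "\<And>f g. keys f \<subseteq> M \<Longrightarrow> keys g \<subseteq> M \<Longrightarrow> P f \<Longrightarrow> P g \<Longrightarrow> P (f + g)"
  shows "P f"
proof -
  have "keys (\<Sum>e\<in>S. Poly_Mapping.single e (lookup f e)) \<subseteq> M \<and>
        P (\<Sum>e\<in>S. Poly_Mapping.single e (lookup f e))" if "finite S" "S \<subseteq> M" for S
    using that
  proof (induction S)
    case (insert e S)
    have "keys (Poly_Mapping.single e (lookup f e)) \<subseteq> M" using insert.prems by auto
    thus ?case using insert assms(3,4)
      by (auto dest!: keys_add[THEN subsetD])
  qed (use assms in auto)
  from this[OF _ assms(1)] show ?thesis using laurent_expand[of f] by simp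
qed

lemma expmap_mult:
  assumes "\<And>e f. A (e + f) = A e + A f"
  shows "expmap A (f * g) = expmap A f * expmap A g"
proof (induction f rule: laurent_induct[OF subset_UNIV])
  case (2 e c)
  show ?case
    by (induction g rule: laurent_induct[OF subset_UNIV])
      (auto simp: mult_single assms expmap_add distrib_left)
qed (auto simp: expmap_add distrib_right)

lemma expmap_comp: "expmap A (expmap B f) = expmap (\<lambda>e. A (B e)) f"
  by (simp add: expmap_def[of B] expmap_def[of "\<lambda>e. A (B e)"] expmap_sum)

lemma keys_expmap: "keys (expmap A f) \<subseteq> A ` keys f"
proof -
  have "keys (expmap A f) \<subseteq> (\<Union>e\<in>keys f. keys (Poly_Mapping.single (A e) (lookup f e)))"
    unfolding expmap_def by (rule keys_sum)
  thus ?thesis by (force split: if_splits)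
qed

lemma expmap_id: "(\<And>e. e \<in> keys f \<Longrightarrow> A e = e) \<Longrightarrow> expmap A f = f"
  by (subst (3) laurent_expand) (simp add: expmap_def)

lemma laurent_shift_expmap: "laurent_shift = expmap (zscale [:0, 1:])"
  by (simp add: fun_eq_iff laurent_shift_def expmap_def)

lemma laurent_shift_simps:
  "laurent_shift (f + g) = laurent_shift f + laurent_shift g"
  "laurent_shift (f * g) = laurent_shift f * laurent_shift g"
  "laurent_shift (Poly_Mapping.single e c) = Poly_Mapping.single (zscale [:0, 1:] e) c"
  "laurent_shift 0 = 0" "laurent_shift 1 = 1"
  "laurent_shift (monomial e) = monomial (zscale [:0, 1:] e)"
  by (auto simp: laurent_shift_expmap expmap_add expmap_mult zvec.scale_right_distrib monomial_def
      simp flip: single_one)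

lemma zscale_inj: "p \<noteq> 0 \<Longrightarrow> zscale p e = zscale p f \<Longrightarrow> e = f"
  by (rule poly_mapping_eqI) (metis lookup_zscale mult_left_cancel)

lemma lookup_expmap:
  "lookup (expmap A f) v = (\<Sum>e\<in>{e\<in>keys f. A e = v}. lookup f e)"
proof -
  have "lookup (expmap A f) v = (\<Sum>e\<in>keys f. lookup f e when A e = v)"
    by (simp add: expmap_def lookup_sum lookup_single)
  also have "\<dots> = (\<Sum>e\<in>{e\<in>keys f. A e = v}. lookup f e)"
    by (simp add: when_def sum.inter_filter)
  finally show ?thesis .
qed

text \<open>
  Multiplication by \<open>x\<close> is injective on exponents, so the shift never merges two terms.
\<close>

lemma laurent_shift_inj: "laurent_shift f = 0 \<Longrightarrow> f = 0"
proof (rule poly_mapping_eqI)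
  fix v assume "laurent_shift f = 0"
  moreover have "{e \<in> keys f. zscale [:0, 1:] e = zscale [:0, 1:] v} = (if v \<in> keys f then {v} else {})"
    by (auto dest: zscale_inj[rotated])
  ultimately show "lookup f v = lookup 0 v"
    using lookup_expmap[of "zscale [:0,1:]" f "zscale [:0,1:] v"]
    by (auto simp: laurent_shift_expmap in_keys_iff split: if_splits)
qed

lemma monomial_add: "monomial (e + f) = monomial e * monomial f"
  by (simp add: monomial_def mult_single)

lemma monomial_0: "monomial 0 = 1" by (simp add: monomial_def)

text \<open>
  These are exactly the \<open>\<nat>[x]\<close>-submodules of the exponent group, phrased through what makes
  \<open>\<rat>{M}\<close> closed under products and under the shift.
\<close>

definition exponent_monoid :: "zvec set \<Rightarrow> bool" where
  "exponent_monoid M \<longleftrightarrow> 0 \<in> M \<and> (\<forall>e\<in>M. \<forall>f\<in>M. e + f \<in> M) \<and> (\<forall>e\<in>M. zscale [:0, 1:] e \<in> M)"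

lemma exponent_monoid_Nx [simp]: "exponent_monoid (Nx n)"
  and exponent_monoid_Zx [simp]: "exponent_monoid (Zx n)"
  and exponent_monoid_UNIV [simp]: "exponent_monoid UNIV"
  by (auto simp: exponent_monoid_def)

lemma module_ring_simps [simp]:
  "carrier (module_ring M) = {f. keys f \<subseteq> M}"
  "f \<otimes>\<^bsub>module_ring M\<^esub> g = f * g" "\<one>\<^bsub>module_ring M\<^esub> = 1"
  "f \<oplus>\<^bsub>module_ring M\<^esub> g = f + g" "\<zero>\<^bsub>module_ring M\<^esub> = 0"
  "shift (module_ring M) = laurent_shift"
  by (simp_all add: module_ring_def)

lemma keys_laurent_mult: "keys f \<subseteq> M \<Longrightarrow> keys g \<subseteq> M \<Longrightarrow> exponent_monoid M \<Longrightarrow> keys (f * g) \<subseteq> M"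
proof
  fix v assume "keys f \<subseteq> M" "keys g \<subseteq> M" "exponent_monoid M" "v \<in> keys (f * g)"
  moreover from this obtain a b where "v = a + b" "a \<in> keys f" "b \<in> keys g"
    using keys_mult[of f g] by auto
  ultimately show "v \<in> M" unfolding exponent_monoid_def by blast
qed

lemma keys_laurent_add: "keys f \<subseteq> M \<Longrightarrow> keys g \<subseteq> M \<Longrightarrow> keys (f + g) \<subseteq> M"
  using keys_add[of f g] by blast

lemma cring_module_ring:
  assumes M: "exponent_monoid M" shows "cring (module_ring M)"
proof (rule cringI)
  show "abelian_group (module_ring M)"
  proof (rule abelian_groupI)
    fix f :: laurent assume "f \<in> carrier (module_ring M)"
    thus "\<exists>g\<in>carrier (module_ring M). g \<oplus>\<^bsub>module_ring M\<^esub> f = \<zero>\<^bsub>module_ring M\<^esub>"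
      by (intro bexI[of _ "- f"]) (auto simp: in_keys_iff)
  qed (auto simp: keys_laurent_add add_ac)
  show "comm_monoid (module_ring M)"
    using M by (intro comm_monoidI)
      (auto simp: mult_ac keys_laurent_mult exponent_monoid_def)
qed (auto simp: distrib_right)

section \<open>Monomials in difference algebras over the rationals\<close>

text \<open>
  A common frame for the two kinds of rings in which difference polynomials are evaluated:
  difference fields over \<open>\<rat>\<close>, where the points live, and the rings \<open>\<rat>{M}\<close>, into which one
  substitutes.  Positive integers have to be units for \<^const>\<open>rat_embed\<close> to mean anything.
\<close>

locale difference_Q_algebra = cring R for R :: "'a difference_ring" (structure) +
  assumes shift_hom: "shift R \<in> ring_hom R R"
    and nat_unit: "0 < (k::nat) \<Longrightarrow> [k] \<cdot> \<one> \<in> Units R"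
begin

text \<open>
  A power \<open>x\<^sup>k\<close> is used either with \<open>k \<ge> 0\<close> or at a unit \<open>x\<close>.  Carrying this disjunction along
  treats difference polynomials at arbitrary points and Laurent polynomials at torus points
  at the same time.
\<close>

definition pow_ok :: "'a \<Rightarrow> int \<Rightarrow> bool" where
  "pow_ok x k \<longleftrightarrow> x \<in> carrier R \<and> (0 \<le> k \<or> x \<in> Units R)"

text \<open>
  Transfers the power laws from the group of units.
\<close>

lemma units_of_int_pow: "x \<in> Units R \<Longrightarrow> x [^]\<^bsub>units_of R\<^esub> (k::int) = x [^] k"
proof -
  assume x: "x \<in> Units R"
  have pw: "x [^] n \<in> Units R" for n :: nat
    by (metis x group.is_monoid monoid.nat_pow_closed units_group units_of_carrier units_of_pow)
  have "x [^]\<^bsub>units_of R\<^esub> n = x [^] n" for n :: nat by (rule units_of_pow[OF x])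
  thus ?thesis
    by (cases "k < 0") (simp_all only: int_pow_def2 if_True if_False units_of_inv[OF pw])
qed

lemma int_pow_Units: "x \<in> Units R \<Longrightarrow> x [^] (k::int) \<in> Units R"
  using group.int_pow_closed[OF units_group, of x k] by (simp add: units_of_int_pow units_of_carrier)

lemma pow_okE:
  assumes "pow_ok x k"
  obtains (unit) "x \<in> Units R" | (nat) m where "x \<in> carrier R" "k = int m"
  using assms unfolding pow_ok_def by (metis nonneg_int_cases)

lemma pow_ok_closed: "pow_ok x k \<Longrightarrow> x [^] k \<in> carrier R"
  by (erule pow_okE) (simp_all add: int_pow_Units[THEN Units_closed] int_pow_int)

lemma pow_ok_add:
  assumes "pow_ok x k" "pow_ok x l"
  shows "x [^] (k + l) = x [^] k \<otimes> x [^] l"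
proof (cases "x \<in> Units R")
  case True
  thus ?thesis using group.int_pow_mult[OF units_group, of x k l]
    by (simp add: units_of_int_pow units_of_carrier units_of_mult)
next
  case False
  with assms obtain m m' where "x \<in> carrier R" "k = int m" "l = int m'"
    by (metis pow_okE)
  thus ?thesis by (simp add: int_pow_int nat_pow_mult flip: of_nat_add)
qed

lemma pow_ok_mult:
  assumes "pow_ok x k" "pow_ok y k"
  shows "(x \<otimes> y) [^] k = x [^] k \<otimes> y [^] k"
proof (cases "0 \<le> k")
  case True
  then obtain m where "k = int m" by (metis nonneg_int_cases)
  thus ?thesis using assms by (simp add: int_pow_int nat_pow_distrib pow_ok_def)
next
  case False
  with assms show ?thesis
    using comm_group.int_pow_distrib[OF units_comm_group, of x y k]
    by (simp add: units_of_int_pow units_of_carrier units_of_mult pow_ok_def)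
qed

lemma int_pow_one [simp]: "x \<in> carrier R \<Longrightarrow> x [^] (1::int) = x"
  using int_pow_int[of R x 1] by simp

end

locale difference_Q_hom =
  R: difference_Q_algebra R + S: difference_Q_algebra S
  for R :: "'a difference_ring" (structure) and S :: "'b difference_ring" (structure) +
  fixes h
  assumes hom: "h \<in> ring_hom R S"
    and hom_shift: "a \<in> carrier R \<Longrightarrow> h (shift R a) = shift S (h a)"
begin

sublocale ring_hom_cring R S h
  by unfold_locales (rule hom)

lemma hom_Units: "x \<in> Units R \<Longrightarrow> h x \<in> Units S"
  unfolding Units_def by (auto, metis hom_closed hom_mult hom_one)

lemma hom_inv: "x \<in> Units R \<Longrightarrow> h (inv x) = inv\<^bsub>S\<^esub> (h x)"
  by (metis R.Units_closed R.Units_inv_closed R.Units_l_inv S.inv_char R.Units_r_inv hom_closed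
      hom_mult hom_one S.m_comm)

lemma hom_nat_pow: "x \<in> carrier R \<Longrightarrow> h (x [^] (k::nat)) = h x [^]\<^bsub>S\<^esub> k"
  by (induction k) auto

lemma hom_int_pow:
  assumes "R.pow_ok x k" shows "h (x [^] k) = h x [^]\<^bsub>S\<^esub> k"
proof (cases "k < 0")
  case True
  hence "x \<in> Units R" using assms by (auto simp: R.pow_ok_def)
  hence "x [^] nat (- k) \<in> Units R"
    using R.int_pow_Units[of x "- k"] True by (simp add: pow_nat)
  thus ?thesis using True \<open>x \<in> Units R\<close>
    by (simp only: int_pow_def2 if_True hom_inv hom_nat_pow R.Units_closed)
next
  case False
  then obtain m where "k = int m" by (metis nonneg_int_cases not_less)
  thus ?thesis using assms by (simp add: int_pow_int hom_nat_pow R.pow_ok_def)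
qed

lemma hom_pow_ok: "R.pow_ok x k \<Longrightarrow> S.pow_ok (h x) k"
  by (auto simp: R.pow_ok_def S.pow_ok_def hom_Units)

end

context difference_Q_algebra
begin

lemma shift_endo: "difference_Q_hom R R (shift R)"
  using shift_hom by unfold_locales auto

sublocale shift: difference_Q_hom R R "shift R" by (rule shift_endo)

lemma shift_pow_closed [simp]: "x \<in> carrier R \<Longrightarrow> (shift R ^^ k) x \<in> carrier R"
  by (induction k) auto

lemma shift_pow_Units: "x \<in> Units R \<Longrightarrow> (shift R ^^ k) x \<in> Units R"
  by (induction k) (auto simp: shift.hom_Units)

lemma shift_pow_ok: "pow_ok x c \<Longrightarrow> pow_ok ((shift R ^^ k) x) c"
  by (auto simp: pow_ok_def shift_pow_Units)

definition admissible :: "nat \<Rightarrow> (nat \<Rightarrow> 'a) \<Rightarrow> zvec set" where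
  "admissible n a = {e \<in> Zx n. \<forall>i<n. \<forall>k. pow_ok (a i) (coeff (lookup e i) k)}"

lemma admissible_Nx: "a \<in> {..<n} \<rightarrow> carrier R \<Longrightarrow> Nx n \<subseteq> admissible n a"
  by (auto simp: admissible_def Nx_def Nx_poly_def pow_ok_def)

lemma admissible_Zx: "a \<in> {..<n} \<rightarrow> Units R \<Longrightarrow> Zx n \<subseteq> admissible n a"
  by (auto simp: admissible_def pow_ok_def)

lemma admissible_closed:
  assumes "a \<in> {..<n} \<rightarrow> carrier R" shows "exponent_monoid (admissible n a)"
proof -
  have "pow_ok x (c + d)" if "pow_ok x c" "pow_ok x d" for x c d
    using that by (auto simp: pow_ok_def)
  thus ?thesis using assms
    by (auto simp: exponent_monoid_def admissible_def lookup_add lookup_zscale coeff_pCons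
      split: nat.splits) (auto simp: pow_ok_def)
qed

lemma elem_pow_eq:
  assumes "\<And>k. pow_ok x (coeff p k)" "degree p \<le> N"
  shows "elem_pow R x p = (\<Otimes>k\<in>{..N}. ((shift R ^^ k) x) [^] coeff p k)"
  unfolding elem_pow_def using assms
  by (intro finprod_mono_neutral_cong_left)
    (auto simp: coeff_eq_0 intro!: pow_ok_closed shift_pow_ok)

text \<open>
  Index ranges that do not depend on the exponent make \<open>a\<^sup>e\<close> comparable for different \<open>e\<close>.
\<close>

lemma vec_pow_eq:
  assumes "e \<in> admissible n a" "\<And>i. degree (lookup e i) \<le> N"
  shows "vec_pow R a e = (\<Otimes>i\<in>{..<n}. \<Otimes>k\<in>{..N}. ((shift R ^^ k) (a i)) [^] coeff (lookup e i) k)"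
  unfolding vec_pow_def
proof (rule finprod_mono_neutral_cong_left)
  show "keys e \<subseteq> {..<n}" using assms by (auto simp: admissible_def Zx_def)
  show "(\<Otimes>k\<in>{..N}. ((shift R ^^ k) (a i)) [^] coeff (lookup e i) k) = \<one>" if "i \<in> {..<n} - keys e" for i
    using that by (simp add: in_keys_iff)
  show "elem_pow R (a i) (lookup e i) = (\<Otimes>k\<in>{..N}. ((shift R ^^ k) (a i)) [^] coeff (lookup e i) k)"
    if "i \<in> keys e" for i
    using assms that by (intro elem_pow_eq) (auto simp: admissible_def Zx_def)
  show "(\<lambda>i. \<Otimes>k\<in>{..N}. ((shift R ^^ k) (a i)) [^] coeff (lookup e i) k) \<in> {..<n} \<rightarrow> carrier R"
    using assms by (auto simp: admissible_def intro!: finprod_closed pow_ok_closed shift_pow_ok)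
qed simp

lemma degree_bound: "\<exists>N. \<forall>i. degree (lookup (e :: zvec) i) \<le> N"
proof (intro exI allI)
  fix i
  show "degree (lookup e i) \<le> (\<Sum>j\<in>keys e. degree (lookup e j))"
    by (cases "i \<in> keys e") (auto simp: in_keys_iff intro: member_le_sum)
qed

lemma admissible_coeff:
  "e \<in> admissible n a \<Longrightarrow> i < n \<Longrightarrow> ((shift R ^^ k) (a i)) [^] coeff (lookup e i) k \<in> carrier R"
  by (auto simp: admissible_def intro!: pow_ok_closed shift_pow_ok)

lemma vec_pow_closed:
  assumes "e \<in> admissible n a" shows "vec_pow R a e \<in> carrier R"
proof -
  obtain N where "\<forall>i. degree (lookup e i) \<le> N" using degree_bound by blast
  thus ?thesis using assms
    by (subst vec_pow_eq[of _ n _ N]) (auto intro!: finprod_closed admissible_coeff)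
qed

lemma vec_pow_0 [simp]: "vec_pow R a 0 = \<one>"
  by (simp add: vec_pow_def)

lemma vec_pow_add:
  assumes e: "e \<in> admissible n a" and f: "f \<in> admissible n a"
  shows "vec_pow R a (e + f) = vec_pow R a e \<otimes> vec_pow R a f"
proof -
  obtain N1 where N1: "\<forall>i. degree (lookup e i) \<le> N1" using degree_bound by blast
  obtain N2 where N2: "\<forall>i. degree (lookup f i) \<le> N2" using degree_bound by blast
  define N where "N = max N1 N2"
  have a: "a \<in> {..<n} \<rightarrow> carrier R" using e by (auto simp: admissible_def pow_ok_def)
  have "e + f \<in> admissible n a"
    using admissible_closed[OF a] e f by (auto simp: exponent_monoid_def)
  moreover have N: "degree (lookup e i) \<le> N" "degree (lookup f i) \<le> N"
    "degree (lookup (e + f) i) \<le> N" for i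
    using N1 N2 degree_add_le_max[of "lookup e i" "lookup f i"]
    by (auto simp: N_def lookup_add le_max_iff_disj intro: order_trans)
  ultimately have "vec_pow R a (e + f) =
      (\<Otimes>i\<in>{..<n}. \<Otimes>k\<in>{..N}. ((shift R ^^ k) (a i)) [^] coeff (lookup (e + f) i) k)"
    by (intro vec_pow_eq)
  also have "\<dots> = (\<Otimes>i\<in>{..<n}. \<Otimes>k\<in>{..N}. ((shift R ^^ k) (a i)) [^] coeff (lookup e i) k \<otimes>
      ((shift R ^^ k) (a i)) [^] coeff (lookup f i) k)"
    using e f by (intro finprod_cong' refl)
      (auto simp: lookup_add admissible_def intro!: pow_ok_add finprod_closed pow_ok_closed shift_pow_ok)
  also have "\<dots> = (\<Otimes>i\<in>{..<n}. (\<Otimes>k\<in>{..N}. ((shift R ^^ k) (a i)) [^] coeff (lookup e i) k) \<otimes>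
      (\<Otimes>k\<in>{..N}. ((shift R ^^ k) (a i)) [^] coeff (lookup f i) k))"
    using e f by (intro finprod_cong' refl finprod_multf)
      (auto intro!: finprod_closed admissible_coeff)
  also have "\<dots> = vec_pow R a e \<otimes> vec_pow R a f"
    using e f N by (subst finprod_multf)
      (auto simp: vec_pow_eq[of _ n _ N] intro!: finprod_closed admissible_coeff)
  finally show ?thesis .
qed

lemma vec_pow_mult:
  assumes a: "e \<in> admissible n a" and b: "e \<in> admissible n b" and c: "\<And>i. i < n \<Longrightarrow> c i = a i \<otimes> b i"
  shows "vec_pow R c e = vec_pow R a e \<otimes> vec_pow R b e"
proof -
  obtain N where N: "\<forall>i. degree (lookup e i) \<le> N" using degree_bound by blast
  have hom: "(shift R ^^ k) (x \<otimes> y) = (shift R ^^ k) x \<otimes> (shift R ^^ k) y"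
    if "x \<in> carrier R" "y \<in> carrier R" for x y k
    using that by (induction k) auto
  have "e \<in> admissible n c"
    using a b c by (auto simp: admissible_def pow_ok_def)
  hence "vec_pow R c e =
      (\<Otimes>i\<in>{..<n}. \<Otimes>k\<in>{..N}. ((shift R ^^ k) (c i)) [^] coeff (lookup e i) k)"
    using N by (intro vec_pow_eq) auto
  also have "\<dots> = (\<Otimes>i\<in>{..<n}. \<Otimes>k\<in>{..N}. ((shift R ^^ k) (a i)) [^] coeff (lookup e i) k \<otimes>
      ((shift R ^^ k) (b i)) [^] coeff (lookup e i) k)"
  proof (intro finprod_cong' refl)
    fix i k assume "i \<in> {..<n}"
    hence ok: "pow_ok (a i) (coeff (lookup e i) k)" "pow_ok (b i) (coeff (lookup e i) k)"
      using a b by (auto simp: admissible_def)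
    hence "(shift R ^^ k) (c i) = (shift R ^^ k) (a i) \<otimes> (shift R ^^ k) (b i)"
      using \<open>i \<in> _\<close> by (auto simp: c pow_ok_def intro!: hom)
    thus "((shift R ^^ k) (c i)) [^] coeff (lookup e i) k =
        ((shift R ^^ k) (a i)) [^] coeff (lookup e i) k \<otimes> ((shift R ^^ k) (b i)) [^] coeff (lookup e i) k"
      using ok by (simp add: pow_ok_mult shift_pow_ok)
  qed (use a b in \<open>auto intro!: finprod_closed admissible_coeff m_closed\<close>)
  also have "\<dots> = (\<Otimes>i\<in>{..<n}. (\<Otimes>k\<in>{..N}. ((shift R ^^ k) (a i)) [^] coeff (lookup e i) k) \<otimes>
      (\<Otimes>k\<in>{..N}. ((shift R ^^ k) (b i)) [^] coeff (lookup e i) k))"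
    using a b by (intro finprod_cong' refl finprod_multf)
      (auto intro!: finprod_closed admissible_coeff)
  also have "\<dots> = vec_pow R a e \<otimes> vec_pow R b e"
    using a b N by (subst finprod_multf)
      (auto simp: vec_pow_eq[of _ n _ N] intro!: finprod_closed admissible_coeff)
  finally show ?thesis .
qed

lemma vec_pow_cong:
  assumes e: "e \<in> admissible n a" and ab: "\<And>i. i < n \<Longrightarrow> a i = b i"
  shows "vec_pow R a e = vec_pow R b e"
proof -
  obtain N where N: "\<forall>i. degree (lookup e i) \<le> N" using degree_bound by blast
  have e': "e \<in> admissible n b" using e ab by (auto simp: admissible_def)
  show ?thesis
    unfolding vec_pow_eq[OF e N[rule_format]] vec_pow_eq[OF e' N[rule_format]]
    by (intro finprod_cong' refl) (auto simp: ab intro!: finprod_closed admissible_coeff[OF e'])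
qed

lemma vec_pow_shift:
  assumes e: "e \<in> admissible n a"
  shows "vec_pow R a (zscale [:0, 1:] e) = shift R (vec_pow R a e)"
proof -
  obtain N where N: "\<forall>i. degree (lookup e i) \<le> N" using degree_bound by blast
  let ?x = "[:0, 1:] :: int poly"
  have a: "a \<in> {..<n} \<rightarrow> carrier R" using e by (auto simp: admissible_def pow_ok_def)
  have xe: "zscale ?x e \<in> admissible n a"
    using admissible_closed[OF a] e by (auto simp: exponent_monoid_def)
  have "degree (lookup (zscale ?x e) i) \<le> Suc N" for i
    using N by (auto simp: lookup_zscale intro: order_trans[OF degree_pCons_le])
  hence "vec_pow R a (zscale ?x e) =
      (\<Otimes>i\<in>{..<n}. \<Otimes>k\<in>{..Suc N}. ((shift R ^^ k) (a i)) [^] coeff (lookup (zscale ?x e) i) k)"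
    using xe by (intro vec_pow_eq) auto
  also have "\<dots> = (\<Otimes>i\<in>{..<n}. \<Otimes>k\<in>{..N}. shift R (((shift R ^^ k) (a i)) [^] coeff (lookup e i) k))"
  proof (rule finprod_cong'[OF refl])
    fix i assume i: "i \<in> {..<n}"
    have "(\<Otimes>k\<in>{..Suc N}. ((shift R ^^ k) (a i)) [^] coeff (lookup (zscale ?x e) i) k) =
      (\<Otimes>k\<in>{..N}. ((shift R ^^ Suc k) (a i)) [^] coeff (lookup (zscale ?x e) i) (Suc k)) \<otimes>
      ((shift R ^^ 0) (a i)) [^] coeff (lookup (zscale ?x e) i) 0"
      using xe i by (intro finprod_Suc2) (auto intro: admissible_coeff)
    also have "\<dots> = (\<Otimes>k\<in>{..N}. ((shift R ^^ Suc k) (a i)) [^] coeff (lookup e i) k)"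
      using admissible_coeff[OF xe, of i "Suc _"] i
      by (auto simp: lookup_zscale intro!: r_one finprod_closed)
    also have "\<dots> = (\<Otimes>k\<in>{..N}. shift R (((shift R ^^ k) (a i)) [^] coeff (lookup e i) k))"
    proof (intro finprod_cong' refl)
      show "((shift R ^^ Suc k) (a i)) [^] coeff (lookup e i) k =
          shift R (((shift R ^^ k) (a i)) [^] coeff (lookup e i) k)" for k
        using e i by (simp add: admissible_def shift_pow_ok shift.hom_int_pow)
    qed (use i admissible_coeff[OF e] in \<open>auto intro: shift.hom_closed\<close>)
    finally show "(\<Otimes>k\<in>{..Suc N}. ((shift R ^^ k) (a i)) [^] coeff (lookup (zscale ?x e) i) k) =
      (\<Otimes>k\<in>{..N}. shift R (((shift R ^^ k) (a i)) [^] coeff (lookup e i) k))" .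
  qed (use e in \<open>auto intro!: finprod_closed admissible_coeff\<close>)
  also have "\<dots> = shift R (vec_pow R a e)"
    using e N by (simp add: vec_pow_eq[of _ n _ N] shift.hom_finprod Pi_def o_def admissible_coeff
      cong: finprod_cong)
  finally show ?thesis .
qed

end

context difference_Q_hom
begin

lemma hom_shift_pow: "x \<in> carrier R \<Longrightarrow> h ((shift R ^^ k) x) = (shift S ^^ k) (h x)"
  by (induction k) (auto simp: hom_shift)

lemma hom_admissible: "e \<in> R.admissible n a \<Longrightarrow> e \<in> S.admissible n (\<lambda>i. h (a i))"
  by (auto simp: R.admissible_def S.admissible_def hom_pow_ok)

lemma hom_vec_pow:
  assumes e: "e \<in> R.admissible n a"
  shows "h (vec_pow R a e) = vec_pow S (\<lambda>i. h (a i)) e"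
proof -
  obtain N where N: "\<And>i. degree (lookup e i) \<le> N" using R.degree_bound by blast
  have e': "e \<in> S.admissible n (\<lambda>i. h (a i))" using e by (rule hom_admissible)
  have "h (vec_pow R a e) = (\<Otimes>\<^bsub>S\<^esub>i\<in>{..<n}. h (\<Otimes>k\<in>{..N}. ((shift R ^^ k) (a i)) [^] coeff (lookup e i) k))"
    unfolding R.vec_pow_eq[OF e N]
    by (subst hom_finprod) (auto simp: o_def intro!: R.finprod_closed R.admissible_coeff[OF e])
  also have "\<dots> = (\<Otimes>\<^bsub>S\<^esub>i\<in>{..<n}. \<Otimes>\<^bsub>S\<^esub>k\<in>{..N}. ((shift S ^^ k) (h (a i))) [^]\<^bsub>S\<^esub> coeff (lookup e i) k)"
  proof (rule S.finprod_cong'[OF refl])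
    fix i assume i: "i \<in> {..<n}"
    hence ok: "R.pow_ok (a i) (coeff (lookup e i) k)" for k
      using e by (auto simp: R.admissible_def)
    have "h (\<Otimes>k\<in>{..N}. ((shift R ^^ k) (a i)) [^] coeff (lookup e i) k) =
      (\<Otimes>\<^bsub>S\<^esub>k\<in>{..N}. h (((shift R ^^ k) (a i)) [^] coeff (lookup e i) k))"
      using i by (subst hom_finprod) (auto simp: o_def intro!: R.admissible_coeff[OF e])
    also have "\<dots> = (\<Otimes>\<^bsub>S\<^esub>k\<in>{..N}. ((shift S ^^ k) (h (a i))) [^]\<^bsub>S\<^esub> coeff (lookup e i) k)"
    proof (rule S.finprod_cong'[OF refl])
      show "h (((shift R ^^ k) (a i)) [^] coeff (lookup e i) k) =
          ((shift S ^^ k) (h (a i))) [^]\<^bsub>S\<^esub> coeff (lookup e i) k" for k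
        using hom_int_pow[OF R.shift_pow_ok[OF ok[of k]]] hom_shift_pow ok[of k]
        by (simp add: R.pow_ok_def)
    qed (use i S.admissible_coeff[OF e'] in auto)
    finally show "h (\<Otimes>k\<in>{..N}. ((shift R ^^ k) (a i)) [^] coeff (lookup e i) k) =
      (\<Otimes>\<^bsub>S\<^esub>k\<in>{..N}. ((shift S ^^ k) (h (a i))) [^]\<^bsub>S\<^esub> coeff (lookup e i) k)" .
  qed (auto intro!: S.finprod_closed S.admissible_coeff[OF e'])
  finally show ?thesis unfolding S.vec_pow_eq[OF e' N] .
qed

end

context difference_Q_algebra
begin

section \<open>Characters of the exponent group\<close>

lemma vec_pow_unit_vec:
  assumes "i < n" "a i \<in> carrier R"
  shows "vec_pow R a (unit_vec i) = a i"
proof -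
  have "elem_pow R (a i) 1 = a i"
    using assms by (simp add: elem_pow_def)
  thus ?thesis using assms by (simp add: vec_pow_def unit_vec_def)
qed

text \<open>
  Multiplicative maps on \<open>\<int>[x]\<^sup>n\<close> that turn multiplication by \<open>x\<close> into the shift.  Identities
  between monomials hold because both sides are such maps and agree on the unit vectors.
\<close>

definition difference_character :: "nat \<Rightarrow> (zvec \<Rightarrow> 'a) \<Rightarrow> bool" where
  "difference_character n \<chi> \<longleftrightarrow> \<chi> 0 = \<one> \<and> (\<forall>v\<in>Zx n. \<chi> v \<in> carrier R \<and>
     \<chi> (zscale [:0, 1:] v) = shift R (\<chi> v) \<and> (\<forall>w\<in>Zx n. \<chi> (v + w) = \<chi> v \<otimes> \<chi> w))"

context
  fixes \<chi> :: "zvec \<Rightarrow> 'a" and n :: nat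
  assumes \<chi>: "difference_character n \<chi>"
begin

lemma character_closed: "v \<in> Zx n \<Longrightarrow> \<chi> v \<in> carrier R"
  and character_add: "v \<in> Zx n \<Longrightarrow> w \<in> Zx n \<Longrightarrow> \<chi> (v + w) = \<chi> v \<otimes> \<chi> w"
  and character_0: "\<chi> 0 = \<one>"
  and character_shift: "v \<in> Zx n \<Longrightarrow> \<chi> (zscale [:0, 1:] v) = shift R (\<chi> v)"
  using \<chi> by (auto simp: difference_character_def)

lemma character_Units:
  assumes "v \<in> Zx n" shows "\<chi> v \<in> Units R"
proof -
  have "\<chi> v \<otimes> \<chi> (- v) = \<one>" "\<chi> (- v) \<otimes> \<chi> v = \<one>"
    using assms character_add[of v "- v"] character_add[of "- v" v] by (simp_all add: character_0)
  moreover have "\<chi> v \<in> carrier R" "\<chi> (- v) \<in> carrier R"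
    using assms by (auto intro!: character_closed)
  ultimately show ?thesis unfolding Units_def by blast
qed

lemma character_uminus: "v \<in> Zx n \<Longrightarrow> \<chi> (- v) = inv (\<chi> v)"
  using character_add[of v "- v"]
  by (intro comm_inv_char[symmetric]) (auto simp: character_0 character_closed)

lemma character_sum:
  assumes "\<And>i. i \<in> I \<Longrightarrow> v i \<in> Zx n" "finite I"
  shows "\<chi> (\<Sum>i\<in>I. v i) = (\<Otimes>i\<in>I. \<chi> (v i))"
  using assms(2,1)
proof (induction I)
  case (insert i I)
  hence "(\<Sum>i\<in>I. v i) \<in> Zx n" by auto
  with insert show ?case by (simp add: character_add character_closed Pi_def)
qed (simp add: character_0)

lemma character_int_scale:
  assumes v: "v \<in> Zx n" shows "\<chi> (zscale [:c:] v) = \<chi> v [^] c"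
proof -
  have nat: "\<chi> (zscale [:int k:] v) = \<chi> v [^] int k" for k
  proof (induction k)
    case 0
    have "zscale 0 v = 0" by (rule zvec.scale_zero_left)
    thus ?case by (simp add: character_0)
  next
    case (Suc k)
    have "zscale [:int (Suc k):] v = zscale [:int k:] v + v"
      by (rule poly_mapping_eqI) (simp add: lookup_zscale lookup_add smult_add_left add.commute)
    with Suc show ?case using v
      by (simp add: character_add int_pow_int del: of_nat_Suc)
  qed
  show ?thesis
  proof (cases "0 \<le> c")
    case True thus ?thesis using nat[of "nat c"] by simp
  next
    case False
    hence "zscale [:c:] v = - zscale [:int (nat (- c)):] v"
      by (intro poly_mapping_eqI) (simp add: lookup_zscale)
    hence "\<chi> (zscale [:c:] v) = inv (\<chi> v [^] int (nat (- c)))"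
      using v by (simp only: character_uminus Zx_closed nat)
    also have "\<dots> = \<chi> v [^] c"
      using False by (simp only: int_pow_def2 int_pow_int) simp
    finally show ?thesis .
  qed
qed

lemma character_shift_scale:
  assumes v: "v \<in> Zx n"
  shows "\<chi> (zscale (Polynomial.monom c k) v) = (shift R ^^ k) (\<chi> v) [^] c"
proof -
  have "\<chi> (zscale (Polynomial.monom 1 k) v) = (shift R ^^ k) (\<chi> v)"
  proof (induction k)
    case (Suc k)
    have "zscale (Polynomial.monom 1 (Suc k)) v = zscale [:0, 1:] (zscale (Polynomial.monom 1 k) v)"
      by (simp add: zvec.scale_scale monom_Suc)
    thus ?case using Suc v by (simp only: character_shift Zx_closed) simp
  qed (simp add: monom_0 flip: one_pCons)
  moreover have "zscale (Polynomial.monom c k) v = zscale [:c:] (zscale (Polynomial.monom 1 k) v)"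
    by (simp add: zvec.scale_scale smult_monom)
  ultimately show ?thesis using v by (simp only: character_int_scale Zx_closed)
qed

text \<open>
  An exponent is a sum of vectors \<open>c x\<^sup>k \<epsilon>\<^sub>i\<close> with integers \<open>c\<close> and unit vectors \<open>\<epsilon>\<^sub>i\<close>, and
  multiplicativity together with the shift determines the value at each of them.
\<close>

lemma character_eq_vec_pow:
  assumes v: "v \<in> Zx n"
  shows "\<chi> v = vec_pow R (\<lambda>i. \<chi> (unit_vec i)) v"
proof -
  obtain N where N: "\<And>i. degree (lookup v i) \<le> N" using degree_bound by blast
  have v': "v \<in> admissible n (\<lambda>i. \<chi> (unit_vec i))"
    using admissible_Zx[of "\<lambda>i. \<chi> (unit_vec i)" n] v character_Units by auto
  have scale: "\<chi> (zscale p w) = (\<Otimes>k\<in>{..N}. (shift R ^^ k) (\<chi> w) [^] coeff p k)"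
    if "w \<in> Zx n" "degree p \<le> N" for p w
  proof -
    have "zscale p w = (\<Sum>k\<le>N. zscale (Polynomial.monom (coeff p k) k) w)"
      using that by (simp add: poly_as_sum_of_monoms' flip: zvec.scale_sum_left)
    thus ?thesis using that by (simp add: character_sum character_shift_scale)
  qed
  have "\<chi> v = \<chi> (\<Sum>i<n. zscale (lookup v i) (unit_vec i))"
    using lincomb_unit_vecs[OF v] by (simp add: lincomb_def)
  also have "\<dots> = (\<Otimes>i\<in>{..<n}. \<chi> (zscale (lookup v i) (unit_vec i)))"
    by (intro character_sum) auto
  also have "\<dots> = (\<Otimes>i\<in>{..<n}. \<Otimes>k\<in>{..N}. (shift R ^^ k) (\<chi> (unit_vec i)) [^] coeff (lookup v i) k)"
    using N by (intro finprod_cong'[OF refl])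
      (auto simp: scale intro!: finprod_closed admissible_coeff[OF v'])
  also have "\<dots> = vec_pow R (\<lambda>i. \<chi> (unit_vec i)) v"
    by (rule vec_pow_eq[OF v' N, symmetric])
  finally show ?thesis .
qed

end

lemma difference_character_vec_pow:
  assumes "t \<in> {..<m} \<rightarrow> Units R" shows "difference_character m (vec_pow R t)"
  using admissible_Zx[OF assms] vec_pow_closed[of _ m t] vec_pow_add[of _ m t]
    vec_pow_shift[of _ m t]
  by (simp add: difference_character_def subset_iff)

lemma vec_pow_Units: "t \<in> {..<m} \<rightarrow> Units R \<Longrightarrow> v \<in> Zx m \<Longrightarrow> vec_pow R t v \<in> Units R"
  by (rule character_Units[OF difference_character_vec_pow])

text \<open>
  Both sides are characters in \<open>e\<close>, and both take the value \<open>t\<^bsup>\<alpha>\<^sub>i\<^esup>\<close> at the \<open>i\<close>-th unit vector.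
\<close>

lemma vec_pow_vec_pow:
  assumes t: "t \<in> {..<m} \<rightarrow> Units R" and \<alpha>: "\<And>i. i < n \<Longrightarrow> \<alpha> i \<in> Zx m" and e: "e \<in> Zx n"
  shows "vec_pow R (\<lambda>i. vec_pow R t (\<alpha> i)) e = vec_pow R t (lincomb n \<alpha> e)"
proof -
  let ?\<chi> = "\<lambda>v. vec_pow R t (lincomb n \<alpha> v)"
  note ch = difference_character_vec_pow[OF t]
  have "difference_character n ?\<chi>"
    using \<alpha> unfolding difference_character_def
    by (simp add: lincomb_add lincomb_zscale lincomb_in_Zx character_closed[OF ch]
        character_add[OF ch] character_shift[OF ch])
  hence "?\<chi> e = vec_pow R (\<lambda>i. ?\<chi> (unit_vec i)) e"
    using e by (rule character_eq_vec_pow)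
  also have "\<dots> = vec_pow R (\<lambda>i. vec_pow R t (\<alpha> i)) e"
  proof (rule vec_pow_cong[where n = n])
    show "e \<in> admissible n (\<lambda>i. ?\<chi> (unit_vec i))"
      using \<alpha> e admissible_Zx[of "\<lambda>i. ?\<chi> (unit_vec i)" n] vec_pow_Units[OF t]
      by (auto simp: lincomb_in_Zx)
  qed (simp add: lincomb_unit_vec)
  finally show ?thesis ..
qed

section \<open>Rational scalars\<close>

lemma int_add: "[(k + l::int)] \<cdot> \<one> = [k] \<cdot> \<one> \<oplus> [l] \<cdot> \<one>"
  by (rule add.int_pow_mult) simp

lemma int_mult: "[(k * l::int)] \<cdot> \<one> = [k] \<cdot> \<one> \<otimes> [l] \<cdot> \<one>"
  by (simp add: add_pow_ldistr_int add.int_pow_pow mult.commute)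

lemma int_unit: "0 < (k::int) \<Longrightarrow> [k] \<cdot> \<one> \<in> Units R"
  using nat_unit[of "nat k"] by (simp add: add_pow_int_ge)

lemma unit_div_eq:
  assumes "a \<in> carrier R" "b \<in> Units R" "c \<in> carrier R" "d \<in> Units R" "a \<otimes> d = c \<otimes> b"
  shows "a \<otimes> inv b = c \<otimes> inv d"
proof -
  have [simp]: "b \<in> carrier R" "d \<in> carrier R" "inv b \<in> carrier R" "inv d \<in> carrier R"
    using assms by auto
  have "a \<otimes> inv b = a \<otimes> (d \<otimes> inv d) \<otimes> inv b" using assms by simp
  also have "\<dots> = (a \<otimes> d) \<otimes> inv d \<otimes> inv b" using assms(1) by (simp add: m_ac)
  also have "\<dots> = (c \<otimes> b) \<otimes> inv d \<otimes> inv b" using assms by simp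
  also have "\<dots> = c \<otimes> (b \<otimes> inv b) \<otimes> inv d" using assms(3) by (simp add: m_ac del: Units_r_inv)
  also have "\<dots> = c \<otimes> inv d" using assms by simp
  finally show ?thesis .
qed

text \<open>
  The embedding is defined by the reduced fraction; additivity and multiplicativity produce
  fractions that need not be reduced.
\<close>

lemma rat_embed_fraction:
  assumes "0 < d" "q = of_int k / of_int d"
  shows "rat_embed R q = [k] \<cdot> \<one> \<otimes> inv ([d] \<cdot> \<one>)"
proof -
  obtain k' d' where qo: "quotient_of q = (k', d')" by force
  have d': "0 < d'" "q = of_int k' / of_int d'"
    using quotient_of_denom_pos[OF qo] quotient_of_div[OF qo] by auto
  have "(of_int (k * d') :: rat) = of_int (k' * d)"
    using assms d' by (simp add: field_simps)
  hence "k' * d = k * d'" by (simp only: of_int_eq_iff)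
  hence "[k'] \<cdot> \<one> \<otimes> [d] \<cdot> \<one> = [k] \<cdot> \<one> \<otimes> [d'] \<cdot> \<one>"
    by (metis int_mult)
  thus ?thesis using assms(1) d'(1) unfolding rat_embed_def qo
    by (auto intro!: unit_div_eq int_unit)
qed

lemma rat_fraction: obtains k d :: int where "0 < d" "(q::rat) = of_int k / of_int d"
  by (metis quotient_of_denom_pos quotient_of_div surj_pair)

lemma rat_embed_closed [simp]: "rat_embed R q \<in> carrier R"
proof -
  obtain k d where "0 < d" "q = of_int k / of_int d" by (rule rat_fraction)
  thus ?thesis by (simp add: rat_embed_fraction int_unit)
qed

lemma inv_mult_Units: "x \<in> Units R \<Longrightarrow> y \<in> Units R \<Longrightarrow> inv (x \<otimes> y) = inv x \<otimes> inv y"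
proof (rule comm_inv_char)
  assume "x \<in> Units R" "y \<in> Units R"
  hence c: "x \<in> carrier R" "y \<in> carrier R" "inv x \<in> carrier R" "inv y \<in> carrier R"
    and i: "x \<otimes> inv x = \<one>" "y \<otimes> inv y = \<one>" by auto
  show "x \<otimes> y \<in> carrier R" "inv x \<otimes> inv y \<in> carrier R" using c by auto
  have "x \<otimes> y \<otimes> (inv x \<otimes> inv y) = (x \<otimes> inv x) \<otimes> (y \<otimes> inv y)" using c by (simp add: m_ac)
  thus "x \<otimes> y \<otimes> (inv x \<otimes> inv y) = \<one>" by (simp add: i)
qed

lemma rat_embed_int: "rat_embed R (of_int k) = [k] \<cdot> \<one>"
  by (subst rat_embed_fraction[of 1]) auto

lemma rat_embed_0 [simp]: "rat_embed R 0 = \<zero>" and rat_embed_1 [simp]: "rat_embed R 1 = \<one>"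
  using rat_embed_int[of 0] rat_embed_int[of 1] by (simp_all add: add_pow_int_ge)

lemma rat_embed_mult: "rat_embed R (q * r) = rat_embed R q \<otimes> rat_embed R r"
proof -
  obtain k d where q: "0 < d" "q = of_int k / of_int d" by (rule rat_fraction)
  obtain l e where r: "0 < e" "r = of_int l / of_int e" by (rule rat_fraction)
  have [simp]: "inv ([d] \<cdot> \<one>) \<in> carrier R" "inv ([e] \<cdot> \<one>) \<in> carrier R"
    using q r int_unit by auto
  have "q * r = of_int (k * l) / of_int (d * e)" using q r by simp
  hence "rat_embed R (q * r) = [(k * l)] \<cdot> \<one> \<otimes> inv ([(d * e)] \<cdot> \<one>)"
    using q r by (intro rat_embed_fraction) auto
  also have "\<dots> = ([k] \<cdot> \<one> \<otimes> inv ([d] \<cdot> \<one>)) \<otimes> ([l] \<cdot> \<one> \<otimes> inv ([e] \<cdot> \<one>))"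
    using q r by (simp add: int_mult int_unit inv_mult_Units m_ac)
  finally show ?thesis using q r by (simp add: rat_embed_fraction)
qed

lemma rat_embed_add: "rat_embed R (q + r) = rat_embed R q \<oplus> rat_embed R r"
proof -
  obtain k d where q: "0 < d" "q = of_int k / of_int d" by (rule rat_fraction)
  obtain l e where r: "0 < e" "r = of_int l / of_int e" by (rule rat_fraction)
  have "q = of_int (k * e) / of_int (d * e)" "r = of_int (l * d) / of_int (d * e)"
    "q + r = of_int (k * e + l * d) / of_int (d * e)" using q r by (auto simp: field_simps)
  moreover have "0 < d * e" using q r by simp
  ultimately show ?thesis
    by (simp only: rat_embed_fraction int_add) (simp add: l_distr int_unit)
qed

end

context difference_Q_hom
begin

lemma hom_int: "h ([(k::int)] \<cdot> \<one>) = [k] \<cdot>\<^bsub>S\<^esub> \<one>\<^bsub>S\<^esub>"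
proof -
  have n: "h ([m] \<cdot> \<one>) = [m] \<cdot>\<^bsub>S\<^esub> \<one>\<^bsub>S\<^esub>" for m :: nat
    by (induction m) auto
  show ?thesis
    by (cases "0 \<le> k") (simp_all add: add_pow_int_ge add_pow_int_lt n)
qed

lemma hom_rat_embed: "h (rat_embed R q) = rat_embed S q"
proof -
  obtain k d where "0 < d" "q = of_int k / of_int d" by (rule R.rat_fraction)
  thus ?thesis
    by (simp add: R.rat_embed_fraction S.rat_embed_fraction R.int_unit hom_int hom_inv)
qed

end

section \<open>Evaluation of difference polynomials\<close>

context difference_Q_algebra
begin

context
  fixes n :: nat and a :: "nat \<Rightarrow> 'a"
  assumes a: "a \<in> {..<n} \<rightarrow> carrier R"
begin

lemma eval_superset:
  assumes "finite T" "keys f \<subseteq> T" "T \<subseteq> admissible n a"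
  shows "eval_dpoly R f a = (\<Oplus>e\<in>T. rat_embed R (lookup f e) \<otimes> vec_pow R a e)"
  unfolding eval_dpoly_def using assms vec_pow_closed
  by (intro add.finprod_mono_neutral_cong_left) (auto simp: in_keys_iff subset_iff)

lemma eval_closed [simp]: "keys f \<subseteq> admissible n a \<Longrightarrow> eval_dpoly R f a \<in> carrier R"
  unfolding eval_dpoly_def using vec_pow_closed by (intro finsum_closed) auto

lemma eval_add:
  assumes "keys f \<subseteq> admissible n a" "keys g \<subseteq> admissible n a"
  shows "eval_dpoly R (f + g) a = eval_dpoly R f a \<oplus> eval_dpoly R g a"
proof -
  let ?T = "keys f \<union> keys g"
  have T: "e \<in> ?T \<Longrightarrow> vec_pow R a e \<in> carrier R" for e using assms vec_pow_closed by blast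
  have "eval_dpoly R (f + g) a = (\<Oplus>e\<in>?T. rat_embed R (lookup (f + g) e) \<otimes> vec_pow R a e)"
    using assms by (intro eval_superset) (auto simp: keys_add)
  also have "\<dots> = (\<Oplus>e\<in>?T. rat_embed R (lookup f e) \<otimes> vec_pow R a e \<oplus>
      rat_embed R (lookup g e) \<otimes> vec_pow R a e)"
    using T by (intro add.finprod_cong'[OF refl]) (auto simp: lookup_add rat_embed_add l_distr)
  also have "\<dots> = eval_dpoly R f a \<oplus> eval_dpoly R g a"
    using T assms by (subst finsum_addf) (auto simp: eval_superset[of ?T, symmetric])
  finally show ?thesis .
qed

lemma eval_single:
  assumes "e \<in> admissible n a"
  shows "eval_dpoly R (Poly_Mapping.single e c) a = rat_embed R c \<otimes> vec_pow R a e"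
  using assms vec_pow_closed[OF assms]
  by (subst eval_superset[of "{e}"]) auto

lemma eval_monomial: "e \<in> admissible n a \<Longrightarrow> eval_dpoly R (monomial e) a = vec_pow R a e"
  using vec_pow_closed by (simp add: eval_single monomial_def)

lemma eval_0 [simp]: "eval_dpoly R 0 a = \<zero>"
  by (simp add: eval_dpoly_def)

lemma admissible_add: "e \<in> admissible n a \<Longrightarrow> e' \<in> admissible n a \<Longrightarrow> e + e' \<in> admissible n a"
  using admissible_closed[OF a] by (simp add: exponent_monoid_def)

lemma keys_mult_admissible: "keys f \<subseteq> admissible n a \<Longrightarrow> keys g \<subseteq> admissible n a \<Longrightarrow>
    keys (f * g) \<subseteq> admissible n a"
  using keys_laurent_mult admissible_closed[OF a] by blast

text \<open>
  Both sides are additive in \<open>f\<close> and in \<open>g\<close>, so only single terms have to be compared.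
\<close>

lemma eval_mult:
  assumes f: "keys f \<subseteq> admissible n a" and g: "keys g \<subseteq> admissible n a"
  shows "eval_dpoly R (f * g) a = eval_dpoly R f a \<otimes> eval_dpoly R g a"
  using f
proof (induction f rule: laurent_induct)
  case (single e c)
  have "e \<in> admissible n a" by fact
  show ?case using g
  proof (induction g rule: laurent_induct)
    case (single e' c')
    with \<open>e \<in> _\<close> show ?case
      by (simp add: mult_single eval_single admissible_add rat_embed_mult vec_pow_add[of _ n]
        vec_pow_closed m_ac)
  next
    case (add g g')
    with \<open>e \<in> _\<close> show ?case
      by (simp add: distrib_left eval_add keys_mult_admissible r_distr)
  qed (use \<open>e \<in> _\<close> in simp)
next
  case (add f f')
  with g show ?case by (simp add: distrib_right eval_add keys_mult_admissible l_distr)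
qed (use g in simp)

lemma eval_shift:
  assumes f: "keys f \<subseteq> admissible n a"
  shows "eval_dpoly R (laurent_shift f) a = shift R (eval_dpoly R f a)"
  using f
proof (induction f rule: laurent_induct)
  case zero show ?case by (simp add: laurent_shift_simps)
next
  case (single e c)
  have "zscale [:0, 1:] e \<in> admissible n a"
    using single admissible_closed[OF a] by (simp add: exponent_monoid_def)
  moreover have "shift R (rat_embed R c) = rat_embed R c"
    by (rule shift.hom_rat_embed)
  ultimately show ?case using single
    by (simp add: laurent_shift_simps eval_single vec_pow_shift[of _ n] vec_pow_closed)
next
  case (add f g)
  have "keys (laurent_shift f) \<subseteq> admissible n a" if "keys f \<subseteq> admissible n a" for f
    using keys_expmap[of "zscale [:0, 1:]" f] that admissible_closed[OF a]
    unfolding laurent_shift_expmap exponent_monoid_def by blast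
  with add show ?case by (simp add: laurent_shift_simps eval_add)
qed

end

lemma eval_cong:
  assumes "keys f \<subseteq> admissible n a" "\<And>i. i < n \<Longrightarrow> a i = b i"
  shows "eval_dpoly R f a = eval_dpoly R f b"
proof -
  have "vec_pow R a e = vec_pow R b e" if "e \<in> keys f" for e
    using assms that by (intro vec_pow_cong[of _ n]) auto
  moreover have "vec_pow R a e \<in> carrier R" if "e \<in> keys f" for e
    using assms that vec_pow_closed by blast
  ultimately show ?thesis unfolding eval_dpoly_def
    by (intro add.finprod_cong'[OF refl]) auto
qed

end

lemma exponent_monoid_zero: "exponent_monoid M \<Longrightarrow> 0 \<in> M"
  by (simp add: exponent_monoid_def)

lemma difference_Q_algebra_module_ring:
  assumes M: "exponent_monoid M" shows "difference_Q_algebra (module_ring M)"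
proof -
  interpret cring "module_ring M" by (rule cring_module_ring[OF M])
  have of_nat: "[k] \<cdot>\<^bsub>module_ring M\<^esub> \<one>\<^bsub>module_ring M\<^esub> = of_nat k" for k :: nat
    by (induction k) (simp_all add: add.commute)
  show ?thesis
  proof unfold_locales
    show "shift (module_ring M) \<in> ring_hom (module_ring M) (module_ring M)"
    proof (rule ring_hom_memI)
      fix f assume "f \<in> carrier (module_ring M)"
      thus "shift (module_ring M) f \<in> carrier (module_ring M)"
        using keys_expmap[of "zscale [:0, 1:]" f] M
        unfolding laurent_shift_expmap exponent_monoid_def module_ring_simps by blast
    qed (auto simp: laurent_shift_simps)
    fix k :: nat assume k: "0 < k"
    let ?i = "Poly_Mapping.single (0::zvec) (1 / of_nat k :: rat)"
    have "of_nat k * ?i = 1" "?i * of_nat k = 1"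
      using k by (simp_all add: mult_single flip: single_of_nat)
    moreover have "?i \<in> carrier (module_ring M)" "of_nat k \<in> carrier (module_ring M)"
      using M by (auto simp: exponent_monoid_zero simp flip: single_of_nat)
    ultimately show "[k] \<cdot>\<^bsub>module_ring M\<^esub> \<one>\<^bsub>module_ring M\<^esub> \<in> Units (module_ring M)"
      unfolding of_nat Units_def by (auto intro!: exI[of _ ?i] split: if_splits)
  qed
qed

lemma (in difference_Q_algebra) eval_hom:
  assumes a: "a \<in> {..<n} \<rightarrow> carrier R" and M: "exponent_monoid M" "M \<subseteq> admissible n a"
  shows "difference_Q_hom (module_ring M) R (\<lambda>f. eval_dpoly R f a)"
proof -
  interpret M: difference_Q_algebra "module_ring M"
    by (rule difference_Q_algebra_module_ring[OF M(1)])
  have "keys f \<subseteq> admissible n a" if "f \<in> carrier (module_ring M)" for f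
    using that M by auto
  moreover have "eval_dpoly R 1 a = \<one>"
    using a eval_monomial[of a n 0] admissible_closed[of a n]
    by (simp add: monomial_0 exponent_monoid_zero)
  ultimately show ?thesis using a
    by unfold_locales (auto intro!: ring_hom_memI simp: eval_add eval_mult eval_shift)
qed

text \<open>
  Homomorphisms commute with evaluation.  Applied to an evaluation homomorphism it says that
  evaluating after substituting polynomials is evaluating at the image point.
\<close>

lemma (in difference_Q_hom) hom_eval:
  assumes "keys f \<subseteq> R.admissible n a"
  shows "h (eval_dpoly R f a) = eval_dpoly S f (\<lambda>i. h (a i))"
proof -
  have adm: "e \<in> R.admissible n a" if "e \<in> keys f" for e using assms that by auto
  have "h (eval_dpoly R f a) = (\<Oplus>\<^bsub>S\<^esub>e\<in>keys f. h (rat_embed R (lookup f e) \<otimes> vec_pow R a e))"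
    unfolding eval_dpoly_def
    by (subst hom_finsum) (auto simp: o_def dest!: adm intro!: R.vec_pow_closed)
  also have "\<dots> = eval_dpoly S f (\<lambda>i. h (a i))"
    unfolding eval_dpoly_def
    by (rule S.add.finprod_cong'[OF refl])
      (auto simp: R.vec_pow_closed hom_vec_pow hom_rat_embed dest!: adm
        intro!: S.vec_pow_closed hom_admissible)
  finally show ?thesis .
qed

lemma difference_Q_algebra_field:
  assumes "difference_field_over_Q E" shows "difference_Q_algebra E"
proof -
  interpret field E using assms by (simp add: difference_field_over_Q_def)
  show ?thesis using assms
    by unfold_locales (auto simp: difference_field_over_Q_def field_Units)
qed

abbreviation "laurent_ring \<equiv> module_ring UNIV"

interpretation laurent: difference_Q_algebra laurent_ring
  by (rule difference_Q_algebra_module_ring) simp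

section \<open>The Laurent ring\<close>

lemma laurent_Units:
  "f \<in> Units laurent_ring \<longleftrightarrow> (\<exists>g. f * g = 1)"
  by (auto simp: Units_def mult.commute)

lemma laurent_rat_embed: "rat_embed laurent_ring q = Poly_Mapping.single 0 q"
proof -
  have of_nat: "[k] \<cdot>\<^bsub>laurent_ring\<^esub> 1 = of_nat k" for k :: nat
    using laurent.add.nat_pow_0[of 1] laurent.add.nat_pow_Suc[of 1] by (induction k) (simp_all add: add.commute)
  have uminus: "\<ominus>\<^bsub>laurent_ring\<^esub> f = - f" for f
    by (rule laurent.minus_equality) auto
  have of_int: "[k] \<cdot>\<^bsub>laurent_ring\<^esub> 1 = of_int k" for k :: int
    by (cases "0 \<le> k") (simp_all add: add_pow_int_ge add_pow_int_lt of_nat uminus)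
  obtain k d where q: "0 < d" "q = of_int k / of_int d" by (rule laurent.rat_fraction)
  have "(of_int d :: laurent) * Poly_Mapping.single 0 (1 / of_int d) = 1"
    using q by (simp add: mult_single flip: single_of_int)
  hence "inv\<^bsub>laurent_ring\<^esub> (of_int d) = Poly_Mapping.single 0 (1 / of_int d)"
    by (intro laurent.comm_inv_char) auto
  thus ?thesis using q
    by (simp add: laurent.rat_embed_fraction of_int mult_single flip: single_of_int)
qed

lemma laurent_finsum: "finsum laurent_ring f A = sum f A"
  by (induction A rule: infinite_finite_induct) auto

lemma eval_laurent:
  assumes "\<And>e. e \<in> keys f \<Longrightarrow> vec_pow laurent_ring a e = Poly_Mapping.single (A e) (\<kappa> e)"
  shows "eval_dpoly laurent_ring f a = (\<Sum>e\<in>keys f. Poly_Mapping.single (A e) (lookup f e * \<kappa> e))"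
  unfolding eval_dpoly_def laurent_finsum
  by (rule sum.cong) (auto simp: assms laurent_rat_embed mult_single)

lemma monomial_character: "laurent.difference_character n (\<lambda>e. monomial (lincomb n \<alpha> e))"
  by (simp add: laurent.difference_character_def lincomb_add lincomb_zscale monomial_add monomial_0
      laurent_shift_simps)

lemma monomial_Units: "monomial v \<in> Units laurent_ring"
  unfolding laurent_Units by (rule exI[of _ "monomial (- v)"]) (simp add: monomial_add[symmetric] monomial_0)

lemma vec_pow_monomials:
  assumes "e \<in> Zx n"
  shows "vec_pow laurent_ring (\<lambda>i. monomial (\<alpha> i)) e = monomial (lincomb n \<alpha> e)"
proof -
  have "vec_pow laurent_ring (\<lambda>i. monomial (\<alpha> i)) e =
      vec_pow laurent_ring (\<lambda>i. monomial (lincomb n \<alpha> (unit_vec i))) e"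
    using assms laurent.admissible_Zx[of "\<lambda>i. monomial (\<alpha> i)" n] monomial_Units
    by (intro laurent.vec_pow_cong[of _ n]) (auto simp: lincomb_unit_vec)
  also have "\<dots> = monomial (lincomb n \<alpha> e)"
    by (rule laurent.character_eq_vec_pow[OF monomial_character assms, symmetric])
  finally show ?thesis .
qed

text \<open>
  At the point \<open>(\<T>\<^bsup>\<alpha>\<^sub>1\<^esup>, \<dots>, \<T>\<^bsup>\<alpha>\<^sub>n\<^esup>)\<close> of the Laurent ring, evaluation only moves exponents.
\<close>

lemma eval_monomials:
  assumes "keys f \<subseteq> Zx n"
  shows "eval_dpoly laurent_ring f (\<lambda>i. monomial (\<alpha> i)) = expmap (lincomb n \<alpha>) f"
proof -
  have "vec_pow laurent_ring (\<lambda>i. monomial (\<alpha> i)) e = Poly_Mapping.single (lincomb n \<alpha> e) 1"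
    if "e \<in> keys f" for e
    using assms that vec_pow_monomials[of e n \<alpha>] by (auto simp: monomial_def)
  from eval_laurent[OF this] show ?thesis by (simp add: expmap_def)
qed

section \<open>A generic difference field in a given universe\<close>

text \<open>
  Injectivity of the shift keeps denominators nonzero.
\<close>

lift_definition fract_shift :: "laurent fract \<Rightarrow> laurent fract"
  is "\<lambda>(a, b). (laurent_shift a, laurent_shift b)"
  by (auto dest: laurent_shift_inj simp flip: laurent_shift_simps(2))

lemma fract_shift_Fract: "b \<noteq> 0 \<Longrightarrow> fract_shift (Fract a b) = Fract (laurent_shift a) (laurent_shift b)"
  by transfer (auto dest: laurent_shift_inj)

lemma fract_shift_simps:
  "fract_shift (q + r) = fract_shift q + fract_shift r"
  "fract_shift (q * r) = fract_shift q * fract_shift r"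
  "fract_shift 1 = 1"
proof -
  obtain a b c d where *: "q = Fract a b" "b \<noteq> 0" "r = Fract c d" "d \<noteq> 0"
    by (metis Fract_cases)
  moreover have "laurent_shift b \<noteq> 0" "laurent_shift d \<noteq> 0" using * laurent_shift_inj by blast+
  ultimately show "fract_shift (q + r) = fract_shift q + fract_shift r"
    "fract_shift (q * r) = fract_shift q * fract_shift r"
    by (auto simp: fract_shift_Fract laurent_shift_simps)
  show "fract_shift 1 = 1" by (simp add: One_fract_def fract_shift_Fract laurent_shift_simps)
qed

text \<open>
  A finitely supported function is determined by its graph over the support, a finite set.
\<close>

lemma countable_poly_mapping:
  assumes "countable (UNIV :: 'a set)" "countable (UNIV :: 'b::zero set)"
  shows "countable (UNIV :: ('a \<Rightarrow>\<^sub>0 'b) set)"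
proof -
  let ?g = "\<lambda>f :: 'a \<Rightarrow>\<^sub>0 'b. (\<lambda>k. (k, lookup f k)) ` keys f"
  have "inj ?g"
  proof (rule injI, rule poly_mapping_eqI)
    fix f f' k assume "?g f = ?g f'"
    hence "(k, y) \<in> ?g f \<longleftrightarrow> (k, y) \<in> ?g f'" for y by simp
    from this[of "lookup f k"] this[of "lookup f' k"] show "lookup f k = lookup f' k"
      by (auto simp: image_iff in_keys_iff)
  qed
  moreover have "countable {A :: ('a \<times> 'b) set. finite A \<and> A \<subseteq> UNIV}"
    using assms by (intro countable_Collect_finite_subset) (simp flip: UNIV_Times_UNIV)
  hence "countable (range ?g)" by (rule countable_subset[rotated]) auto
  ultimately show ?thesis by (rule countable_image_inj_on[rotated])
qed

lemma countable_fract: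
  assumes "countable (UNIV :: 'a::idom set)" shows "countable (UNIV :: 'a fract set)"
proof -
  have "(UNIV :: 'a fract set) \<subseteq> (\<lambda>(a, b). Fract a b) ` (UNIV \<times> UNIV)"
  proof
    show "q \<in> (\<lambda>(a, b). Fract a b) ` (UNIV \<times> UNIV)" for q :: "'a fract" by (cases q) auto
  qed
  thus ?thesis using assms by (meson countable_SIGMA countable_image countable_subset)
qed

lemma countable_int_poly: "countable (UNIV :: int poly set)"
proof (rule countable_image_inj_on)
  show "inj (coeffs :: int poly \<Rightarrow> _)" by (simp add: inj_on_def coeffs_eq_iff)
qed (rule countable_subset[OF subset_UNIV], simp)

lemma inj_laurent_fract:
  assumes "infinite (UNIV :: 'e set)"
  obtains g :: "laurent fract \<Rightarrow> 'e" where "inj g"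
proof -
  have "countable (UNIV :: laurent fract set)"
    by (intro countable_fract countable_poly_mapping countable_int_poly) auto
  then obtain f :: "laurent fract \<Rightarrow> nat" where "inj f" by (rule countableE)
  moreover obtain h :: "nat \<Rightarrow> 'e" where "inj h"
    using infinite_countable_subset[OF assms] by blast
  ultimately show thesis using that[of "h \<circ> f"] by (simp add: inj_compose)
qed

text \<open>
  The fraction field of the Laurent ring, transported along an injection \<open>g\<close> into the universe.
\<close>

definition generic_field :: "(laurent fract \<Rightarrow> 'e) \<Rightarrow> 'e difference_ring" where
  "generic_field g =
     \<lparr>carrier = range g, monoid.mult = (\<lambda>x y. g (inv_into UNIV g x * inv_into UNIV g y)), one = g 1,
      zero = g 0, add = (\<lambda>x y. g (inv_into UNIV g x + inv_into UNIV g y)),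
      shift = (\<lambda>x. g (fract_shift (inv_into UNIV g x)))\<rparr>"

text \<open>
  The exponent group is linearly ordered, so the Laurent ring is a domain, and it is countable,
  so its fraction field has a copy inside every infinite universe.  The images of the
  indeterminates then form a point of the torus at which no nonzero Laurent difference
  polynomial vanishes.
\<close>

lemma generic_point:
  assumes "infinite (UNIV :: 'e set)"
  obtains E :: "'e difference_ring" and h where
    "difference_field_over_Q E" "difference_Q_hom laurent_ring E h"
    "\<And>f. h f = \<zero>\<^bsub>E\<^esub> \<longleftrightarrow> f = 0"
proof -
  obtain g :: "laurent fract \<Rightarrow> 'e" where g: "inj g" by (rule inj_laurent_fract[OF assms])
  define E where "E = generic_field g"
  have E: "carrier E = range g" "g x \<otimes>\<^bsub>E\<^esub> g y = g (x * y)" "g x \<oplus>\<^bsub>E\<^esub> g y = g (x + y)"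
    "\<one>\<^bsub>E\<^esub> = g 1" "\<zero>\<^bsub>E\<^esub> = g 0" "shift E (g x) = g (fract_shift x)" for x y
    using g by (simp_all add: E_def generic_field_def)
  have "cring E"
  proof (rule cringI)
    show "abelian_group E"
    proof (rule abelian_groupI)
      fix x assume "x \<in> carrier E"
      then obtain q where "x = g q" by (auto simp: E)
      thus "\<exists>y\<in>carrier E. y \<oplus>\<^bsub>E\<^esub> x = \<zero>\<^bsub>E\<^esub>"
        by (intro bexI[of _ "g (- q)"]) (auto simp: E)
    qed (auto simp: E add_ac)
    show "comm_monoid E" by (rule comm_monoidI) (auto simp: E mult_ac)
  qed (auto simp: E distrib_right)
  then interpret cring E .
  have "field E"
  proof (rule cring_fieldI2)
    show "\<zero>\<^bsub>E\<^esub> \<noteq> \<one>\<^bsub>E\<^esub>" using g by (simp add: E inj_eq)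
    fix x assume "x \<in> carrier E" "x \<noteq> \<zero>\<^bsub>E\<^esub>"
    then obtain q where "x = g q" "q \<noteq> 0" by (auto simp: E)
    thus "\<exists>y\<in>carrier E. x \<otimes>\<^bsub>E\<^esub> y = \<one>\<^bsub>E\<^esub>"
      by (intro bexI[of _ "g (inverse q)"]) (auto simp: E)
  qed
  moreover have "shift E \<in> ring_hom E E"
    by (rule ring_hom_memI) (auto simp: E fract_shift_simps)
  moreover have "[k] \<cdot>\<^bsub>E\<^esub> \<one>\<^bsub>E\<^esub> = g (of_nat k)" for k :: nat
    by (induction k) (auto simp: E add.commute)
  ultimately have fE: "difference_field_over_Q E"
    using g by (simp add: difference_field_over_Q_def E inj_eq of_nat_fract Zero_fract_def eq_fract)
  interpret E: difference_Q_algebra E by (rule difference_Q_algebra_field[OF fE])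
  define h where "h f = g (Fract f 1)" for f
  have "h \<in> ring_hom laurent_ring E"
    by (rule ring_hom_memI) (auto simp: E h_def One_fract_def)
  moreover have "h (shift laurent_ring f) = shift E (h f)" for f
    by (simp add: E h_def fract_shift_Fract laurent_shift_simps)
  ultimately have "difference_Q_hom laurent_ring E h"
    by unfold_locales auto
  moreover have "h f = \<zero>\<^bsub>E\<^esub> \<longleftrightarrow> f = 0" for f
    using g by (simp add: E h_def inj_eq Zero_fract_def eq_fract)
  ultimately show thesis using fE that by blast
qed

section \<open>Toric ideals and the closure of a quasi torus\<close>

lemma dpoly_ring_simps [simp]:
  "carrier (dpoly_ring n) = {f. keys f \<subseteq> Nx n}"
  "f \<otimes>\<^bsub>dpoly_ring n\<^esub> g = f * g" "\<one>\<^bsub>dpoly_ring n\<^esub> = 1"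
  "f \<oplus>\<^bsub>dpoly_ring n\<^esub> g = f + g" "\<zero>\<^bsub>dpoly_ring n\<^esub> = 0"
  "shift (dpoly_ring n) = laurent_shift"
  by (simp_all add: dpoly_ring_def)

lemma difference_Q_algebra_dpoly_ring: "difference_Q_algebra (dpoly_ring n)"
  unfolding dpoly_ring_def by (rule difference_Q_algebra_module_ring) simp

lemma difference_field_Units:
  "difference_field_over_Q E \<Longrightarrow> Units E = carrier E - {\<zero>\<^bsub>E\<^esub>}"
  by (simp add: difference_field_over_Q_def field.field_Units)

lemma torus_points_Units:
  "difference_field_over_Q E \<Longrightarrow> torus_points n E = {..<n} \<rightarrow>\<^sub>E Units E"
  by (simp add: torus_points_def difference_field_Units)

lemma dpoly_keys_admissible:
  assumes "difference_Q_algebra R" "a \<in> {..<n} \<rightarrow> carrier R" "keys f \<subseteq> Nx n"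
  shows "keys f \<subseteq> difference_Q_algebra.admissible R n a"
  using difference_Q_algebra.admissible_Nx[OF assms(1,2)] assms(3) by blast

lemma eval_dpoly_hom:
  assumes "difference_Q_algebra R" "a \<in> {..<n} \<rightarrow> carrier R"
  shows "difference_Q_hom (dpoly_ring n) R (\<lambda>f. eval_dpoly R f a)"
  unfolding dpoly_ring_def using difference_Q_algebra.eval_hom[OF assms]
    difference_Q_algebra.admissible_Nx[OF assms] by simp

lemma eval_dpoly_unit_vec:
  assumes "difference_Q_algebra R" "a \<in> {..<n} \<rightarrow> carrier R" "i < n"
  shows "eval_dpoly R (monomial (unit_vec i)) a = a i"
proof -
  interpret difference_Q_algebra R by fact
  have "unit_vec i \<in> admissible n a" using admissible_Nx[OF assms(2)] assms(3) by auto
  thus ?thesis using assms by (simp add: eval_monomial[OF assms(2)] vec_pow_unit_vec Pi_def)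
qed

text \<open>
  Evaluating at \<open>(t\<^bsup>\<alpha>\<^sub>1\<^esup>, \<dots>, t\<^bsup>\<alpha>\<^sub>n\<^esup>)\<close> means to substitute \<open>\<T>\<^bsup>\<alpha>\<^sub>i\<^esup>\<close> for \<open>y\<^sub>i\<close> and to evaluate at \<open>t\<close>.
\<close>

lemma eval_expmap:
  assumes R: "difference_Q_algebra R" and t: "t \<in> {..<m} \<rightarrow> Units R"
    and \<alpha>: "\<And>i. i < n \<Longrightarrow> \<alpha> i \<in> Zx m" and f: "keys f \<subseteq> Zx n"
  shows "eval_dpoly R (expmap (lincomb n \<alpha>) f) t = eval_dpoly R f (\<lambda>i. vec_pow R t (\<alpha> i))"
proof -
  interpret difference_Q_algebra R by fact
  have t': "t \<in> {..<m} \<rightarrow> carrier R" using t by auto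
  have a: "(\<lambda>i. vec_pow R t (\<alpha> i)) \<in> {..<n} \<rightarrow> Units R" using vec_pow_Units[OF t] \<alpha> by auto
  hence a': "(\<lambda>i. vec_pow R t (\<alpha> i)) \<in> {..<n} \<rightarrow> carrier R" by auto
  have Zm: "lincomb n \<alpha> e \<in> admissible m t" for e
    using admissible_Zx[OF t] lincomb_in_Zx[of n \<alpha> m e] \<alpha> by auto
  have Zn: "e \<in> admissible n (\<lambda>i. vec_pow R t (\<alpha> i))" if "e \<in> Zx n" for e
    using admissible_Zx[OF a] that by auto
  have keys: "keys (expmap (lincomb n \<alpha>) f) \<subseteq> admissible m t" for f
    using keys_expmap[of "lincomb n \<alpha>" f] Zm by blast
  show ?thesis using f
  proof (induction f rule: laurent_induct)
    case zero show ?case by (simp add: eval_dpoly_def)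
  next
    case (single e c)
    thus ?case
      by (simp add: eval_single[OF t'] eval_single[OF a'] Zm Zn vec_pow_vec_pow[OF t \<alpha>])
  next
    case (add f g)
    have "keys f \<subseteq> admissible n (\<lambda>i. vec_pow R t (\<alpha> i))"
      "keys g \<subseteq> admissible n (\<lambda>i. vec_pow R t (\<alpha> i))" using add Zn by blast+
    with add show ?case by (simp add: expmap_add eval_add[OF t'] eval_add[OF a'] keys)
  qed
qed

text \<open>
  The ideal of all \<open>f\<close> with \<open>f(\<T>\<^bsup>\<alpha>\<^sub>1\<^esup>, \<dots>, \<T>\<^bsup>\<alpha>\<^sub>n\<^esup>) = 0\<close>.
\<close>

definition toric_ideal :: "nat \<Rightarrow> (nat \<Rightarrow> zvec) \<Rightarrow> laurent set" where
  "toric_ideal n \<alpha> = {f \<in> carrier (dpoly_ring n). expmap (lincomb n \<alpha>) f = 0}"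

lemma quasi_torus_eq:
  "difference_field_over_Q E \<Longrightarrow> quasi_torus m n \<alpha> E =
     (\<lambda>t. \<lambda>i\<in>{..<n}. vec_pow E t (\<alpha> i)) ` ({..<m} \<rightarrow>\<^sub>E Units E)"
  by (simp add: quasi_torus_def torus_points_Units)

lemma quasi_torus_non_field: "\<not> difference_field_over_Q E \<Longrightarrow> quasi_torus m n \<alpha> E = {}"
  by (simp add: quasi_torus_def torus_points_def)

lemma quasi_torus_subset_torus:
  assumes "\<And>i. i < n \<Longrightarrow> \<alpha> i \<in> Zx m"
  shows "quasi_torus m n \<alpha> E \<subseteq> torus_points n E"
proof (cases "difference_field_over_Q E")
  case True
  interpret difference_Q_algebra E by (rule difference_Q_algebra_field[OF True])
  have "vec_pow E t (\<alpha> i) \<in> Units E" if "t \<in> {..<m} \<rightarrow>\<^sub>E Units E" "i < n" for t i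
    using that assms by (intro vec_pow_Units[of t m]) (auto simp: PiE_def)
  thus ?thesis using True by (auto simp: quasi_torus_eq torus_points_Units)
qed (simp add: quasi_torus_non_field)

lemma eval_quasi_torus_point:
  assumes E: "difference_field_over_Q E" and t: "t \<in> {..<m} \<rightarrow>\<^sub>E Units E"
    and \<alpha>: "\<And>i. i < n \<Longrightarrow> \<alpha> i \<in> Zx m" and f: "keys f \<subseteq> Nx n"
  shows "eval_dpoly E f (\<lambda>i\<in>{..<n}. vec_pow E t (\<alpha> i)) = eval_dpoly E (expmap (lincomb n \<alpha>) f) t"
proof -
  interpret difference_Q_algebra E by (rule difference_Q_algebra_field[OF E])
  have t': "t \<in> {..<m} \<rightarrow> Units E" using t by auto
  have a: "(\<lambda>i\<in>{..<n}. vec_pow E t (\<alpha> i)) \<in> {..<n} \<rightarrow> carrier E"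
    using vec_pow_Units[OF t'] \<alpha> by auto
  have "eval_dpoly E f (\<lambda>i\<in>{..<n}. vec_pow E t (\<alpha> i)) = eval_dpoly E f (\<lambda>i. vec_pow E t (\<alpha> i))"
    using f by (intro eval_cong[of _ n]) (use admissible_Nx[OF a] in auto)
  also have "\<dots> = eval_dpoly E (expmap (lincomb n \<alpha>) f) t"
    using f Nx_subset_Zx \<alpha>
    by (intro eval_expmap[symmetric, OF difference_Q_algebra_axioms t']) auto
  finally show ?thesis .
qed

text \<open>
  A polynomial that becomes zero after the substitution vanishes at all points of the quasi
  torus.  For the converse a single point suffices, the image of the generic point of the torus.
\<close>

theorem defining_ideal_quasi_torus:
  assumes inf: "infinite (UNIV :: 'e set)" and \<alpha>: "\<And>i. i < n \<Longrightarrow> \<alpha> i \<in> Zx m"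
  shows "defining_ideal n (quasi_torus m n \<alpha> :: 'e subfunctor) = toric_ideal n \<alpha>"
proof (intro equalityI subsetI)
  fix f assume f: "f \<in> defining_ideal n (quasi_torus m n \<alpha> :: 'e subfunctor)"
  hence keys: "keys f \<subseteq> Nx n" by (simp add: defining_ideal_def)
  obtain E :: "'e difference_ring" and h where E: "difference_field_over_Q E"
    and h: "difference_Q_hom laurent_ring E h" and inj: "\<And>f. h f = \<zero>\<^bsub>E\<^esub> \<longleftrightarrow> f = 0"
    using generic_point[OF inf] by metis
  interpret E: difference_Q_algebra E by (rule difference_Q_algebra_field[OF E])
  interpret h: difference_Q_hom laurent_ring E h by (rule h)
  define t where "t = (\<lambda>j\<in>{..<m}. h (monomial (unit_vec j)))"
  have t: "t \<in> {..<m} \<rightarrow>\<^sub>E Units E"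
    using h.hom_Units[OF monomial_Units] by (auto simp: t_def)
  have u: "(\<lambda>j. monomial (unit_vec j)) \<in> {..<m} \<rightarrow> Units laurent_ring"
    using monomial_Units by auto
  have adm: "keys (expmap (lincomb n \<alpha>) f) \<subseteq> laurent.admissible m (\<lambda>j. monomial (unit_vec j))"
    using laurent.admissible_Zx[OF u] keys_expmap[of "lincomb n \<alpha>" f] lincomb_in_Zx[of n \<alpha> m] \<alpha>
    by blast
  have "h (expmap (lincomb n \<alpha>) f) = h (eval_dpoly laurent_ring (expmap (lincomb n \<alpha>) f) (\<lambda>j. monomial (unit_vec j)))"
  proof -
    have k: "keys (expmap (lincomb n \<alpha>) f) \<subseteq> Zx m"
      using keys_expmap[of "lincomb n \<alpha>" f] lincomb_in_Zx[of n \<alpha> m] \<alpha> by blast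
    hence "expmap (lincomb m unit_vec) (expmap (lincomb n \<alpha>) f) = expmap (lincomb n \<alpha>) f"
      by (intro expmap_id) (auto intro: lincomb_unit_vecs)
    thus ?thesis by (simp add: eval_monomials[OF k])
  qed
  also have "\<dots> = eval_dpoly E (expmap (lincomb n \<alpha>) f) (\<lambda>j. h (monomial (unit_vec j)))"
    using adm by (intro h.hom_eval[of _ m])
  also have "\<dots> = eval_dpoly E (expmap (lincomb n \<alpha>) f) t"
    using adm by (intro E.eval_cong[of _ m]) (auto simp: t_def intro!: h.hom_admissible)
  also have "\<dots> = eval_dpoly E f (\<lambda>i\<in>{..<n}. vec_pow E t (\<alpha> i))"
    by (rule eval_quasi_torus_point[OF E t \<alpha> keys, symmetric])
  also have "\<dots> = \<zero>\<^bsub>E\<^esub>"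
    using f t by (auto simp: defining_ideal_def quasi_torus_eq[OF E])
  finally show "f \<in> toric_ideal n \<alpha>" using keys inj by (simp add: toric_ideal_def)
next
  fix f assume f: "f \<in> toric_ideal n \<alpha>"
  have "eval_dpoly E f a = \<zero>\<^bsub>E\<^esub>" if a: "a \<in> quasi_torus m n \<alpha> E" for E :: "'e difference_ring" and a
  proof -
    have E: "difference_field_over_Q E" using a quasi_torus_non_field by blast
    interpret E: difference_Q_algebra E by (rule difference_Q_algebra_field[OF E])
    obtain t where t: "t \<in> {..<m} \<rightarrow>\<^sub>E Units E" "a = (\<lambda>i\<in>{..<n}. vec_pow E t (\<alpha> i))"
      using a unfolding quasi_torus_eq[OF E] by blast
    have "eval_dpoly E f a = eval_dpoly E (expmap (lincomb n \<alpha>) f) t"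
      unfolding t(2) using f by (intro eval_quasi_torus_point[OF E t(1) \<alpha>]) (auto simp: toric_ideal_def)
    also have "\<dots> = \<zero>\<^bsub>E\<^esub>" using f by (simp add: toric_ideal_def eval_dpoly_def)
    finally show ?thesis .
  qed
  thus "f \<in> defining_ideal n (quasi_torus m n \<alpha> :: 'e subfunctor)"
    using f by (auto simp: defining_ideal_def toric_ideal_def)
qed

section \<open>Varieties and their defining ideals\<close>

lemma variety_of_defining_ideal:
  assumes "difference_variety n X" shows "variety_of n (defining_ideal n X) = X"
proof
  fix E
  obtain P where P: "P \<subseteq> carrier (dpoly_ring n)" "X = variety_of n P"
    using assms by (auto simp: difference_variety_def)
  hence "P \<subseteq> defining_ideal n X"
    by (auto simp: defining_ideal_def variety_of_def split: if_splits)
  thus "variety_of n (defining_ideal n X) E = X E"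
    unfolding P(2) by (auto simp: variety_of_def defining_ideal_def split: if_splits)
qed

lemma difference_variety_defining_ideal: "difference_variety n (variety_of n (defining_ideal n V))"
  unfolding difference_variety_def
  by (rule exI[of _ "defining_ideal n V"]) (auto simp: defining_ideal_def)

lemma defining_ideal_mono: "(\<And>E. V E \<subseteq> W E) \<Longrightarrow> defining_ideal n W \<subseteq> defining_ideal n V"
  by (fastforce simp: defining_ideal_def)

lemma difference_variety_points:
  assumes "difference_variety n X" "a \<in> X E"
  shows "difference_field_over_Q E" "a \<in> {..<n} \<rightarrow>\<^sub>E carrier E"
  using assms by (auto simp: difference_variety_def variety_of_def split: if_splits)

text \<open>
  A variety that contains \<open>V\<close> is cut out by polynomials that vanish on \<open>V\<close>.
\<close>

lemma Cohn_closure_eq: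
  assumes V: "\<And>E. V E \<subseteq> (if difference_field_over_Q E then {..<n} \<rightarrow>\<^sub>E carrier E else {})"
  shows "Cohn_closure n V = variety_of n (defining_ideal n V)"
proof
  fix E
  have "V E' \<subseteq> variety_of n (defining_ideal n V) E'" for E'
    using V[of E'] by (auto simp: variety_of_def defining_ideal_def split: if_splits)
  moreover have "variety_of n (defining_ideal n V) E \<subseteq> X E"
    if "difference_variety n X" "\<forall>E'. V E' \<subseteq> X E'" for X
  proof -
    have "defining_ideal n X \<subseteq> defining_ideal n V" using that by (intro defining_ideal_mono) auto
    hence "variety_of n (defining_ideal n V) E \<subseteq> variety_of n (defining_ideal n X) E"
      by (auto simp: variety_of_def)
    thus ?thesis using variety_of_defining_ideal[OF that(1)] by simp
  qed
  ultimately show "Cohn_closure n V E = variety_of n (defining_ideal n V) E"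
    unfolding Cohn_closure_def using difference_variety_defining_ideal[of n V] by blast
qed

lemma defining_ideal_variety_of_defining_ideal:
  fixes V :: "'e subfunctor"
  assumes V: "\<And>E. V E \<subseteq> (if difference_field_over_Q E then {..<n} \<rightarrow>\<^sub>E carrier E else {})"
  shows "defining_ideal n (variety_of n (defining_ideal n V) :: 'e subfunctor) = defining_ideal n V"
proof (rule equalityI)
  show "defining_ideal n (variety_of n (defining_ideal n V) :: 'e subfunctor) \<subseteq> defining_ideal n V"
    by (rule defining_ideal_mono)
      (use V in \<open>fastforce simp: variety_of_def defining_ideal_def split: if_splits\<close>)
  show "defining_ideal n V \<subseteq> defining_ideal n (variety_of n (defining_ideal n V) :: 'e subfunctor)"
    by (auto simp: defining_ideal_def variety_of_def split: if_splits)
qed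

lemma quasi_torus_closure:
  assumes inf: "infinite (UNIV :: 'e set)" and \<alpha>: "\<And>i. i < n \<Longrightarrow> \<alpha> i \<in> Zx m"
  shows "Cohn_closure n (quasi_torus m n \<alpha> :: 'e subfunctor) = variety_of n (toric_ideal n \<alpha>)"
    and "defining_ideal n (variety_of n (toric_ideal n \<alpha>) :: 'e subfunctor) = toric_ideal n \<alpha>"
proof -
  have *: "quasi_torus m n \<alpha> E \<subseteq> (if difference_field_over_Q E then {..<n} \<rightarrow>\<^sub>E carrier E else {})"
    for E :: "'e difference_ring"
    using quasi_torus_subset_torus[of n \<alpha> m E] \<alpha> by (auto simp: torus_points_def PiE_def split: if_splits)
  show "Cohn_closure n (quasi_torus m n \<alpha> :: 'e subfunctor) = variety_of n (toric_ideal n \<alpha>)"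
    using Cohn_closure_eq[of "quasi_torus m n \<alpha>", OF *] defining_ideal_quasi_torus[of n \<alpha> m, OF inf \<alpha>]
    by simp
  show "defining_ideal n (variety_of n (toric_ideal n \<alpha>) :: 'e subfunctor) = toric_ideal n \<alpha>"
    using defining_ideal_variety_of_defining_ideal[of "quasi_torus m n \<alpha>", OF *]
      defining_ideal_quasi_torus[of n \<alpha> m, OF inf \<alpha>]
    by simp
qed

lemma (in difference_Q_hom) ring_hom_ring: "ring_hom_ring R S h"
  by unfold_locales (rule hom)

lemma (in difference_Q_hom) difference_ideal_kernel:
  "difference_ideal {x \<in> carrier R. h x = \<zero>\<^bsub>S\<^esub>} R"
  using ring_hom_ring.kernel_is_ideal[OF ring_hom_ring] unfolding difference_ideal_def a_kernel_def' by (auto simp: hom_shift)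

lemma keys_uminus: "keys (- f :: laurent) = keys f"
  by (auto simp: in_keys_iff)

lemma keys_laurent_diff: "keys f \<subseteq> M \<Longrightarrow> keys g \<subseteq> M \<Longrightarrow> keys (f - g :: laurent) \<subseteq> M"
  using keys_laurent_add[of f M "- g"] by (simp add: keys_uminus)

lemma keys_monomial [simp]: "keys (monomial e) = {e}"
  by (simp add: monomial_def)

lemma eval_diff_zero_iff:
  assumes R: "difference_Q_algebra R" "a \<in> {..<n} \<rightarrow> carrier R" and fg: "keys f \<subseteq> Nx n" "keys g \<subseteq> Nx n"
  shows "eval_dpoly R (f - g) a = \<zero>\<^bsub>R\<^esub> \<longleftrightarrow> eval_dpoly R f a = eval_dpoly R g a"
proof -
  interpret difference_Q_algebra R by fact
  interpret h: difference_Q_hom "dpoly_ring n" R "\<lambda>f. eval_dpoly R f a"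
    by (rule eval_dpoly_hom[OF R])
  have "eval_dpoly R f a = eval_dpoly R (f - g) a \<oplus>\<^bsub>R\<^esub> eval_dpoly R g a"
    using h.hom_add[of "f - g" g] fg by (simp add: keys_laurent_diff)
  moreover have "eval_dpoly R (f - g) a \<in> carrier R" "eval_dpoly R g a \<in> carrier R"
    using fg h.hom_closed by (simp_all add: keys_laurent_diff)
  ultimately show ?thesis by (metis add.r_cancel_one l_zero)
qed

lemma expmap_monomial: "expmap A (monomial e) = monomial (A e)"
  by (simp only: monomial_def expmap_single)

lemma monomial_inj: "monomial e = monomial f \<longleftrightarrow> e = f"
  by (metis keys_monomial singleton_inject)

section \<open>Toric ideals and lattices\<close>

text \<open>
  The lattice of a toric ideal: \<open>\<Y>\<^sup>e\<close> and \<open>\<Y>\<^bsup>e'\<^esup>\<close> agree on the quasi torus iff \<open>e - e'\<close> lies in it.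
\<close>

definition syzygies :: "nat \<Rightarrow> (nat \<Rightarrow> zvec) \<Rightarrow> zvec set" where
  "syzygies n \<alpha> = {f \<in> Zx n. lincomb n \<alpha> f = 0}"

definition lattice_binomials :: "zvec set \<Rightarrow> laurent set" where
  "lattice_binomials L = {monomial (pos_part f) - monomial (neg_part f) | f. f \<in> L}"

lemma Zx_lattice_syzygies: "Zx_lattice n (syzygies n \<alpha>)"
  by (auto simp: Zx_lattice_def zvec.subspace_def syzygies_def lincomb_add lincomb_zscale)

lemma Zx_saturated_syzygies: "Zx_saturated n (syzygies n \<alpha>)"
  using zscale_inj[of _ _ 0] by (auto simp: Zx_saturated_def syzygies_def lincomb_zscale)

lemma toric_hom: "difference_Q_hom (dpoly_ring n) laurent_ring (expmap (lincomb n \<alpha>))"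
proof -
  interpret difference_Q_algebra "dpoly_ring n" by (rule difference_Q_algebra_dpoly_ring)
  show ?thesis
    by unfold_locales (auto intro!: ring_hom_memI simp: expmap_add expmap_mult lincomb_add
      laurent_shift_expmap expmap_comp lincomb_zscale expmap_single[of _ 0 1, simplified])
qed

lemma difference_ideal_toric_ideal: "difference_ideal (toric_ideal n \<alpha>) (dpoly_ring n)"
  using difference_Q_hom.difference_ideal_kernel[OF toric_hom[of n \<alpha>]]
  by (simp add: toric_ideal_def)

lemma syzygy_parts:
  assumes "f \<in> syzygies n \<alpha>"
  shows "pos_part f \<in> Nx n" "neg_part f \<in> Nx n"
    "lincomb n \<alpha> (pos_part f) = lincomb n \<alpha> (neg_part f)"
  using assms pos_neg_part_in_Nx[of f n] pos_part_minus_neg_part[of f]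
    lincomb_diff[of n \<alpha> "pos_part f" "neg_part f"]
  by (auto simp: syzygies_def)

lemma primeideal_toric_ideal: "primeideal (toric_ideal n \<alpha>) (dpoly_ring n)"
proof (rule primeidealI)
  show "ideal (toric_ideal n \<alpha>) (dpoly_ring n)"
    using difference_ideal_toric_ideal by (simp add: difference_ideal_def)
  show "cring (dpoly_ring n)"
    using difference_Q_algebra_dpoly_ring by (simp add: difference_Q_algebra_def)
  have "expmap (lincomb n \<alpha>) 1 = 1"
    using expmap_monomial[of "lincomb n \<alpha>" 0] by (simp add: monomial_0)
  hence "1 \<notin> toric_ideal n \<alpha>" by (simp add: toric_ideal_def)
  moreover have "1 \<in> carrier (dpoly_ring n)" by simp
  ultimately show "carrier (dpoly_ring n) \<noteq> toric_ideal n \<alpha>" by blast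
qed (auto simp: toric_ideal_def expmap_mult lincomb_add)

lemma binomial_in_toric_ideal:
  assumes "e \<in> Nx n" "e' \<in> Nx n" "lincomb n \<alpha> e = lincomb n \<alpha> e'"
  shows "monomial e - monomial e' \<in> toric_ideal n \<alpha>"
  using assms by (simp add: toric_ideal_def keys_laurent_diff expmap_diff expmap_monomial)

lemma lattice_binomials_subset_toric_ideal:
  "lattice_binomials (syzygies n \<alpha>) \<subseteq> toric_ideal n \<alpha>"
  unfolding lattice_binomials_def using syzygy_parts binomial_in_toric_ideal by blast

lemma ideal_dpoly_closed:
  assumes "ideal I (dpoly_ring n)"
  shows "0 \<in> I" "f \<in> I \<Longrightarrow> g \<in> I \<Longrightarrow> f + g \<in> I" "f \<in> I \<Longrightarrow> keys g \<subseteq> Nx n \<Longrightarrow> g * f \<in> I"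
    "f \<in> I \<Longrightarrow> keys f \<subseteq> Nx n"
proof -
  interpret ideal I "dpoly_ring n" by fact
  show "0 \<in> I" "f \<in> I \<Longrightarrow> g \<in> I \<Longrightarrow> f + g \<in> I" "f \<in> I \<Longrightarrow> keys g \<subseteq> Nx n \<Longrightarrow> g * f \<in> I"
    "f \<in> I \<Longrightarrow> keys f \<subseteq> Nx n"
    using additive_subgroup.zero_closed[OF additive_subgroup_axioms]
      additive_subgroup.a_closed[OF additive_subgroup_axioms, of f g] I_l_closed[of f g] Icarr[of f] by auto
qed

lemma binomial_in_ideal:
  assumes I: "ideal I (dpoly_ring n)" and L: "lattice_binomials L \<subseteq> I"
    and e: "e \<in> Nx n" "e' \<in> Nx n" "e - e' \<in> L"
  shows "monomial e - monomial e' \<in> I"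
proof -
  obtain c where c: "c \<in> Nx n" "e = pos_part (e - e') + c" "e' = neg_part (e - e') + c"
    using common_part[OF e(1,2)] by blast
  have "monomial (pos_part (e - e')) - monomial (neg_part (e - e')) \<in> I"
    using L e(3) by (auto simp: lattice_binomials_def)
  hence "monomial c * (monomial (pos_part (e - e')) - monomial (neg_part (e - e'))) \<in> I"
    using c(1) by (intro ideal_dpoly_closed(3)[OF I]) auto
  also have "monomial c * (monomial (pos_part (e - e')) - monomial (neg_part (e - e'))) =
      monomial e - monomial e'"
    by (subst (2) c(2), subst (2) c(3)) (simp only: right_diff_distrib monomial_add mult.commute)
  finally show ?thesis .
qed

text \<open>
  If the substitution kills \<open>f\<close>, then every term of \<open>f\<close> has a partner with another exponent but
  the same image.  Subtracting a multiple of the binomial of these two exponents removes the term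
  without creating new ones, so that induction on the number of terms applies.
\<close>

lemma toric_ideal_subset:
  assumes I: "ideal I (dpoly_ring n)" and L: "lattice_binomials (syzygies n \<alpha>) \<subseteq> I"
  shows "toric_ideal n \<alpha> \<subseteq> I"
proof
  fix f assume "f \<in> toric_ideal n \<alpha>"
  thus "f \<in> I"
  proof (induction "card (keys f)" arbitrary: f rule: less_induct)
    case less
    have f: "keys f \<subseteq> Nx n" "expmap (lincomb n \<alpha>) f = 0" using less.prems by (auto simp: toric_ideal_def)
    show ?case
    proof (cases "f = 0")
      case True thus ?thesis by (simp add: ideal_dpoly_closed[OF I])
    next
      case False
      then obtain e where e: "e \<in> keys f" by (metis keys_eq_empty ex_in_conv)
      have "\<exists>e'\<in>keys f. e' \<noteq> e \<and> lincomb n \<alpha> e' = lincomb n \<alpha> e"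
      proof (rule ccontr)
        assume "\<not> ?thesis"
        hence "{e' \<in> keys f. lincomb n \<alpha> e' = lincomb n \<alpha> e} = {e}" using e by auto
        hence "lookup (expmap (lincomb n \<alpha>) f) (lincomb n \<alpha> e) = lookup f e"
          by (simp add: lookup_expmap)
        thus False using f(2) e by (simp add: in_keys_iff)
      qed
      then obtain e' where e': "e' \<in> keys f" "e' \<noteq> e" "lincomb n \<alpha> e' = lincomb n \<alpha> e" by blast
      have N: "e \<in> Nx n" "e' \<in> Nx n" using e e' f by auto
      let ?b = "Poly_Mapping.single 0 (lookup f e) * (monomial e - monomial e')"
      have b: "?b = Poly_Mapping.single e (lookup f e) - Poly_Mapping.single e' (lookup f e)"
        by (simp add: monomial_def right_diff_distrib mult_single)
      have "e - e' \<in> syzygies n \<alpha>"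
        using N e' Nx_subset_Zx by (auto simp: syzygies_def lincomb_diff)
      hence bI: "?b \<in> I"
        by (intro ideal_dpoly_closed(3)[OF I] binomial_in_ideal[OF I L N]) auto
      have "keys (f - ?b) \<subseteq> keys f - {e}"
        unfolding b using e' e
        by (auto simp: in_keys_iff lookup_minus lookup_single when_def split: if_splits)
      hence "card (keys (f - ?b)) < card (keys f)" and k: "keys (f - ?b) \<subseteq> Nx n"
        using e f by (auto intro!: psubset_card_mono)
      moreover have "f - ?b \<in> toric_ideal n \<alpha>"
        using k f e'(3) by (simp add: toric_ideal_def expmap_diff) (simp add: b expmap_diff)
      ultimately have "f - ?b \<in> I" by (intro less.hyps)
      from ideal_dpoly_closed(2)[OF I this bI] show ?thesis by simp
    qed
  qed
qed

theorem toric_ideal_eq_gen: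
  "toric_ideal n \<alpha> = gen_difference_ideal (dpoly_ring n) (lattice_binomials (syzygies n \<alpha>))"
  unfolding gen_difference_ideal_def
  using toric_ideal_subset[of _ n \<alpha>] lattice_binomials_subset_toric_ideal[of n \<alpha>]
    difference_ideal_toric_ideal[of n \<alpha>]
  by (auto simp: difference_ideal_def)

section \<open>Saturated lattices are syzygy modules\<close>

lemma lookup_lincomb: "lookup (lincomb n \<alpha> f) k = (\<Sum>i<n. lookup f i * lookup (\<alpha> i) k)"
  by (simp add: lincomb_def lookup_sum lookup_zscale)

text \<open>
  The set \<open>B\<close> is a maximal set of unit vectors that is linearly independent modulo \<open>L\<close>.  By
  maximality a nonzero multiple of each unit vector is congruent to a combination of \<open>B\<close>, and
  \<open>D\<close> is the product of the multipliers.  Over \<open>\<rat>(x)\<close> the set \<open>B\<close> is a basis of the quotient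
  space.
\<close>

lemma saturated_lattice_common_denominator:
  assumes L: "Zx_lattice n L"
  obtains B D \<rho> where "B \<subseteq> {..<n}" "D \<noteq> 0" "\<And>i. i < n \<Longrightarrow> keys (\<rho> i) \<subseteq> B"
    "\<And>i. i < n \<Longrightarrow> zscale D (unit_vec i) - \<rho> i \<in> L"
    "\<And>f. keys f \<subseteq> B \<Longrightarrow> f \<in> L \<Longrightarrow> f = 0"
proof -
  have sub: "zvec.subspace L" using L by (auto simp: Zx_lattice_def)
  define indep where "indep B \<longleftrightarrow> (\<forall>f. keys f \<subseteq> B \<longrightarrow> f \<in> L \<longrightarrow> f = 0)" for B
  have "\<exists>B. (B \<subseteq> {..<n} \<and> indep B) \<and> (\<forall>C. (C \<subseteq> {..<n} \<and> indep C) \<longrightarrow> card C \<le> card B)"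
  proof (rule Lattices_Big.ex_has_greatest_nat)
    show "{} \<subseteq> {..<n} \<and> indep {}" by (auto simp: indep_def)
    show "\<forall>C. (C \<subseteq> {..<n} \<and> indep C) \<longrightarrow> card C < Suc n"
      using card_mono[of "{..<n}"] by (auto simp: less_Suc_eq_le)
  qed
  then obtain B where B: "B \<subseteq> {..<n}" "indep B"
    and max: "\<And>C. C \<subseteq> {..<n} \<Longrightarrow> indep C \<Longrightarrow> card C \<le> card B" by blast
  have "\<exists>d r. d \<noteq> 0 \<and> keys r \<subseteq> B \<and> zscale d (unit_vec i) - r \<in> L" if i: "i < n" for i
  proof (cases "i \<in> B")
    case True
    hence "keys (unit_vec i) \<subseteq> B" by (simp add: unit_vec_def)
    thus ?thesis
      using sub zvec.scale_one[of "unit_vec i"] by (metis diff_self one_neq_zero zvec.subspace_0)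
  next
    case False
    have "finite B" using B(1) finite_subset by blast
    hence "\<not> indep (insert i B)"
      using max[of "insert i B"] i B(1) False by auto
    then obtain f where f: "keys f \<subseteq> insert i B" "f \<in> L" "f \<noteq> 0" by (auto simp: indep_def)
    define r where "r = zscale (lookup f i) (unit_vec i) - f"
    have "keys r \<subseteq> B"
    proof
      fix k assume "k \<in> keys r"
      thus "k \<in> B" using f(1)
        by (cases "k = i") (auto simp: in_keys_iff r_def lookup_minus lookup_zscale lookup_unit_vec)
    qed
    moreover have "lookup f i \<noteq> 0"
    proof
      assume "lookup f i = 0"
      hence "keys f \<subseteq> B" using f(1) by (auto simp: in_keys_iff)
      thus False using B(2) f by (auto simp: indep_def)
    qed
    moreover have "zscale (lookup f i) (unit_vec i) - r \<in> L" using f by (simp add: r_def)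
    ultimately show ?thesis by blast
  qed
  then obtain d r where dr: "\<And>i. i < n \<Longrightarrow> d i \<noteq> 0" "\<And>i. i < n \<Longrightarrow> keys (r i) \<subseteq> B"
    "\<And>i. i < n \<Longrightarrow> zscale (d i) (unit_vec i) - r i \<in> L" by metis
  define D where "D = (\<Prod>i<n. d i)"
  define \<rho> where "\<rho> i = zscale (\<Prod>k\<in>{..<n}-{i}. d k) (r i)" for i
  show thesis
  proof
    show "B \<subseteq> {..<n}" by (rule B(1))
    show "D \<noteq> 0" using dr(1) by (simp add: D_def)
    show "keys (\<rho> i) \<subseteq> B" if "i < n" for i
      using dr(2)[OF that] by (auto simp: \<rho>_def in_keys_iff lookup_zscale)
    show "zscale D (unit_vec i) - \<rho> i \<in> L" if "i < n" for i
    proof -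
      have "D = (\<Prod>k\<in>{..<n}-{i}. d k) * d i"
        using that by (simp add: D_def prod.remove[of _ i] mult.commute)
      hence "zscale D (unit_vec i) - \<rho> i = zscale (\<Prod>k\<in>{..<n}-{i}. d k) (zscale (d i) (unit_vec i) - r i)"
        by (simp add: \<rho>_def zvec.scale_right_diff_distrib)
      thus ?thesis using sub dr(3)[OF that] by (simp add: zvec.subspace_scale)
    qed
    show "f = 0" if "keys f \<subseteq> B" "f \<in> L" for f using B(2) that by (auto simp: indep_def)
  qed
qed

text \<open>
  The quotient \<open>\<int>[x]\<^sup>n / L\<close> is torsion-free, hence embeds into a free module.  Explicitly, modulo
  \<open>L\<close> the vector \<open>D f\<close> is congruent to the combination of the \<open>\<rho>\<^sub>i\<close> with coefficients \<open>f\<^sub>i\<close>,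
  which is supported in \<open>B\<close>; saturation gives \<open>f \<in> L\<close> iff \<open>D f \<in> L\<close>, and independence of \<open>B\<close>
  makes the latter equivalent to the vanishing of that combination.  Numbering \<open>B\<close> turns it into
  a map to \<open>\<int>[x]\<^sup>m\<close>, and no row of it is zero because \<open>\<rho>\<^sub>i = D \<epsilon>\<^sub>i\<close> for \<open>i \<in> B\<close>.
\<close>

theorem saturated_lattice_syzygies:
  assumes L: "Zx_lattice n L" and sat: "Zx_saturated n L"
  obtains m \<alpha> where "\<And>i. i < n \<Longrightarrow> \<alpha> i \<in> Zx m"
    "\<And>k. k < m \<Longrightarrow> \<exists>i<n. lookup (\<alpha> i) k \<noteq> 0" "L = syzygies n \<alpha>"
proof -
  have LZ: "L \<subseteq> Zx n" and sub: "zvec.subspace L" using L by (auto simp: Zx_lattice_def)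
  obtain B D \<rho> where B: "B \<subseteq> {..<n}" and D: "D \<noteq> 0" and \<rho>: "\<And>i. i < n \<Longrightarrow> keys (\<rho> i) \<subseteq> B"
    and D\<rho>: "\<And>i. i < n \<Longrightarrow> zscale D (unit_vec i) - \<rho> i \<in> L"
    and indep: "\<And>f. keys f \<subseteq> B \<Longrightarrow> f \<in> L \<Longrightarrow> f = 0"
    using saturated_lattice_common_denominator[OF L] by metis
  have keys: "keys (lincomb n \<rho> f) \<subseteq> B" for f
  proof -
    have "keys (zscale (lookup f i) (\<rho> i)) \<subseteq> B" if "i < n" for i
      using \<rho>[OF that] by (auto simp: in_keys_iff lookup_zscale)
    hence "(\<Union>i\<in>{..<n}. keys (zscale (lookup f i) (\<rho> i))) \<subseteq> B" by blast
    thus ?thesis using keys_sum[of "\<lambda>i. zscale (lookup f i) (\<rho> i)" "{..<n}"]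
      unfolding lincomb_def by blast
  qed
  have in_L: "f \<in> L \<longleftrightarrow> lincomb n \<rho> f = 0" if f: "f \<in> Zx n" for f
  proof -
    have "zscale D f - lincomb n \<rho> f = (\<Sum>i<n. zscale (lookup f i) (zscale D (unit_vec i) - \<rho> i))"
      by (subst (1) lincomb_unit_vecs[OF f, symmetric])
        (simp add: lincomb_def zvec.scale_sum_right zvec.scale_right_diff_distrib sum_subtractf mult.commute)
    also have "\<dots> \<in> L" using sub D\<rho> by (intro zvec.subspace_sum zvec.subspace_scale) auto
    finally have *: "zscale D f - lincomb n \<rho> f \<in> L" .
    have "f \<in> L \<longleftrightarrow> zscale D f \<in> L"
      using sat D f zvec.subspace_scale[OF sub] unfolding Zx_saturated_def by blast
    also have "\<dots> \<longleftrightarrow> lincomb n \<rho> f \<in> L"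
      using zvec.subspace_diff[OF sub _ *, of "zscale D f"] zvec.subspace_add[OF sub *, of "lincomb n \<rho> f"]
      by auto
    also have "\<dots> \<longleftrightarrow> lincomb n \<rho> f = 0" using indep[OF keys] sub by (auto simp: zvec.subspace_0)
    finally show ?thesis .
  qed
  define m where "m = card B"
  have "finite B" using B finite_subset by blast
  then obtain b where b: "bij_betw b {..<m} B"
    using ex_bij_betw_nat_finite[of B] by (auto simp: m_def atLeast0LessThan)
  define \<alpha> where "\<alpha> i = (\<Sum>k<m. zscale (lookup (\<rho> i) (b k)) (unit_vec k))" for i
  have lookup_\<alpha>: "lookup (\<alpha> i) k = (if k < m then lookup (\<rho> i) (b k) else 0)" for i k
    by (simp add: \<alpha>_def lookup_sum lookup_zscale lookup_unit_vec if_distrib cong: if_cong)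
  have "lincomb n \<alpha> f = 0 \<longleftrightarrow> lincomb n \<rho> f = 0" for f
  proof -
    have "lookup (lincomb n \<alpha> f) k = (if k < m then lookup (lincomb n \<rho> f) (b k) else 0)" for k
      by (simp add: lookup_lincomb lookup_\<alpha>)
    hence "lincomb n \<alpha> f = 0 \<longleftrightarrow> (\<forall>k<m. lookup (lincomb n \<rho> f) (b k) = 0)"
      by (auto simp: poly_mapping_eq_iff fun_eq_iff)
    also have "\<dots> \<longleftrightarrow> (\<forall>k\<in>B. lookup (lincomb n \<rho> f) k = 0)"
      unfolding bij_betw_imp_surj_on[OF b, symmetric] by auto
    also have "\<dots> \<longleftrightarrow> lincomb n \<rho> f = 0"
      using keys[of f] by (auto simp: poly_mapping_eq_iff fun_eq_iff in_keys_iff subset_iff)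
    finally show ?thesis .
  qed
  hence "L = syzygies n \<alpha>" using in_L LZ by (auto simp: syzygies_def)
  moreover have "\<exists>i<n. lookup (\<alpha> i) k \<noteq> 0" if "k < m" for k
  proof (intro exI conjI)
    have bk: "b k \<in> B" using b that by (auto simp: bij_betw_def)
    show "b k < n" using bk B by auto
    have "keys (zscale D (unit_vec (b k)) - \<rho> (b k)) \<subseteq> B"
    proof
      fix j assume "j \<in> keys (zscale D (unit_vec (b k)) - \<rho> (b k))"
      thus "j \<in> B" using \<rho>[OF \<open>b k < n\<close>] bk
        by (cases "j = b k") (auto simp: in_keys_iff lookup_minus lookup_zscale lookup_unit_vec)
    qed
    hence "zscale D (unit_vec (b k)) - \<rho> (b k) = 0" using indep D\<rho>[OF \<open>b k < n\<close>] by blast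
    hence "lookup (zscale D (unit_vec (b k)) - \<rho> (b k)) (b k) = 0" by (simp only: lookup_zero)
    hence "lookup (\<rho> (b k)) (b k) = D" by (simp add: lookup_minus lookup_zscale lookup_unit_vec)
    thus "lookup (\<alpha> (b k)) k \<noteq> 0" using D that by (simp add: lookup_\<alpha>)
  qed
  ultimately show thesis
    using that[of \<alpha> m] by (auto simp: Zx_iff lookup_\<alpha>)
qed

section \<open>Toric varieties and toric ideals\<close>

text \<open>
  Both conditions say that \<open>y\<^sub>i - 1\<close> lies in the toric ideal.
\<close>

lemma unit_coordinate_iff:
  assumes X: "difference_variety n X" and I: "defining_ideal n X = toric_ideal n \<alpha>" and i: "i < n"
  shows "\<alpha> i = 0 \<longleftrightarrow> (\<forall>E. \<forall>a\<in>X E. a i = \<one>\<^bsub>E\<^esub>)"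
proof -
  let ?b = "monomial (unit_vec i) - monomial 0"
  have k: "keys ?b \<subseteq> Nx n" using i by (intro keys_laurent_diff) auto
  have "\<alpha> i = 0 \<longleftrightarrow> expmap (lincomb n \<alpha>) ?b = 0"
    using i by (simp add: expmap_diff lincomb_unit_vec expmap_monomial monomial_inj)
  also have "\<dots> \<longleftrightarrow> ?b \<in> defining_ideal n X"
    using k unfolding I by (simp add: toric_ideal_def)
  also have "\<dots> \<longleftrightarrow> (\<forall>E. \<forall>a\<in>X E. eval_dpoly E ?b a = \<zero>\<^bsub>E\<^esub>)"
    using k by (simp add: defining_ideal_def)
  also have "\<dots> \<longleftrightarrow> (\<forall>E. \<forall>a\<in>X E. a i = \<one>\<^bsub>E\<^esub>)"
  proof (intro iff_allI ball_cong refl)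
    fix E a assume a: "a \<in> X E"
    interpret difference_Q_algebra E
      by (rule difference_Q_algebra_field[OF difference_variety_points(1)[OF X a]])
    have a': "a \<in> {..<n} \<rightarrow> carrier E" using difference_variety_points(2)[OF X a] by auto
    have "eval_dpoly E (monomial 0) a = \<one>\<^bsub>E\<^esub>"
      using ring_hom_one[OF difference_Q_hom.hom[OF eval_dpoly_hom[OF difference_Q_algebra_axioms a']]]
      by (simp add: monomial_0)
    thus "eval_dpoly E ?b a = \<zero>\<^bsub>E\<^esub> \<longleftrightarrow> a i = \<one>\<^bsub>E\<^esub>"
      using i by (simp add: eval_diff_zero_iff[OF difference_Q_algebra_axioms a']
        eval_dpoly_unit_vec[OF difference_Q_algebra_axioms a'])
  qed
  finally show ?thesis .
qed

theorem toric_varietyE: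
  assumes inf: "infinite (UNIV :: 'e set)" and X: "toric_variety n (X :: 'e subfunctor)"
  obtains m \<alpha> where "defining_vector m n \<alpha>" "X = Cohn_closure n (quasi_torus m n \<alpha>)"
    "X = variety_of n (toric_ideal n \<alpha>)"
    "defining_ideal n X = toric_ideal n \<alpha>" "difference_variety n X" "no_unit_coordinate n X"
proof -
  obtain m \<alpha> where \<alpha>: "defining_vector m n \<alpha>" and X: "X = Cohn_closure n (quasi_torus m n \<alpha>)"
    using X by (auto simp: toric_variety_def)
  have \<alpha>m: "\<And>i. i < n \<Longrightarrow> \<alpha> i \<in> Zx m" using \<alpha> by (simp add: defining_vector_def)
  have X': "X = variety_of n (toric_ideal n \<alpha>)"
    unfolding X by (rule quasi_torus_closure(1)[OF inf \<alpha>m])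
  have I: "defining_ideal n X = toric_ideal n \<alpha>"
    unfolding X' by (rule quasi_torus_closure(2)[OF inf \<alpha>m])
  have V: "difference_variety n X" unfolding X' difference_variety_def
    by (rule exI[of _ "toric_ideal n \<alpha>"]) (auto simp: toric_ideal_def)
  have "no_unit_coordinate n X"
    using unit_coordinate_iff[OF V I] \<alpha> by (auto simp: no_unit_coordinate_def defining_vector_def)
  thus thesis using that \<alpha> X X' I V by blast
qed

theorem toric_varietyI:
  assumes inf: "infinite (UNIV :: 'e set)" and V: "difference_variety n (X :: 'e subfunctor)"
    and unit: "no_unit_coordinate n X"
    and L: "Zx_lattice n L" "Zx_saturated n L"
    and I: "defining_ideal n X = gen_difference_ideal (dpoly_ring n) (lattice_binomials L)"
  shows "toric_variety n X"
proof -
  obtain m \<alpha> where \<alpha>: "\<And>i. i < n \<Longrightarrow> \<alpha> i \<in> Zx m"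
    and row: "\<And>k. k < m \<Longrightarrow> \<exists>i<n. lookup (\<alpha> i) k \<noteq> 0" and L': "L = syzygies n \<alpha>"
    using saturated_lattice_syzygies[OF L] by blast
  have I': "defining_ideal n X = toric_ideal n \<alpha>" unfolding I L' toric_ideal_eq_gen ..
  have "\<alpha> i \<noteq> 0" if "i < n" for i
    using unit_coordinate_iff[OF V I' that] unit that by (auto simp: no_unit_coordinate_def)
  hence "defining_vector m n \<alpha>" using \<alpha> row by (auto simp: defining_vector_def)
  moreover have "X = Cohn_closure n (quasi_torus m n \<alpha>)"
    using variety_of_defining_ideal[OF V] I' quasi_torus_closure(1)[of n \<alpha> m, OF inf \<alpha>] by simp
  ultimately show ?thesis by (auto simp: toric_variety_def)
qed

text \<open>
  The vectors \<open>\<gamma>\<^sub>i\<close> may leave some indeterminates unused.  Passing through the lattice of syzygies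
  exchanges them for vectors that satisfy the convention on rows.
\<close>

corollary toric_variety_if_toric_ideal:
  assumes inf: "infinite (UNIV :: 'e set)" and V: "difference_variety n (X :: 'e subfunctor)"
    and unit: "no_unit_coordinate n X" and I: "defining_ideal n X = toric_ideal n \<gamma>"
  shows "toric_variety n X"
  using toric_varietyI[OF inf V unit Zx_lattice_syzygies Zx_saturated_syzygies] I toric_ideal_eq_gen
  by blast

section \<open>Coordinate rings and isomorphisms of varieties\<close>

lemma difference_Q_hom_comp:
  assumes "difference_Q_hom R S g" "difference_Q_hom S T h"
  shows "difference_Q_hom R T (\<lambda>x. h (g x))"
proof -
  interpret g: difference_Q_hom R S g by fact
  interpret h: difference_Q_hom S T h by fact
  show ?thesis
    by unfold_locales (auto intro!: ring_hom_memI simp: g.hom_shift h.hom_shift)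
qed

lemma difference_Q_hom_module_ring_inclusion:
  assumes "exponent_monoid M" shows "difference_Q_hom (module_ring M) laurent_ring (\<lambda>f. f)"
proof -
  interpret difference_Q_algebra "module_ring M"
    by (rule difference_Q_algebra_module_ring[OF assms])
  show ?thesis by unfold_locales (auto intro!: ring_hom_memI)
qed

text \<open>
  A polynomial is its own value at the point \<open>(y\<^sub>1, \<dots>, y\<^sub>n)\<close>.
\<close>

lemma hom_dpoly_eq_eval:
  assumes h: "difference_Q_hom (dpoly_ring n) S h" and f: "keys f \<subseteq> Nx n"
  shows "h f = eval_dpoly S f (\<lambda>i. h (monomial (unit_vec i)))"
proof -
  let ?y = "\<lambda>i. monomial (unit_vec i)"
  interpret h: difference_Q_hom "dpoly_ring n" S h by (rule h)
  interpret i: difference_Q_hom "dpoly_ring n" laurent_ring "\<lambda>f. f"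
    unfolding dpoly_ring_def by (rule difference_Q_hom_module_ring_inclusion) simp
  have adm: "keys f \<subseteq> h.R.admissible n ?y"
    using f by (intro dpoly_keys_admissible h.R.difference_Q_algebra_axioms) auto
  have "eval_dpoly (dpoly_ring n) f ?y = eval_dpoly laurent_ring f ?y"
    using i.hom_eval[OF adm] .
  also have "\<dots> = expmap (lincomb n unit_vec) f"
    using f Nx_subset_Zx by (intro eval_monomials) blast
  also have "\<dots> = f"
    using f Nx_subset_Zx by (intro expmap_id lincomb_unit_vecs) blast
  finally show ?thesis using h.hom_eval[OF adm] by simp
qed

lemma hom_dpoly_eqI:
  assumes g: "difference_Q_hom (dpoly_ring n) S g" and h: "difference_Q_hom (dpoly_ring n) S h"
    and eq: "\<And>i. i < n \<Longrightarrow> g (monomial (unit_vec i)) = h (monomial (unit_vec i))"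
    and f: "keys f \<subseteq> Nx n"
  shows "g f = h f"
proof -
  interpret g: difference_Q_hom "dpoly_ring n" S g by (rule g)
  have "eval_dpoly S f (\<lambda>i. g (monomial (unit_vec i))) = eval_dpoly S f (\<lambda>i. h (monomial (unit_vec i)))"
    using f eq by (intro g.S.eval_cong[of _ n] dpoly_keys_admissible g.S.difference_Q_algebra_axioms)
      (auto intro!: g.hom_closed)
  thus ?thesis using hom_dpoly_eq_eval[OF g f] hom_dpoly_eq_eval[OF h f] by simp
qed

abbreviation substitute :: "nat \<Rightarrow> (nat \<Rightarrow> laurent) \<Rightarrow> laurent \<Rightarrow> laurent" where
  "substitute n F f \<equiv> eval_dpoly (dpoly_ring n) f F"

lemma substitute_hom:
  assumes "\<And>i. i < n' \<Longrightarrow> F i \<in> carrier (dpoly_ring n)"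
  shows "difference_Q_hom (dpoly_ring n') (dpoly_ring n) (substitute n F)"
  using assms by (intro eval_dpoly_hom difference_Q_algebra_dpoly_ring) auto

lemma substitute_closed:
  assumes "\<And>i. i < n' \<Longrightarrow> F i \<in> carrier (dpoly_ring n)" "keys f \<subseteq> Nx n'"
  shows "keys (substitute n F f) \<subseteq> Nx n"
  using ring_hom_closed[OF difference_Q_hom.hom[OF substitute_hom[of n' F n, OF assms(1)]], of f] assms(2)
  by simp

lemma substitute_unit_vec:
  assumes "\<And>i. i < n' \<Longrightarrow> F i \<in> carrier (dpoly_ring n)" "i < n'"
  shows "substitute n F (monomial (unit_vec i)) = F i"
  using assms by (intro eval_dpoly_unit_vec[of _ _ n'] difference_Q_algebra_dpoly_ring) auto

lemma eval_substitute:
  assumes E: "difference_field_over_Q E" and a: "a \<in> {..<n} \<rightarrow>\<^sub>E carrier E"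
    and F: "\<And>i. i < n' \<Longrightarrow> F i \<in> carrier (dpoly_ring n)" and f: "keys f \<subseteq> Nx n'"
  shows "eval_dpoly E f (eval_map n' E F a) = eval_dpoly E (substitute n F f) a"
proof -
  interpret E: difference_Q_algebra E by (rule difference_Q_algebra_field[OF E])
  have a': "a \<in> {..<n} \<rightarrow> carrier E" using a by auto
  interpret h: difference_Q_hom "dpoly_ring n" E "\<lambda>f. eval_dpoly E f a"
    by (rule eval_dpoly_hom[OF E.difference_Q_algebra_axioms a'])
  have "eval_dpoly E (substitute n F f) a = eval_dpoly E f (\<lambda>i. eval_dpoly E (F i) a)"
    using F f by (intro h.hom_eval[of _ n'] dpoly_keys_admissible difference_Q_algebra_dpoly_ring) auto
  also have "\<dots> = eval_dpoly E f (eval_map n' E F a)"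
    using F f h.hom_closed
    by (intro E.eval_cong[of _ n'] dpoly_keys_admissible E.difference_Q_algebra_axioms)
      (auto simp: eval_map_def)
  finally show ?thesis ..
qed

lemma eval_map_closed:
  assumes E: "difference_field_over_Q E" and a: "a \<in> {..<n} \<rightarrow>\<^sub>E carrier E"
    and F: "\<And>i. i < n' \<Longrightarrow> F i \<in> carrier (dpoly_ring n)"
  shows "eval_map n' E F a \<in> {..<n'} \<rightarrow>\<^sub>E carrier E"
proof -
  have "a \<in> {..<n} \<rightarrow> carrier E" using a by auto
  note h = eval_dpoly_hom[OF difference_Q_algebra_field[OF E] this]
  show ?thesis using ring_hom_closed[OF difference_Q_hom.hom[OF h]] F by (auto simp: eval_map_def)
qed

text \<open>
  A homomorphism whose kernel is the defining ideal.  Its image is a copy of the coordinate ring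
  that avoids cosets.
\<close>

definition presents :: "nat \<Rightarrow> 'e subfunctor \<Rightarrow> 'b difference_ring \<Rightarrow> (laurent \<Rightarrow> 'b) \<Rightarrow> bool" where
  "presents n X S h \<longleftrightarrow> difference_Q_hom (dpoly_ring n) S h \<and>
     defining_ideal n X = {f \<in> carrier (dpoly_ring n). h f = \<zero>\<^bsub>S\<^esub>}"

lemma presents_eq_iff:
  assumes X: "difference_variety n X" and h: "presents n X S h"
    and f: "keys f \<subseteq> Nx n" and g: "keys g \<subseteq> Nx n"
  shows "h f = h g \<longleftrightarrow> (\<forall>E. \<forall>a\<in>X E. eval_dpoly E f a = eval_dpoly E g a)"
proof -
  interpret h: difference_Q_hom "dpoly_ring n" S h using h by (simp add: presents_def)
  have k: "keys (f - g) \<subseteq> Nx n" by (rule keys_laurent_diff[OF f g])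
  have "h f = h (f - g) \<oplus>\<^bsub>S\<^esub> h g" using h.hom_add[of "f - g" g] k g by simp
  hence "h f = h g \<longleftrightarrow> h (f - g) = \<zero>\<^bsub>S\<^esub>"
    using k g h.hom_closed by (metis dpoly_ring_simps(1) h.S.add.r_cancel_one h.S.l_zero mem_Collect_eq)
  also have "\<dots> \<longleftrightarrow> f - g \<in> defining_ideal n X" using h k by (simp add: presents_def)
  also have "\<dots> \<longleftrightarrow> (\<forall>E. \<forall>a\<in>X E. eval_dpoly E (f - g) a = \<zero>\<^bsub>E\<^esub>)"
    using k by (simp add: defining_ideal_def)
  also have "\<dots> \<longleftrightarrow> (\<forall>E. \<forall>a\<in>X E. eval_dpoly E f a = eval_dpoly E g a)"
    using difference_variety_points[OF X] f g
    by (intro iff_allI ball_cong refl eval_diff_zero_iff[of _ _ n] difference_Q_algebra_field)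
      (auto simp: PiE_def)
  finally show ?thesis .
qed

text \<open>
  Preimages under \<open>h\<close> of the \<open>h'(y\<^sub>i)\<close>, and preimages under \<open>h'\<close> of the \<open>h(y\<^sub>i)\<close>, serve as the
  two polynomial maps: substituting them intertwines \<open>h\<close> and \<open>h'\<close>, so that all required
  identities hold modulo the defining ideals.
\<close>

lemma isomorphic_varieties_if_same_image:
  assumes X: "difference_variety n (X :: 'e subfunctor)" and X': "difference_variety n' (X' :: 'e subfunctor)"
    and h: "presents n X S h" and h': "presents n' X' S h'"
    and img: "h ` carrier (dpoly_ring n) = h' ` carrier (dpoly_ring n')"
  shows "isomorphic_varieties n X n' X'"
proof -
  have hom: "difference_Q_hom (dpoly_ring n) S h" "difference_Q_hom (dpoly_ring n') S h'"
    using h h' by (auto simp: presents_def)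
  have "\<exists>p\<in>carrier (dpoly_ring n). h p = h' (monomial (unit_vec i))" if "i < n'" for i
  proof -
    have "h' (monomial (unit_vec i)) \<in> h' ` carrier (dpoly_ring n')" using that by (simp add: imageI)
    hence "h' (monomial (unit_vec i)) \<in> h ` carrier (dpoly_ring n)" by (simp only: img)
    thus ?thesis by (metis imageE)
  qed
  then obtain F where F: "\<And>i. i < n' \<Longrightarrow> F i \<in> carrier (dpoly_ring n)"
    "\<And>i. i < n' \<Longrightarrow> h (F i) = h' (monomial (unit_vec i))" by metis
  have "\<exists>p\<in>carrier (dpoly_ring n'). h' p = h (monomial (unit_vec i))" if "i < n" for i
  proof -
    have "h (monomial (unit_vec i)) \<in> h ` carrier (dpoly_ring n)" using that by (simp add: imageI)
    hence "h (monomial (unit_vec i)) \<in> h' ` carrier (dpoly_ring n')" by (simp only: img)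
    thus ?thesis by (metis imageE)
  qed
  then obtain G where G: "\<And>i. i < n \<Longrightarrow> G i \<in> carrier (dpoly_ring n')"
    "\<And>i. i < n \<Longrightarrow> h' (G i) = h (monomial (unit_vec i))" by metis
  \<comment> \<open>Stated for arbitrary data because it is used in both directions.\<close>
  have main: "eval_map n' E F a \<in> X' E \<and> eval_map n E G (eval_map n' E F a) = a"
    if X: "difference_variety n X" and X': "difference_variety n' X'"
      and h: "presents n X S h" and h': "presents n' X' S h'"
      and F: "\<And>i. i < n' \<Longrightarrow> F i \<in> carrier (dpoly_ring n)"
        "\<And>i. i < n' \<Longrightarrow> h (F i) = h' (monomial (unit_vec i))"
      and G: "\<And>i. i < n \<Longrightarrow> G i \<in> carrier (dpoly_ring n')"
        "\<And>i. i < n \<Longrightarrow> h' (G i) = h (monomial (unit_vec i))"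
      and a: "a \<in> X E"
    for n n' h h' F G X X' and E :: "'e difference_ring" and a
  proof
    have hom: "difference_Q_hom (dpoly_ring n) S h" "difference_Q_hom (dpoly_ring n') S h'"
      using h h' by (auto simp: presents_def)
    note E = difference_variety_points[OF X a]
    note comp = difference_Q_hom_comp[OF substitute_hom[of n' F n, OF F(1)] hom(1)]
    have gen: "h (substitute n F (monomial (unit_vec i))) = h' (monomial (unit_vec i))" if "i < n'" for i
      using F(2)[OF that] substitute_unit_vec[of n' F n i, OF F(1) that] by simp
    have eq: "h (substitute n F p) = h' p" if "keys p \<subseteq> Nx n'" for p
      by (rule hom_dpoly_eqI[OF comp hom(2) gen that])
    note sub = eval_substitute[OF E F(1)]
    note closed = substitute_closed[of n' F n, OF F(1)]
    have "eval_dpoly E p (eval_map n' E F a) = \<zero>\<^bsub>E\<^esub>" if "p \<in> defining_ideal n' X'" for p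
    proof -
      have p: "keys p \<subseteq> Nx n'" "h' p = \<zero>\<^bsub>S\<^esub>" using that h' by (auto simp: presents_def)
      hence "substitute n F p \<in> defining_ideal n X"
        using h eq[of p] closed[of p] by (simp add: presents_def)
      thus ?thesis using a sub[OF _ p(1)] by (simp add: defining_ideal_def)
    qed
    hence "eval_map n' E F a \<in> variety_of n' (defining_ideal n' X') E"
      using eval_map_closed[OF E F(1)] E by (simp add: variety_of_def)
    thus "eval_map n' E F a \<in> X' E" by (simp add: variety_of_defining_ideal[OF X'])
    show "eval_map n E G (eval_map n' E F a) = a"
    proof (rule PiE_ext)
      show "eval_map n E G (eval_map n' E F a) \<in> {..<n} \<rightarrow>\<^sub>E carrier E"
        by (rule eval_map_closed[OF E(1) eval_map_closed[OF E F(1)] G(1)])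
      show "a \<in> {..<n} \<rightarrow>\<^sub>E carrier E" by (rule E)
      fix i assume "i \<in> {..<n}"
      hence i: "i < n" by simp
      have Gi: "keys (G i) \<subseteq> Nx n'" using G(1)[OF i] by simp
      have "h (substitute n F (G i)) = h (monomial (unit_vec i))"
        using eq[OF Gi] G(2)[OF i] by simp
      hence "eval_dpoly E (substitute n F (G i)) a = eval_dpoly E (monomial (unit_vec i)) a"
        using presents_eq_iff[OF X h closed[OF _ Gi], of "monomial (unit_vec i)"] i a by simp
      also have "\<dots> = a i"
        using E i by (intro eval_dpoly_unit_vec[of _ _ n] difference_Q_algebra_field) auto
      finally show "eval_map n E G (eval_map n' E F a) i = a i"
        using i sub[OF _ Gi] by (simp add: eval_map_def[of n])
    qed
  qed
  show ?thesis unfolding isomorphic_varieties_def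
    using F G main[OF X X' h h' F G] main[OF X' X h' h G F] by blast
qed

text \<open>
  Composing \<open>h'\<close> with the pullback along the inverse isomorphism \<open>G\<close> presents \<open>X\<close>: a polynomial
  vanishes on \<open>X\<close> iff its pullback vanishes on \<open>X'\<close>, since \<open>G\<close> maps \<open>X'\<close> onto \<open>X\<close>.
\<close>

lemma presents_isomorphic:
  assumes X: "difference_variety n (X :: 'e subfunctor)" and X': "difference_variety n' (X' :: 'e subfunctor)"
    and iso: "isomorphic_varieties n X n' X'" and h': "presents n' X' S h'"
  obtains h where "presents n X S h" "h ` carrier (dpoly_ring n) = h' ` carrier (dpoly_ring n')"
proof -
  from iso obtain F G where F: "\<forall>i<n'. F i \<in> carrier (dpoly_ring n)"
    and G: "\<forall>i<n. G i \<in> carrier (dpoly_ring n')"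
    and FG: "\<forall>E. (\<forall>a \<in> X E. eval_map n' E F a \<in> X' E \<and> eval_map n E G (eval_map n' E F a) = a) \<and>
            (\<forall>b \<in> X' E. eval_map n E G b \<in> X E \<and> eval_map n' E F (eval_map n E G b) = b)"
    unfolding isomorphic_varieties_def by (elim exE conjE)
  have FX: "\<And>E a. a \<in> X E \<Longrightarrow> eval_map n' E F a \<in> X' E"
      "\<And>E a. a \<in> X E \<Longrightarrow> eval_map n E G (eval_map n' E F a) = a"
    and GX: "\<And>E b. b \<in> X' E \<Longrightarrow> eval_map n E G b \<in> X E"
      "\<And>E b. b \<in> X' E \<Longrightarrow> eval_map n' E F (eval_map n E G b) = b"
    using FG by blast+
  note F = F[rule_format] and G = G[rule_format]
  have hom': "difference_Q_hom (dpoly_ring n') S h'" using h' by (simp add: presents_def)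
  have subG: "eval_dpoly E (substitute n' G f) b = eval_dpoly E f (eval_map n E G b)"
    if "b \<in> X' E" "keys f \<subseteq> Nx n" for E b f
    using eval_substitute[OF difference_variety_points[OF X' that(1)] G that(2)] by simp
  have subF: "eval_dpoly E (substitute n F f) a = eval_dpoly E f (eval_map n' E F a)"
    if "a \<in> X E" "keys f \<subseteq> Nx n'" for E a f
    using eval_substitute[OF difference_variety_points[OF X that(1)] F that(2)] by simp
  note closedF = substitute_closed[of n' F n, OF F]
  note closedG = substitute_closed[of n G n', OF G]
  define h where "h f = h' (substitute n' G f)" for f
  have hom: "difference_Q_hom (dpoly_ring n) S h"
    unfolding h_def by (rule difference_Q_hom_comp[OF substitute_hom[OF G] hom'])
  have "f \<in> defining_ideal n X \<longleftrightarrow> h f = \<zero>\<^bsub>S\<^esub>" if f: "keys f \<subseteq> Nx n" for f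
  proof -
    have "h f = \<zero>\<^bsub>S\<^esub> \<longleftrightarrow> substitute n' G f \<in> defining_ideal n' X'"
      using h' closedG[OF _ f] by (simp add: presents_def h_def)
    also have "\<dots> \<longleftrightarrow> (\<forall>E. \<forall>b\<in>X' E. eval_dpoly E f (eval_map n E G b) = \<zero>\<^bsub>E\<^esub>)"
      using closedG[OF _ f] subG[OF _ f] by (simp add: defining_ideal_def)
    also have "\<dots> \<longleftrightarrow> (\<forall>E. \<forall>a\<in>X E. eval_dpoly E f a = \<zero>\<^bsub>E\<^esub>)"
      using GX(1) FX by metis
    finally show ?thesis using f by (simp add: defining_ideal_def)
  qed
  hence "presents n X S h" using hom by (auto simp: presents_def defining_ideal_def)
  moreover have "h ` carrier (dpoly_ring n) = h' ` carrier (dpoly_ring n')"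
  proof (intro equalityI subsetI)
    fix y assume "y \<in> h ` carrier (dpoly_ring n)"
    thus "y \<in> h' ` carrier (dpoly_ring n')" using closedG by (auto simp: h_def)
  next
    fix y assume "y \<in> h' ` carrier (dpoly_ring n')"
    then obtain g where g: "keys g \<subseteq> Nx n'" "y = h' g" by auto
    have "eval_dpoly E (substitute n' G (substitute n F g)) b = eval_dpoly E g b" if "b \<in> X' E" for E b
      using subG[OF that closedF[OF _ g(1)]] subF[OF GX(1)[OF that] g(1)] GX(2)[OF that] by simp
    hence "h (substitute n F g) = y"
      unfolding h_def g(2) using presents_eq_iff[OF X' h' closedG[OF _ closedF[OF _ g(1)]] g(1)] by blast
    thus "y \<in> h ` carrier (dpoly_ring n)" using closedF[OF _ g(1)] by (auto simp: image_iff)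
  qed
  ultimately show thesis using that by blast
qed

section \<open>Quotients by difference ideals\<close>

lemma difference_quotient_simps:
  "carrier (difference_quotient R I) = a_rcosets\<^bsub>R\<^esub> I"
  "\<zero>\<^bsub>difference_quotient R I\<^esub> = I"
  "shift (difference_quotient R I) C = (\<Union>a\<in>C. I +>\<^bsub>R\<^esub> shift R a)"
  "ring_iso (difference_quotient R I) S = ring_iso (R Quot I) S"
  "ring_hom R (difference_quotient R I) = ring_hom R (R Quot I)"
  by (simp_all add: difference_quotient_def FactRing_def ring.extend_def ring_iso_def ring_hom_def)

context difference_Q_algebra
begin

lemma shift_coset:
  assumes I: "difference_ideal I R" and a: "a \<in> carrier R"
  shows "shift (difference_quotient R I) (I +> a) = I +> shift R a"
proof -
  interpret ideal I R using I by (simp add: difference_ideal_def)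
  have "I +> shift R x = I +> shift R a" if x: "x \<in> I +> a" for x
  proof -
    obtain i where i: "i \<in> I" "x = i \<oplus> a" using x by (auto simp: a_r_coset_def')
    hence "shift R x = shift R i \<oplus> shift R a" using a Icarr by simp
    moreover have "shift R i \<in> I" using I i by (auto simp: difference_ideal_def)
    ultimately have "shift R x \<in> I +> shift R a" by (auto simp: a_r_coset_def')
    thus ?thesis using a by (intro a_repr_independence[symmetric] a_subgroup shift.hom_closed)
  qed
  moreover have "a \<in> I +> a" using a by (rule a_rcos_self)
  ultimately show ?thesis unfolding difference_quotient_simps by blast
qed

end

text \<open>
  The homomorphism theorem, for homomorphisms that commute with the shifts.
\<close>

lemma difference_isomorphic_quotient_iff:
  assumes R: "difference_Q_algebra R" and S: "difference_Q_algebra S" and I: "difference_ideal I R"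
  shows "difference_isomorphic (difference_quotient R I) S \<longleftrightarrow>
    (\<exists>h. difference_Q_hom R S h \<and> h ` carrier R = carrier S \<and> {x \<in> carrier R. h x = \<zero>\<^bsub>S\<^esub>} = I)"
proof
  interpret R: difference_Q_algebra R by fact
  interpret S: difference_Q_algebra S by fact
  interpret I: ideal I R using I by (simp add: difference_ideal_def)
  {
    assume "difference_isomorphic (difference_quotient R I) S"
    then obtain g where g: "g \<in> ring_iso (R Quot I) S"
      and gs: "\<And>C. C \<in> carrier (difference_quotient R I) \<Longrightarrow>
        g (shift (difference_quotient R I) C) = shift S (g C)"
      by (auto simp: difference_isomorphic_def difference_quotient_simps(4))
    define h where "h a = g (I +>\<^bsub>R\<^esub> a)" for a
    have g': "g \<in> ring_hom (R Quot I) S" "bij_betw g (carrier (R Quot I)) (carrier S)"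
      using g by (auto simp: ring_iso_def)
    have coset: "I +>\<^bsub>R\<^esub> a \<in> a_rcosets\<^bsub>R\<^esub> I" if "a \<in> carrier R" for a
      using that by (rule R.a_rcosetsI[OF I.a_subset])
    have "h \<in> ring_hom R S"
      using ring_hom_trans[OF I.rcos_ring_hom g'(1)] by (simp add: h_def[abs_def] comp_def)
    moreover have "h (shift R a) = shift S (h a)" if "a \<in> carrier R" for a
      using gs[of "I +>\<^bsub>R\<^esub> a"] R.shift_coset[OF I that] coset[OF that]
      by (simp add: h_def difference_quotient_simps(1))
    ultimately have hom: "difference_Q_hom R S h" by unfold_locales auto
    moreover have "h ` carrier R = carrier S"
    proof -
      have "carrier (R Quot I) = (\<lambda>a. I +>\<^bsub>R\<^esub> a) ` carrier R"
        by (auto simp: FactRing_def A_RCOSETS_def')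
      thus ?thesis using g'(2) by (simp add: h_def bij_betw_def image_image)
    qed
    moreover have "{x \<in> carrier R. h x = \<zero>\<^bsub>S\<^esub>} = I"
    proof -
      have Q: "ring (R Quot I)" by (rule I.quotient_is_ring)
      have zero: "g I = \<zero>\<^bsub>S\<^esub>"
        using ring_hom_zero[OF g'(1) Q S.ring_axioms] by (simp add: FactRing_def)
      have "h x = \<zero>\<^bsub>S\<^esub> \<longleftrightarrow> x \<in> I" if x: "x \<in> carrier R" for x
      proof -
        have "I \<in> carrier (R Quot I)" using ring.ring_simprules(2)[OF Q] by (simp add: FactRing_def)
        hence "h x = \<zero>\<^bsub>S\<^esub> \<longleftrightarrow> I +>\<^bsub>R\<^esub> x = I"
          using g'(2) coset[OF x] unfolding h_def zero[symmetric]
          by (intro inj_on_eq_iff[of g "carrier (R Quot I)"]) (auto simp: bij_betw_def FactRing_def)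
        also have "\<dots> \<longleftrightarrow> x \<in> I"
          using I.a_rcos_self[OF x] I.a_rcos_const[of x] by auto
        finally show ?thesis .
      qed
      thus ?thesis using I.Icarr by auto
    qed
    ultimately show "\<exists>h. difference_Q_hom R S h \<and> h ` carrier R = carrier S \<and>
        {x \<in> carrier R. h x = \<zero>\<^bsub>S\<^esub>} = I" by blast
  }
  {
    assume "\<exists>h. difference_Q_hom R S h \<and> h ` carrier R = carrier S \<and> {x \<in> carrier R. h x = \<zero>\<^bsub>S\<^esub>} = I"
    then obtain h where hom: "difference_Q_hom R S h" and surj: "h ` carrier R = carrier S"
      and ker: "a_kernel R S h = I" by (auto simp: a_kernel_def')
    interpret h: difference_Q_hom R S h by (rule hom)
    let ?g = "\<lambda>C. the_elem (h ` C)"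
    have g: "?g \<in> ring_iso (R Quot I) S"
      using ring_hom_ring.FactRing_iso_set_aux[OF h.ring_hom_ring] surj unfolding ker by simp
    have g_coset: "?g (I +>\<^bsub>R\<^esub> a) = h a" if "a \<in> carrier R" for a
      using that ring_hom_ring.the_elem_simp[OF h.ring_hom_ring, of a] unfolding ker by simp
    have gs: "?g (shift (difference_quotient R I) C) = shift S (?g C)" if C: "C \<in> a_rcosets\<^bsub>R\<^esub> I" for C
    proof -
      obtain a where a: "a \<in> carrier R" "C = I +>\<^bsub>R\<^esub> a" using C by (auto simp: A_RCOSETS_def')
      thus ?thesis by (simp add: R.shift_coset[OF I] g_coset h.hom_shift)
    qed
    show "difference_isomorphic (difference_quotient R I) S"
      unfolding difference_isomorphic_def difference_quotient_simps(1,4)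
      by (rule bexI[OF _ g], rule ballI, rule gs)
  }
qed

section \<open>Affine modules and toric varieties\<close>

lemma affine_Nx_module_iff:
  "affine_Nx_module m M \<longleftrightarrow> (\<exists>n \<alpha>. (\<forall>i<n. \<alpha> i \<in> Zx m) \<and> M = lincomb n \<alpha> ` Nx n)"
proof -
  have "{(\<Sum>i<n. zscale (a i) (\<alpha> i)) | a. \<forall>i<n. a i \<in> Nx_poly} = lincomb n \<alpha> ` Nx n" for n \<alpha>
  proof (intro equalityI subsetI)
    fix v assume "v \<in> {(\<Sum>i<n. zscale (a i) (\<alpha> i)) | a. \<forall>i<n. a i \<in> Nx_poly}"
    then obtain a where a: "\<forall>i<n. a i \<in> Nx_poly" "v = (\<Sum>i<n. zscale (a i) (\<alpha> i))" by blast
    let ?e = "\<Sum>i<n. zscale (a i) (unit_vec i)"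
    have "v = lincomb n \<alpha> ?e" by (simp add: a(2) lincomb_sum lincomb_zscale lincomb_unit_vec)
    moreover have "?e \<in> Nx n" using a(1) by (intro Nx_sum) auto
    ultimately show "v \<in> lincomb n \<alpha> ` Nx n" by blast
  qed (auto simp: lincomb_def Nx_def)
  thus ?thesis unfolding affine_Nx_module_def by auto
qed

lemma lincomb_Nx_closed:
  assumes "\<And>i. i < k \<Longrightarrow> \<beta> i \<in> lincomb n \<alpha> ` Nx n"
  shows "lincomb k \<beta> ` Nx k \<subseteq> lincomb n \<alpha> ` Nx n"
proof
  fix v assume "v \<in> lincomb k \<beta> ` Nx k"
  then obtain e where e: "e \<in> Nx k" "v = lincomb k \<beta> e" by blast
  from assms obtain b where b: "\<And>i. i < k \<Longrightarrow> b i \<in> Nx n" "\<And>i. i < k \<Longrightarrow> \<beta> i = lincomb n \<alpha> (b i)"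
    unfolding image_iff by metis
  have "v = lincomb n \<alpha> (\<Sum>i<k. zscale (lookup e i) (b i))"
    using b(2) by (simp add: e(2) lincomb_sum lincomb_zscale lincomb_def[of k])
  moreover have "(\<Sum>i<k. zscale (lookup e i) (b i)) \<in> Nx n"
    using b(1) e(1) by (intro Nx_sum) (auto simp: Nx_def[of k])
  ultimately show "v \<in> lincomb n \<alpha> ` Nx n" by blast
qed

lemma generator_in_lincomb_image: "i < n \<Longrightarrow> \<alpha> i \<in> lincomb n \<alpha> ` Nx n"
  using lincomb_unit_vec[of i n \<alpha>] by (metis Nx_closed(4) imageI)

text \<open>
  Generators equal to zero have to go, since they would become constant coordinates.
\<close>

lemma affine_Nx_module_nonzero_generators:
  assumes "affine_Nx_module m M"
  obtains n \<alpha> where "\<And>i. i < n \<Longrightarrow> \<alpha> i \<in> Zx m" "\<And>i. i < n \<Longrightarrow> \<alpha> i \<noteq> 0" "M = lincomb n \<alpha> ` Nx n"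
proof -
  obtain k \<beta> where \<beta>: "\<forall>i<k. \<beta> i \<in> Zx m" and M: "M = lincomb k \<beta> ` Nx k"
    using assms unfolding affine_Nx_module_iff by blast
  define S where "S = \<beta> ` {..<k} - {0}"
  have "finite S" by (simp add: S_def)
  then obtain \<alpha> where \<alpha>: "bij_betw \<alpha> {0..<card S} S" using ex_bij_betw_nat_finite by blast
  define n where "n = card S"
  have \<alpha>S: "\<alpha> i \<in> S" if "i < n" for i using \<alpha> that by (auto simp: bij_betw_def n_def)
  have "\<beta> i \<in> lincomb n \<alpha> ` Nx n" if "i < k" for i
  proof (cases "\<beta> i = 0")
    case True thus ?thesis by (intro image_eqI[of _ _ 0]) auto
  next
    case False
    hence "\<beta> i \<in> \<alpha> ` {0..<n}" using \<alpha> that by (auto simp: bij_betw_def n_def S_def)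
    thus ?thesis using generator_in_lincomb_image by auto
  qed
  moreover have "\<alpha> i \<in> lincomb k \<beta> ` Nx k" if "i < n" for i
    using \<alpha>S[OF that] generator_in_lincomb_image by (auto simp: S_def)
  ultimately have M': "M = lincomb n \<alpha> ` Nx n"
    unfolding M by (intro equalityI lincomb_Nx_closed)
  have "\<alpha> i \<in> Zx m" "\<alpha> i \<noteq> 0" if "i < n" for i
    using \<alpha>S[OF that] \<beta> by (auto simp: S_def)
  thus thesis by (rule that[OF _ _ M'])
qed

lemma exponent_monoid_lincomb_image: "exponent_monoid (lincomb n \<alpha> ` Nx n)"
  by (auto simp: exponent_monoid_def image_iff
      intro: bexI[of _ 0] bexI[of _ "_ + _"] bexI[of _ "zscale _ _"]
      simp flip: lincomb_add lincomb_zscale)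

text \<open>
  The image is all of \<open>\<rat>{M}\<close> because a choice \<open>s\<close> of preimages of exponents lifts polynomials
  term by term.
\<close>

lemma toric_hom_module_ring:
  fixes n :: nat and \<alpha> :: "nat \<Rightarrow> zvec"
  defines "M \<equiv> lincomb n \<alpha> ` Nx n"
  shows "difference_Q_hom (dpoly_ring n) (module_ring M) (expmap (lincomb n \<alpha>))"
    and "expmap (lincomb n \<alpha>) ` carrier (dpoly_ring n) = carrier (module_ring M)"
proof -
  have k: "keys (expmap (lincomb n \<alpha>) f) \<subseteq> M" if "keys f \<subseteq> Nx n" for f
    using keys_expmap[of "lincomb n \<alpha>" f] that by (auto simp: M_def)
  interpret t: difference_Q_hom "dpoly_ring n" laurent_ring "expmap (lincomb n \<alpha>)" by (rule toric_hom)
  interpret M: difference_Q_algebra "module_ring M"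
    unfolding M_def by (intro difference_Q_algebra_module_ring exponent_monoid_lincomb_image)
  show "difference_Q_hom (dpoly_ring n) (module_ring M) (expmap (lincomb n \<alpha>))"
    using k t.hom_add t.hom_mult t.hom_one t.hom_shift by unfold_locales (auto intro!: ring_hom_memI)
  show "expmap (lincomb n \<alpha>) ` carrier (dpoly_ring n) = carrier (module_ring M)"
  proof (intro equalityI subsetI)
    fix g assume "g \<in> carrier (module_ring M)"
    hence g: "keys g \<subseteq> M" by simp
    define s where "s v = (SOME e. e \<in> Nx n \<and> lincomb n \<alpha> e = v)" for v
    have s: "s v \<in> Nx n \<and> lincomb n \<alpha> (s v) = v" if "v \<in> M" for v
    proof -
      have "\<exists>e. e \<in> Nx n \<and> lincomb n \<alpha> e = v" using that by (auto simp: M_def)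
      thus ?thesis unfolding s_def by (rule someI_ex)
    qed
    have "expmap (lincomb n \<alpha>) (expmap s g) = g"
      unfolding expmap_comp using g s by (intro expmap_id) auto
    moreover have "keys (expmap s g) \<subseteq> Nx n" using keys_expmap[of s g] g s by blast
    ultimately show "g \<in> expmap (lincomb n \<alpha>) ` carrier (dpoly_ring n)" by (auto intro: image_eqI[rotated])
  qed (use k in auto)
qed

text \<open>
  The defining ideal is the intersection of the kernels of evaluation at the points.  The whole
  ring is added to the family for the case that there are no points.
\<close>

lemma difference_ideal_defining_ideal:
  fixes X :: "'e subfunctor"
  assumes X: "difference_variety n X" shows "difference_ideal (defining_ideal n X) (dpoly_ring n)"
proof -
  interpret R: difference_Q_algebra "dpoly_ring n" by (rule difference_Q_algebra_dpoly_ring)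
  have h: "difference_Q_hom (dpoly_ring n) E (\<lambda>f. eval_dpoly E f a)" if "a \<in> X E" for a E
    using difference_variety_points[OF X that] by (intro eval_dpoly_hom difference_Q_algebra_field) auto
  define K where "K a E = {f \<in> carrier (dpoly_ring n). eval_dpoly E f a = \<zero>\<^bsub>E\<^esub>}"
    for a and E :: "'e difference_ring"
  have K: "difference_ideal (K a E) (dpoly_ring n)" if "a \<in> X E" for a E
    unfolding K_def by (rule difference_Q_hom.difference_ideal_kernel[OF h[OF that]])
  have whole: "difference_ideal (carrier (dpoly_ring n)) (dpoly_ring n)"
    using R.oneideal R.shift.hom_closed by (auto simp: difference_ideal_def simp del: dpoly_ring_simps)
  define \<K> where "\<K> = insert (carrier (dpoly_ring n)) {K a E | a E. a \<in> X E}"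
  have "defining_ideal n X = \<Inter> \<K>"
    by (auto simp: \<K>_def defining_ideal_def K_def)
  moreover have "difference_ideal (\<Inter> \<K>) (dpoly_ring n)"
  proof -
    have "difference_ideal I (dpoly_ring n)" if "I \<in> \<K>" for I
      using that K whole by (auto simp: \<K>_def simp del: dpoly_ring_simps)
    moreover have "\<K> \<noteq> {}" by (simp add: \<K>_def)
    ultimately show ?thesis
      unfolding difference_ideal_def using R.i_Intersect[of \<K>] by blast
  qed
  ultimately show ?thesis by simp
qed

text \<open>
  For a toric variety with vectors \<open>\<alpha>\<^sub>i\<close>, the module \<open>M\<close> generated by the \<open>\<alpha>\<^sub>i\<close> gives the
  coordinate ring, by the substitution \<open>y\<^sub>i \<mapsto> \<T>\<^bsup>\<alpha>\<^sub>i\<^esup>\<close>.  Conversely, nonzero generators of \<open>M\<close> are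
  the vectors of a toric variety with coordinate ring \<open>\<rat>{M}\<close>, and varieties with isomorphic
  coordinate rings are isomorphic.
\<close>

theorem isomorphic_to_toric_iff:
  assumes inf: "infinite (UNIV :: 'e set)" and X: "difference_variety n (X :: 'e subfunctor)"
  shows "(\<exists>n' X'. toric_variety n' (X' :: 'e subfunctor) \<and> isomorphic_varieties n X n' X') \<longleftrightarrow>
    (\<exists>m M. affine_Nx_module m M \<and> difference_isomorphic (coordinate_ring n X) (module_ring M))"
proof
  assume "\<exists>n' X'. toric_variety n' (X' :: 'e subfunctor) \<and> isomorphic_varieties n X n' X'"
  then obtain n' and X' :: "'e subfunctor" where X': "toric_variety n' X'" and iso: "isomorphic_varieties n X n' X'"
    by blast
  obtain m \<alpha> where \<alpha>: "defining_vector m n' \<alpha>" and I: "defining_ideal n' X' = toric_ideal n' \<alpha>"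
    and V: "difference_variety n' X'" by (rule toric_varietyE[OF inf X'])
  define M where "M = lincomb n' \<alpha> ` Nx n'"
  note toric = toric_hom_module_ring[of n' \<alpha>, folded M_def]
  have "presents n' X' (module_ring M) (expmap (lincomb n' \<alpha>))"
    using toric(1) by (simp add: presents_def I toric_ideal_def)
  then obtain h where h: "presents n X (module_ring M) h" "h ` carrier (dpoly_ring n) = carrier (module_ring M)"
    using presents_isomorphic[OF X V iso] toric(2) by metis
  have M: "difference_Q_algebra (module_ring M)"
    unfolding M_def by (intro difference_Q_algebra_module_ring exponent_monoid_lincomb_image)
  have "difference_isomorphic (coordinate_ring n X) (module_ring M)"
    unfolding coordinate_ring_def
      difference_isomorphic_quotient_iff[OF difference_Q_algebra_dpoly_ring M difference_ideal_defining_ideal[OF X]]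
    using h by (auto simp: presents_def simp del: dpoly_ring_simps module_ring_simps)
  moreover have "affine_Nx_module m M"
    unfolding affine_Nx_module_iff M_def using \<alpha> by (auto simp: defining_vector_def)
  ultimately show "\<exists>m M. affine_Nx_module m M \<and> difference_isomorphic (coordinate_ring n X) (module_ring M)"
    by blast
next
  assume "\<exists>m M. affine_Nx_module m M \<and> difference_isomorphic (coordinate_ring n X) (module_ring M)"
  then obtain m M where "affine_Nx_module m M"
    and iso: "difference_isomorphic (coordinate_ring n X) (module_ring M)" by blast
  then obtain n' \<alpha> where \<alpha>: "\<And>i. i < n' \<Longrightarrow> \<alpha> i \<in> Zx m" "\<And>i. i < n' \<Longrightarrow> \<alpha> i \<noteq> 0"
    and M: "M = lincomb n' \<alpha> ` Nx n'" using affine_Nx_module_nonzero_generators by metis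
  have Malg: "difference_Q_algebra (module_ring M)"
    unfolding M by (intro difference_Q_algebra_module_ring exponent_monoid_lincomb_image)
  obtain h where h: "difference_Q_hom (dpoly_ring n) (module_ring M) h"
    "h ` carrier (dpoly_ring n) = carrier (module_ring M)"
    "{f \<in> carrier (dpoly_ring n). h f = \<zero>\<^bsub>module_ring M\<^esub>} = defining_ideal n X"
    using iso unfolding coordinate_ring_def
      difference_isomorphic_quotient_iff[OF difference_Q_algebra_dpoly_ring Malg difference_ideal_defining_ideal[OF X]]
    by blast
  define X' where "X' = (variety_of n' (toric_ideal n' \<alpha>) :: 'e subfunctor)"
  have I: "defining_ideal n' X' = toric_ideal n' \<alpha>"
    unfolding X'_def by (rule quasi_torus_closure(2)[OF inf \<alpha>(1)])
  have V: "difference_variety n' X'" unfolding X'_def difference_variety_def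
    by (rule exI[of _ "toric_ideal n' \<alpha>"]) (auto simp: toric_ideal_def)
  have "no_unit_coordinate n' X'"
    using unit_coordinate_iff[OF V I] \<alpha>(2) by (auto simp: no_unit_coordinate_def)
  hence "toric_variety n' X'" by (rule toric_variety_if_toric_ideal[OF inf V _ I])
  moreover have "isomorphic_varieties n X n' X'"
  proof (rule isomorphic_varieties_if_same_image[OF X V])
    show "presents n X (module_ring M) h" using h by (simp add: presents_def)
    show "presents n' X' (module_ring M) (expmap (lincomb n' \<alpha>))"
      using toric_hom_module_ring(1)[of n' \<alpha>] by (simp add: presents_def I toric_ideal_def M)
    show "h ` carrier (dpoly_ring n) = expmap (lincomb n' \<alpha>) ` carrier (dpoly_ring n')"
      unfolding h(2) toric_hom_module_ring(2) M ..
  qed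
  ultimately show "\<exists>n' X'. toric_variety n' (X' :: 'e subfunctor) \<and> isomorphic_varieties n X n' X'"
    by blast
qed

theorem toric_variety_iff_toric_ideal:
  assumes inf: "infinite (UNIV :: 'e set)" and X: "difference_variety n (X :: 'e subfunctor)"
  shows "toric_variety n X \<longleftrightarrow> no_unit_coordinate n X \<and>
    (\<exists>L. Zx_lattice n L \<and> Zx_saturated n L \<and>
       defining_ideal n X = gen_difference_ideal (dpoly_ring n) (lattice_binomials L))"
proof
  assume "toric_variety n X"
  then obtain \<alpha> where "defining_ideal n X = toric_ideal n \<alpha>" "no_unit_coordinate n X"
    by (rule toric_varietyE[OF inf])
  thus "no_unit_coordinate n X \<and> (\<exists>L. Zx_lattice n L \<and> Zx_saturated n L \<and>
       defining_ideal n X = gen_difference_ideal (dpoly_ring n) (lattice_binomials L))"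
    using toric_ideal_eq_gen[of n \<alpha>] Zx_lattice_syzygies[of n \<alpha>] Zx_saturated_syzygies[of n \<alpha>] by auto
qed (use toric_varietyI[OF inf X] in blast)

section \<open>The torus of a toric variety\<close>

text \<open>
  The polynomials that vanish at \<open>a\<close> form an ideal, so they contain the toric ideal as soon as
  they contain its binomials.
\<close>

lemma toric_point_iff:
  assumes E: "difference_field_over_Q E"
  shows "a \<in> variety_of n (toric_ideal n \<alpha>) E \<longleftrightarrow> a \<in> {..<n} \<rightarrow>\<^sub>E carrier E \<and>
    (\<forall>e\<in>Nx n. \<forall>e'\<in>Nx n. lincomb n \<alpha> e = lincomb n \<alpha> e' \<longrightarrow> vec_pow E a e = vec_pow E a e')"
proof (cases "a \<in> {..<n} \<rightarrow>\<^sub>E carrier E")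
  case True
  interpret E: difference_Q_algebra E by (rule difference_Q_algebra_field[OF E])
  have a: "a \<in> {..<n} \<rightarrow> carrier E" using True by auto
  interpret h: difference_Q_hom "dpoly_ring n" E "\<lambda>f. eval_dpoly E f a"
    by (rule eval_dpoly_hom[OF E.difference_Q_algebra_axioms a])
  define K where "K = {f \<in> carrier (dpoly_ring n). eval_dpoly E f a = \<zero>\<^bsub>E\<^esub>}"
  have K: "ideal K (dpoly_ring n)" using h.difference_ideal_kernel by (simp add: K_def difference_ideal_def)
  have bin: "monomial e - monomial e' \<in> K \<longleftrightarrow> vec_pow E a e = vec_pow E a e'"
    if "e \<in> Nx n" "e' \<in> Nx n" for e e'
  proof -
    have "keys (monomial e - monomial e') \<subseteq> Nx n" using that by (intro keys_laurent_diff) auto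
    thus ?thesis using that E.admissible_Nx[OF a]
      by (simp add: K_def eval_diff_zero_iff[OF E.difference_Q_algebra_axioms a]
          E.eval_monomial[OF a] subset_iff)
  qed
  have "a \<in> variety_of n (toric_ideal n \<alpha>) E \<longleftrightarrow> toric_ideal n \<alpha> \<subseteq> K"
    using True E by (auto simp: variety_of_def K_def toric_ideal_def)
  also have "\<dots> \<longleftrightarrow> (\<forall>e\<in>Nx n. \<forall>e'\<in>Nx n. lincomb n \<alpha> e = lincomb n \<alpha> e' \<longrightarrow> vec_pow E a e = vec_pow E a e')"
  proof
    assume "toric_ideal n \<alpha> \<subseteq> K"
    thus "\<forall>e\<in>Nx n. \<forall>e'\<in>Nx n. lincomb n \<alpha> e = lincomb n \<alpha> e' \<longrightarrow> vec_pow E a e = vec_pow E a e'"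
      using binomial_in_toric_ideal bin by blast
  next
    assume *: "\<forall>e\<in>Nx n. \<forall>e'\<in>Nx n. lincomb n \<alpha> e = lincomb n \<alpha> e' \<longrightarrow> vec_pow E a e = vec_pow E a e'"
    show "toric_ideal n \<alpha> \<subseteq> K"
    proof (rule toric_ideal_subset[OF K], rule subsetI)
      fix b assume "b \<in> lattice_binomials (syzygies n \<alpha>)"
      then obtain f where f: "f \<in> syzygies n \<alpha>" "b = monomial (pos_part f) - monomial (neg_part f)"
        by (auto simp: lattice_binomials_def)
      show "b \<in> K" unfolding f(2) using bin * syzygy_parts[OF f(1)] by blast
    qed
  qed
  finally show ?thesis using True by blast
qed (use E in \<open>auto simp: variety_of_def\<close>)

text \<open>
  At a point of the torus the equation \<open>a\<^sup>e = a\<^bsup>e'\<^esup>\<close> can be divided by \<open>a\<^bsup>e'\<^esup>\<close>.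
\<close>

lemma toric_torus_point_iff:
  assumes E: "difference_field_over_Q E" and a: "a \<in> {..<n} \<rightarrow>\<^sub>E Units E"
  shows "a \<in> variety_of n (toric_ideal n \<alpha>) E \<longleftrightarrow> (\<forall>f\<in>syzygies n \<alpha>. vec_pow E a f = \<one>\<^bsub>E\<^esub>)"
proof -
  interpret E: difference_Q_algebra E by (rule difference_Q_algebra_field[OF E])
  have aU: "a \<in> {..<n} \<rightarrow> Units E" and a': "a \<in> {..<n} \<rightarrow>\<^sub>E carrier E" using a by auto
  have closed: "vec_pow E a e \<in> Units E" if "e \<in> Zx n" for e by (rule E.vec_pow_Units[OF aU that])
  have add: "vec_pow E a (e + f) = vec_pow E a e \<otimes>\<^bsub>E\<^esub> vec_pow E a f" if "e \<in> Zx n" "f \<in> Zx n" for e f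
    using E.character_add[OF E.difference_character_vec_pow[OF aU] that] .
  have eq: "vec_pow E a e = vec_pow E a e' \<longleftrightarrow> vec_pow E a (e - e') = \<one>\<^bsub>E\<^esub>"
    if "e \<in> Zx n" "e' \<in> Zx n" for e e'
  proof -
    have "vec_pow E a e = vec_pow E a (e - e') \<otimes>\<^bsub>E\<^esub> vec_pow E a e'"
      using add[of "e - e'" e'] that by simp
    moreover have "vec_pow E a e' \<in> Units E" "vec_pow E a (e - e') \<in> carrier E"
      using closed that by auto
    ultimately show ?thesis by (metis E.Units_closed E.l_one E.Units_r_inv E.m_assoc E.Units_inv_closed E.r_one)
  qed
  have NZ: "e \<in> Nx n \<Longrightarrow> e \<in> Zx n" for e using Nx_subset_Zx by blast
  show ?thesis unfolding toric_point_iff[OF E]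
  proof (intro iffI conjI ballI impI)
    fix f assume f: "f \<in> syzygies n \<alpha>"
      and *: "a \<in> {..<n} \<rightarrow>\<^sub>E carrier E \<and> (\<forall>e\<in>Nx n. \<forall>e'\<in>Nx n. lincomb n \<alpha> e = lincomb n \<alpha> e' \<longrightarrow>
        vec_pow E a e = vec_pow E a e')"
    note parts = syzygy_parts[OF f]
    have "vec_pow E a (pos_part f) = vec_pow E a (neg_part f)" using * parts by blast
    thus "vec_pow E a f = \<one>\<^bsub>E\<^esub>"
      using eq[OF NZ[OF parts(1)] NZ[OF parts(2)]] by (simp add: pos_part_minus_neg_part)
  next
    fix e e' assume "\<forall>f\<in>syzygies n \<alpha>. vec_pow E a f = \<one>\<^bsub>E\<^esub>" "e \<in> Nx n" "e' \<in> Nx n"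
      "lincomb n \<alpha> e = lincomb n \<alpha> e'"
    thus "vec_pow E a e = vec_pow E a e'"
      using NZ by (subst eq) (auto simp: syzygies_def lincomb_diff)
  qed (rule a')
qed

text \<open>
  The exponents of the Laurent monomials \<open>y\<^sub>1, \<dots>, y\<^sub>n, y\<^sub>1\<^bsup>-1\<^esup>, \<dots>, y\<^sub>n\<^bsup>-1\<^esup>\<close> that make up
  \<^const>\<open>theta\<close>.  With them \<open>\<theta>\<close> maps the quasi torus of \<open>\<alpha>\<close> to the one of \<open>(\<alpha>, -\<alpha>)\<close>.
\<close>

definition theta_vec :: "nat \<Rightarrow> nat \<Rightarrow> zvec" where
  "theta_vec n i = (if i < n then unit_vec i else - unit_vec (i - n))"

lemma theta_vec_Zx: "i < 2 * n \<Longrightarrow> theta_vec n i \<in> Zx n"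
  by (auto simp: theta_vec_def)

lemma theta_eq:
  assumes E: "difference_field_over_Q E" and a: "a \<in> {..<n} \<rightarrow> Units E"
  shows "theta n E a = (\<lambda>i\<in>{..<2 * n}. vec_pow E a (theta_vec n i))"
proof -
  interpret E: difference_Q_algebra E by (rule difference_Q_algebra_field[OF E])
  have "vec_pow E a (unit_vec i) = a i" if "i < n" for i
    using a that by (intro E.vec_pow_unit_vec) auto
  moreover have "vec_pow E a (- unit_vec i) = inv\<^bsub>E\<^esub> (a i)" if "i < n" for i
    using E.character_uminus[OF E.difference_character_vec_pow[OF a], of "unit_vec i"] calculation that
    by simp
  ultimately show ?thesis by (auto simp: theta_def theta_vec_def intro!: restrict_ext)
qed

lemma theta_quasi_torus:
  assumes \<alpha>: "\<And>i. i < n \<Longrightarrow> \<alpha> i \<in> Zx m"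
  shows "theta_image n (quasi_torus m n \<alpha>) = quasi_torus m (2 * n) (\<lambda>i. lincomb n \<alpha> (theta_vec n i))"
proof
  fix E :: "'a difference_ring"
  show "theta_image n (quasi_torus m n \<alpha>) E = quasi_torus m (2 * n) (\<lambda>i. lincomb n \<alpha> (theta_vec n i)) E"
  proof (cases "difference_field_over_Q E")
    case E: True
    interpret E: difference_Q_algebra E by (rule difference_Q_algebra_field[OF E])
    have "theta n E (\<lambda>i\<in>{..<n}. vec_pow E t (\<alpha> i)) =
        (\<lambda>i\<in>{..<2 * n}. vec_pow E t (lincomb n \<alpha> (theta_vec n i)))" if "t \<in> {..<m} \<rightarrow>\<^sub>E Units E" for t
    proof -
      have t: "t \<in> {..<m} \<rightarrow> Units E" using that by auto
      let ?a = "\<lambda>i\<in>{..<n}. vec_pow E t (\<alpha> i)"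
      have a: "?a \<in> {..<n} \<rightarrow> Units E" using E.vec_pow_Units[OF t] \<alpha> by auto
      have "vec_pow E ?a (theta_vec n i) = vec_pow E t (lincomb n \<alpha> (theta_vec n i))" if "i < 2 * n" for i
      proof -
        have "vec_pow E ?a (theta_vec n i) = vec_pow E (\<lambda>i. vec_pow E t (\<alpha> i)) (theta_vec n i)"
          using E.admissible_Zx[OF a] theta_vec_Zx[OF that] by (intro E.vec_pow_cong[of _ n]) auto
        also have "\<dots> = vec_pow E t (lincomb n \<alpha> (theta_vec n i))"
          by (rule E.vec_pow_vec_pow[OF t \<alpha> theta_vec_Zx[OF that]])
        finally show ?thesis .
      qed
      thus ?thesis unfolding theta_eq[OF E a] by (auto intro!: restrict_ext)
    qed
    thus ?thesis unfolding theta_image_def quasi_torus_eq[OF E] image_image by (rule image_cong[OF refl])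
  qed (simp add: theta_image_def quasi_torus_non_field)
qed

lemma lincomb_theta: "lincomb (2 * n) (\<lambda>i. lincomb n \<alpha> (theta_vec n i)) e = lincomb n \<alpha> (lincomb (2 * n) (theta_vec n) e)"
  by (rule lincomb_lincomb[symmetric])

lemma lincomb_theta_Nx:
  assumes "e \<in> Zx n" shows "lincomb (2 * n) (theta_vec n) e = e"
proof -
  have "lincomb (2 * n) (theta_vec n) e = lincomb n (theta_vec n) e"
    using assms unfolding lincomb_def
    by (intro sum.mono_neutral_right) (auto simp: Zx_iff)
  also have "\<dots> = lincomb n unit_vec e" by (rule lincomb_cong) (simp add: theta_vec_def)
  finally show ?thesis using lincomb_unit_vecs[OF assms] by simp
qed

text \<open>
  A point \<open>b\<close> of the closure satisfies \<open>b\<^sub>i b\<^sub>n\<^sub>+\<^sub>i = 1\<close>, because the corresponding vectors of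
  \<open>(\<alpha>, -\<alpha>)\<close> cancel; so it is \<open>\<theta>(a)\<close> for a torus point \<open>a\<close>.  Monomials in \<open>\<theta>(a)\<close> are Laurent
  monomials in \<open>a\<close>, and the syzygies correspond.
\<close>

lemma theta_closure_points:
  assumes E: "difference_field_over_Q E"
  shows "variety_of (2 * n) (toric_ideal (2 * n) (\<lambda>i. lincomb n \<alpha> (theta_vec n i))) E =
    theta n E ` (torus_points n E \<inter> variety_of n (toric_ideal n \<alpha>) E)"
    (is "?W = theta n E ` ?T")
proof -
  interpret E: difference_Q_algebra E by (rule difference_Q_algebra_field[OF E])
  let ?\<tau> = "theta_vec n"
  show ?thesis
  proof (intro equalityI subsetI)
    fix b assume "b \<in> theta n E ` ?T"
    then obtain a where a: "a \<in> {..<n} \<rightarrow>\<^sub>E Units E" "a \<in> variety_of n (toric_ideal n \<alpha>) E" "b = theta n E a"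
      using torus_points_Units[OF E] by auto
    have aU: "a \<in> {..<n} \<rightarrow> Units E" using a by auto
    have b: "b = (\<lambda>i\<in>{..<2 * n}. vec_pow E a (?\<tau> i))" using theta_eq[OF E aU] a(3) by simp
    have bU: "b \<in> {..<2 * n} \<rightarrow> Units E"
      using E.vec_pow_Units[OF aU theta_vec_Zx] by (auto simp: b)
    have "b \<in> extensional {..<2 * n}" by (simp add: b)
    with bU have b2: "b \<in> {..<2 * n} \<rightarrow>\<^sub>E Units E" by (simp only: PiE_def Int_iff)
    show "b \<in> ?W" unfolding toric_torus_point_iff[OF E b2]
    proof
      fix f assume f: "f \<in> syzygies (2 * n) (\<lambda>i. lincomb n \<alpha> (?\<tau> i))"
      hence fZ: "f \<in> Zx (2 * n)" by (simp add: syzygies_def)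
      have "vec_pow E b f = vec_pow E (\<lambda>i. vec_pow E a (?\<tau> i)) f"
        using E.admissible_Zx[OF bU] fZ by (intro E.vec_pow_cong[of _ "2 * n"]) (auto simp: b)
      also have "\<dots> = vec_pow E a (lincomb (2 * n) ?\<tau> f)"
        by (rule E.vec_pow_vec_pow[OF aU theta_vec_Zx fZ])
      also have "\<dots> = \<one>\<^bsub>E\<^esub>"
      proof -
        have "lincomb (2 * n) ?\<tau> f \<in> syzygies n \<alpha>"
          using f lincomb_in_Zx[of "2 * n" ?\<tau> n f] theta_vec_Zx by (auto simp: syzygies_def lincomb_theta)
        thus ?thesis using toric_torus_point_iff[OF E a(1)] a(2) by blast
      qed
      finally show "vec_pow E b f = \<one>\<^bsub>E\<^esub>" .
    qed
  next
    fix b assume b: "b \<in> ?W"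
    hence bE: "b \<in> {..<2 * n} \<rightarrow>\<^sub>E carrier E"
      and eq: "\<And>e e'. e \<in> Nx (2 * n) \<Longrightarrow> e' \<in> Nx (2 * n) \<Longrightarrow>
        lincomb n \<alpha> (lincomb (2 * n) ?\<tau> e) = lincomb n \<alpha> (lincomb (2 * n) ?\<tau> e') \<Longrightarrow>
        vec_pow E b e = vec_pow E b e'"
      unfolding toric_point_iff[OF E] lincomb_theta by blast+
    have bE': "b \<in> {..<2 * n} \<rightarrow> carrier E" using bE by auto
    have prod: "b i \<otimes>\<^bsub>E\<^esub> b (n + i) = \<one>\<^bsub>E\<^esub>" if i: "i < n" for i
    proof -
      have "lincomb (2 * n) ?\<tau> (unit_vec i + unit_vec (n + i)) = 0"
        using i by (simp add: lincomb_add lincomb_unit_vec theta_vec_def)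
      hence "vec_pow E b (unit_vec i + unit_vec (n + i)) = \<one>\<^bsub>E\<^esub>"
        using eq[of "unit_vec i + unit_vec (n + i)" 0] i by simp
      moreover have "unit_vec i \<in> E.admissible (2 * n) b" "unit_vec (n + i) \<in> E.admissible (2 * n) b"
        using E.admissible_Nx[OF bE'] i by auto
      ultimately show ?thesis using i bE'
        by (simp add: E.vec_pow_add[of _ "2 * n"] E.vec_pow_unit_vec[of _ "2 * n"] Pi_def)
    qed
    define a where "a = restrict b {..<n}"
    have bU: "b i \<in> Units E" "b (n + i) = inv\<^bsub>E\<^esub> (b i)" if "i < n" for i
    proof -
      have "b i \<in> carrier E" "b (n + i) \<in> carrier E" using bE' that by auto
      thus "b i \<in> Units E" using prod[OF that] E.m_comm[of "b i" "b (n + i)"] by (auto simp: Units_def)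
      show "b (n + i) = inv\<^bsub>E\<^esub> (b i)"
        using \<open>b i \<in> carrier E\<close> \<open>b (n + i) \<in> carrier E\<close> prod[OF that] by (metis E.comm_inv_char)
    qed
    have a: "a \<in> {..<n} \<rightarrow>\<^sub>E Units E" using bU by (auto simp: a_def)
    have "b = theta n E a"
    proof
      fix i
      show "b i = theta n E a i"
      proof (cases "i < 2 * n")
        case True
        thus ?thesis using bU(2)[of "i - n"] by (auto simp: theta_def a_def)
      next
        case False
        thus ?thesis using bE by (auto simp: theta_def PiE_def extensional_def)
      qed
    qed
    moreover have "a \<in> variety_of n (toric_ideal n \<alpha>) E" unfolding toric_point_iff[OF E]
    proof (intro conjI ballI impI)
      show "a \<in> {..<n} \<rightarrow>\<^sub>E carrier E" using a by auto
      fix e e' assume e: "e \<in> Nx n" "e' \<in> Nx n" "lincomb n \<alpha> e = lincomb n \<alpha> e'"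
      have NZ: "e \<in> Nx n \<Longrightarrow> e \<in> Zx n" for e using Nx_subset_Zx by blast
      have N: "e \<in> Nx n \<Longrightarrow> e \<in> Nx (2 * n)" for e using Nx_mono[of n "2 * n"] by auto
      have cong: "vec_pow E a e = vec_pow E b e" if "e \<in> Nx n" for e
        using E.admissible_Nx[of a n] a that by (intro E.vec_pow_cong[of _ n]) (auto simp: a_def)
      show "vec_pow E a e = vec_pow E a e'"
        using eq[OF N[OF e(1)] N[OF e(2)]] e cong by (simp add: lincomb_theta_Nx NZ)
    qed
    ultimately show "b \<in> theta n E ` ?T" using a torus_points_Units[OF E] by auto
  qed
qed

lemma theta_inj_on: "inj_on (theta n E) (torus_points n E)"
proof (rule inj_onI)
  fix a b assume *: "a \<in> torus_points n E" "b \<in> torus_points n E" "theta n E a = theta n E b"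
  show "a = b"
  proof (rule PiE_ext)
    show "a \<in> {..<n} \<rightarrow>\<^sub>E (carrier E - {\<zero>\<^bsub>E\<^esub>})" "b \<in> {..<n} \<rightarrow>\<^sub>E (carrier E - {\<zero>\<^bsub>E\<^esub>})"
      using * by (auto simp: torus_points_def split: if_splits)
    fix i assume "i \<in> {..<n}"
    thus "a i = b i" using fun_cong[OF *(3), of i] by (simp add: theta_def)
  qed
qed

lemma variety_of_non_field: "\<not> difference_field_over_Q E \<Longrightarrow> variety_of n P E = {}"
  by (simp add: variety_of_def)

lemma theta_quasi_torus_closure:
  assumes inf: "infinite (UNIV :: 'e set)" and \<alpha>: "\<And>i. i < n \<Longrightarrow> \<alpha> i \<in> Zx m"
  shows "Cohn_closure (2 * n) (theta_image n (quasi_torus m n \<alpha> :: 'e subfunctor)) =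
      variety_of (2 * n) (toric_ideal (2 * n) (\<lambda>i. lincomb n \<alpha> (theta_vec n i)))"
    and "defining_ideal (2 * n) (variety_of (2 * n)
        (toric_ideal (2 * n) (\<lambda>i. lincomb n \<alpha> (theta_vec n i))) :: 'e subfunctor) =
      toric_ideal (2 * n) (\<lambda>i. lincomb n \<alpha> (theta_vec n i))"
proof -
  have "theta_image n (quasi_torus m n \<alpha> :: 'e subfunctor) =
      quasi_torus m (2 * n) (\<lambda>i. lincomb n \<alpha> (theta_vec n i))"
    by (rule theta_quasi_torus[OF \<alpha>])
  moreover note quasi_torus_closure[OF inf, of "2 * n" "\<lambda>i. lincomb n \<alpha> (theta_vec n i)" m,
      OF lincomb_in_Zx[of n \<alpha> m, OF \<alpha>]]
  ultimately show "Cohn_closure (2 * n) (theta_image n (quasi_torus m n \<alpha> :: 'e subfunctor)) =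
      variety_of (2 * n) (toric_ideal (2 * n) (\<lambda>i. lincomb n \<alpha> (theta_vec n i)))"
    and "defining_ideal (2 * n) (variety_of (2 * n)
        (toric_ideal (2 * n) (\<lambda>i. lincomb n \<alpha> (theta_vec n i))) :: 'e subfunctor) =
      toric_ideal (2 * n) (\<lambda>i. lincomb n \<alpha> (theta_vec n i))" by simp_all
qed

text \<open>
  On the torus \<open>\<theta>\<close> is injective, so the description of the closure of \<open>\<theta>(T\<^sub>\<alpha>)\<close> can be read
  off in the coordinates of \<open>T\<^sub>\<alpha>\<close> themselves.
\<close>

theorem star_closure_quasi_torus:
  assumes inf: "infinite (UNIV :: 'e set)" and \<alpha>: "\<And>i. i < n \<Longrightarrow> \<alpha> i \<in> Zx m"
  defines "T \<equiv> star_closure n (quasi_torus m n \<alpha> :: 'e subfunctor)"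
  shows "T E = torus_points n E \<inter> variety_of n (toric_ideal n \<alpha>) E"
    and "theta_image n T = variety_of (2 * n) (toric_ideal (2 * n) (\<lambda>i. lincomb n \<alpha> (theta_vec n i)))"
proof -
  have cl: "Cohn_closure (2 * n) (theta_image n (quasi_torus m n \<alpha> :: 'e subfunctor)) =
      variety_of (2 * n) (toric_ideal (2 * n) (\<lambda>i. lincomb n \<alpha> (theta_vec n i)))"
    by (rule theta_quasi_torus_closure(1)[OF inf \<alpha>])
  show *: "T E = torus_points n E \<inter> variety_of n (toric_ideal n \<alpha>) E" for E
  proof (cases "difference_field_over_Q E")
    case True
    have "Cohn_closure (2 * n) (theta_image n (quasi_torus m n \<alpha>)) E =
        theta n E ` (torus_points n E \<inter> variety_of n (toric_ideal n \<alpha>) E)"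
      unfolding cl by (rule theta_closure_points[OF True])
    thus ?thesis
      unfolding T_def star_closure_def using theta_inj_on[of n E] by (auto dest: inj_onD)
  qed (simp add: T_def star_closure_def torus_points_def)
  show "theta_image n T = variety_of (2 * n) (toric_ideal (2 * n) (\<lambda>i. lincomb n \<alpha> (theta_vec n i)))"
  proof
    fix E :: "'e difference_ring"
    show "theta_image n T E = variety_of (2 * n) (toric_ideal (2 * n) (\<lambda>i. lincomb n \<alpha> (theta_vec n i))) E"
      by (cases "difference_field_over_Q E")
        (simp_all add: theta_image_def * theta_closure_points variety_of_non_field)
  qed
qed

lemma (in difference_Q_algebra) vec_pow_one:
  assumes e: "e \<in> Zx n" and a: "\<And>i. i < n \<Longrightarrow> a i = \<one>" shows "vec_pow R a e = \<one>"
proof -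
  have "difference_character n (\<lambda>_. \<one>)" by (simp add: difference_character_def)
  from character_eq_vec_pow[OF this e] have 1: "vec_pow R (\<lambda>_. \<one>) e = \<one>" by simp
  have "e \<in> admissible n a" using admissible_Zx[of a n] e a by auto
  thus ?thesis using vec_pow_cong[of e n a "\<lambda>_. \<one>"] a 1 by simp
qed

text \<open>
  The equation \<open>y\<^sub>1 \<cdots> y\<^sub>n = 0\<close> cuts out the complement of the torus.
\<close>

lemma vec_pow_product_zero_iff:
  assumes E: "difference_field_over_Q E" and a: "a \<in> {..<n} \<rightarrow> carrier E"
  shows "vec_pow E a (\<Sum>i<n. unit_vec i) = \<zero>\<^bsub>E\<^esub> \<longleftrightarrow> (\<exists>i<n. a i = \<zero>\<^bsub>E\<^esub>)"
proof -
  interpret E: difference_Q_algebra E by (rule difference_Q_algebra_field[OF E])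
  interpret F: field E using E by (simp add: difference_field_over_Q_def)
  have N: "e \<in> E.admissible n a" if "e \<in> Nx n" for e using E.admissible_Nx[OF a] that by blast
  have "vec_pow E a (\<Sum>i\<in>I. unit_vec i) = \<zero>\<^bsub>E\<^esub> \<longleftrightarrow> (\<exists>i\<in>I. a i = \<zero>\<^bsub>E\<^esub>)"
    if "finite I" "I \<subseteq> {..<n}" for I
    using that
  proof (induction I)
    case (insert i I)
    hence i: "i < n" by simp
    have S: "(\<Sum>i\<in>I. unit_vec i) \<in> Nx n" using insert.prems by (intro Nx_sum) auto
    have "vec_pow E a (\<Sum>i\<in>insert i I. unit_vec i) = a i \<otimes>\<^bsub>E\<^esub> vec_pow E a (\<Sum>i\<in>I. unit_vec i)"
      using insert.hyps i a N[OF S] N[of "unit_vec i"]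
      by (simp add: E.vec_pow_add[of _ n] E.vec_pow_unit_vec[of _ n] Pi_def)
    moreover have "vec_pow E a (\<Sum>i\<in>I. unit_vec i) \<in> carrier E" "a i \<in> carrier E"
      using E.vec_pow_closed[OF N[OF S]] a i by auto
    ultimately show ?case using insert by (auto simp: F.integral_iff)
  qed (simp add: F.one_not_zero)
  from this[of "{..<n}"] show ?thesis by auto
qed

definition mult_action :: "nat \<Rightarrow> nat \<Rightarrow> laurent" where
  "mult_action n i = monomial (unit_vec i + unit_vec (n + i))"

lemma act_mult_action:
  assumes E: "difference_field_over_Q E" and a: "a \<in> {..<n} \<rightarrow> carrier E" and b: "b \<in> {..<n} \<rightarrow> carrier E"
  shows "act n (mult_action n) E a b = torus_mult n E a b"
proof -
  interpret E: difference_Q_algebra E by (rule difference_Q_algebra_field[OF E])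
  let ?c = "\<lambda>i\<in>{..<2 * n}. if i < n then a i else b (i - n)"
  have c: "?c \<in> {..<2 * n} \<rightarrow> carrier E" using a b by (auto simp: Pi_def)
  have N: "e \<in> E.admissible (2 * n) ?c" if "e \<in> Nx (2 * n)" for e using E.admissible_Nx[OF c] that by blast
  have "eval_dpoly E (mult_action n i) ?c = a i \<otimes>\<^bsub>E\<^esub> b i" if i: "i < n" for i
  proof -
    have u: "vec_pow E ?c (unit_vec i) = a i" "vec_pow E ?c (unit_vec (n + i)) = b i"
      using E.vec_pow_unit_vec[of i "2 * n" ?c] E.vec_pow_unit_vec[of "n + i" "2 * n" ?c] i a b
      by (auto simp: Pi_def)
    have "eval_dpoly E (mult_action n i) ?c = vec_pow E ?c (unit_vec i + unit_vec (n + i))"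
      unfolding mult_action_def using i by (intro E.eval_monomial[OF c] N) auto
    also have "\<dots> = vec_pow E ?c (unit_vec i) \<otimes>\<^bsub>E\<^esub> vec_pow E ?c (unit_vec (n + i))"
      using i by (intro E.vec_pow_add[of _ "2 * n"] N) auto
    finally show ?thesis unfolding u .
  qed
  thus ?thesis unfolding act_def eval_map_def torus_mult_def by (intro restrict_ext) simp
qed

text \<open>
  The torus \<open>T\<close> is the star closure of the quasi torus, that is, the set of points of \<open>X\<close> with
  nonzero coordinates.  It is given by equations \<open>a\<^sup>f = 1\<close>, hence is a group, and its complement
  in \<open>X\<close> is given by \<open>y\<^sub>1 \<cdots> y\<^sub>n = 0\<close>.  Componentwise multiplication preserves the equations
  \<open>a\<^sup>e = a\<^bsup>e'\<^esup>\<close> of \<open>X\<close>, so \<open>T\<close> acts on \<open>X\<close> by it.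
\<close>

theorem toric_variety_has_torus:
  assumes inf: "infinite (UNIV :: 'e set)" and X: "toric_variety n (X :: 'e subfunctor)"
  obtains T \<phi> where "difference_torus n T" "Cohn_open_in n X T" "torus_action n T X \<phi>"
    "extends_torus_mult n T \<phi>"
proof -
  obtain m \<alpha> where \<alpha>: "defining_vector m n \<alpha>" and X': "X = variety_of n (toric_ideal n \<alpha>)"
    by (rule toric_varietyE[OF inf X])
  have \<alpha>m: "\<And>i. i < n \<Longrightarrow> \<alpha> i \<in> Zx m" using \<alpha> by (simp add: defining_vector_def)
  define T where "T = star_closure n (quasi_torus m n \<alpha> :: 'e subfunctor)"
  have T: "T E = torus_points n E \<inter> X E" for E
    unfolding T_def X' by (rule star_closure_quasi_torus(1)[OF inf \<alpha>m])
  define W where "W = (variety_of (2 * n) (toric_ideal (2 * n) (\<lambda>i. lincomb n \<alpha> (theta_vec n i))) :: 'e subfunctor)"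
  have W: "theta_image n T = W"
    unfolding T_def W_def by (rule star_closure_quasi_torus(2)[OF inf \<alpha>m])
  have W_var: "difference_variety (2 * n) W" unfolding W_def difference_variety_def
    by (intro exI conjI) (auto simp: toric_ideal_def)
  have W_ideal: "defining_ideal (2 * n) W = toric_ideal (2 * n) (\<lambda>i. lincomb n \<alpha> (theta_vec n i))"
    unfolding W_def by (rule theta_quasi_torus_closure(2)[OF inf \<alpha>m])
  have in_T: "a \<in> T E \<longleftrightarrow> a \<in> {..<n} \<rightarrow>\<^sub>E Units E \<and> (\<forall>f\<in>syzygies n \<alpha>. vec_pow E a f = \<one>\<^bsub>E\<^esub>)"
    if "difference_field_over_Q E" for a and E :: "'e difference_ring"
    unfolding T X' torus_points_Units[OF that] using toric_torus_point_iff[OF that, of a n \<alpha>] by auto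
  have field_T: "difference_field_over_Q E" if "a \<in> T E" for a E
    using that by (auto simp: T torus_points_def split: if_splits)
  have mult_X: "torus_mult n E a b \<in> X E" if E: "difference_field_over_Q E" and a: "a \<in> X E" and b: "b \<in> X E"
    for a b and E :: "'e difference_ring"
  proof -
    interpret E: difference_Q_algebra E by (rule difference_Q_algebra_field[OF E])
    have a': "a \<in> {..<n} \<rightarrow> carrier E" and b': "b \<in> {..<n} \<rightarrow> carrier E"
      using a b by (auto simp: X' toric_point_iff[OF E])
    have mult: "vec_pow E (torus_mult n E a b) e = vec_pow E a e \<otimes>\<^bsub>E\<^esub> vec_pow E b e" if "e \<in> Nx n" for e
      using E.admissible_Nx[OF a'] E.admissible_Nx[OF b'] that
      by (intro E.vec_pow_mult[of _ n]) (auto simp: torus_mult_def)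
    show ?thesis unfolding X' toric_point_iff[OF E]
    proof (intro conjI ballI impI)
      show "torus_mult n E a b \<in> {..<n} \<rightarrow>\<^sub>E carrier E"
        using a' b' by (auto simp: torus_mult_def)
      fix e e' assume e: "e \<in> Nx n" "e' \<in> Nx n" "lincomb n \<alpha> e = lincomb n \<alpha> e'"
      have "vec_pow E a e = vec_pow E a e'" "vec_pow E b e = vec_pow E b e'"
        using a b e unfolding X' toric_point_iff[OF E] by blast+
      thus "vec_pow E (torus_mult n E a b) e = vec_pow E (torus_mult n E a b) e'"
        by (simp only: mult[OF e(1)] mult[OF e(2)])
    qed
  qed
  have "difference_torus n T" unfolding difference_torus_def
  proof (intro conjI allI impI ballI)
    fix E :: "'e difference_ring"
    show "T E \<subseteq> torus_points n E" by (simp add: T)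
  next
    show "difference_variety (2 * n) (theta_image n T)" unfolding W by (rule W_var)
  next
    have p: "presents (2 * n) W laurent_ring (expmap (lincomb (2 * n) (\<lambda>i. lincomb n \<alpha> (theta_vec n i))))"
      using toric_hom by (simp add: presents_def W_ideal toric_ideal_def)
    have "isomorphic_varieties (2 * n) W (2 * n) W"
      by (rule isomorphic_varieties_if_same_image[OF W_var W_var p p refl])
    thus "\<exists>m k \<alpha>. defining_vector m k \<alpha> \<and>
        isomorphic_varieties (2 * n) (theta_image n T)
          (2 * k) (theta_image k (star_closure k (quasi_torus m k \<alpha>)))"
      using \<alpha> W unfolding T_def by metis
  next
    fix E :: "'e difference_ring" assume E: "difference_field_over_Q E"
    interpret E: difference_Q_algebra E by (rule difference_Q_algebra_field[OF E])
    show one: "torus_one n E \<in> T E" unfolding in_T[OF E]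
      using E.vec_pow_one[of _ n "torus_one n E"] by (auto simp: torus_one_def syzygies_def)
    fix a assume a: "a \<in> T E"
    have aU: "a \<in> {..<n} \<rightarrow> Units E" and "a \<in> X E" using a in_T[OF E] T by auto
    have inv: "torus_inv n E a \<in> {..<n} \<rightarrow> Units E" using aU by (auto simp: torus_inv_def)
    show "torus_inv n E a \<in> T E" unfolding in_T[OF E]
    proof (intro conjI ballI)
      show "torus_inv n E a \<in> {..<n} \<rightarrow>\<^sub>E Units E" using aU by (auto simp: torus_inv_def)
      fix f assume f: "f \<in> syzygies n \<alpha>"
      hence fZ: "f \<in> Zx n" by (simp add: syzygies_def)
      have "vec_pow E (\<lambda>i. \<one>\<^bsub>E\<^esub>) f = vec_pow E a f \<otimes>\<^bsub>E\<^esub> vec_pow E (torus_inv n E a) f"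
        using E.admissible_Zx[OF aU] E.admissible_Zx[OF inv] fZ aU
        by (intro E.vec_pow_mult[of _ n]) (auto simp: torus_inv_def Pi_iff)
      moreover have "vec_pow E (\<lambda>i. \<one>\<^bsub>E\<^esub>) f = \<one>\<^bsub>E\<^esub>" using fZ by (intro E.vec_pow_one) auto
      moreover have "vec_pow E a f = \<one>\<^bsub>E\<^esub>" using a f in_T[OF E] by blast
      moreover have "vec_pow E (torus_inv n E a) f \<in> carrier E"
        using E.vec_pow_Units[OF inv fZ] by blast
      ultimately show "vec_pow E (torus_inv n E a) f = \<one>\<^bsub>E\<^esub>" by simp
    qed
    fix b assume b: "b \<in> T E"
    hence "b \<in> {..<n} \<rightarrow> Units E" "b \<in> X E" using in_T[OF E] T by auto
    moreover have "torus_mult n E a b \<in> torus_points n E"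
      using aU calculation(1) by (auto simp: torus_points_Units[OF E] torus_mult_def)
    ultimately show "torus_mult n E a b \<in> T E" using mult_X[OF E \<open>a \<in> X E\<close>] by (simp add: T)
  qed
  moreover have "Cohn_open_in n X T" unfolding Cohn_open_in_def
  proof (intro exI conjI allI)
    let ?P = "toric_ideal n \<alpha> \<union> {monomial (\<Sum>i<n. unit_vec i)}"
    have sum_Nx: "(\<Sum>i<n. unit_vec i) \<in> Nx n" by (intro Nx_sum) auto
    show "difference_variety n (variety_of n ?P :: 'e subfunctor)" unfolding difference_variety_def
      using sum_Nx by (intro exI[of _ ?P]) (auto simp: toric_ideal_def)
    fix E :: "'e difference_ring"
    show "variety_of n ?P E \<subseteq> X E" by (auto simp: X' variety_of_def)
    show "T E = X E - variety_of n ?P E"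
    proof (cases "difference_field_over_Q E")
      case E: True
      interpret E: difference_Q_algebra E by (rule difference_Q_algebra_field[OF E])
      have "a \<in> torus_points n E \<longleftrightarrow> a \<notin> variety_of n ?P E" if "a \<in> X E" for a
      proof -
        have aE: "a \<in> {..<n} \<rightarrow>\<^sub>E carrier E" using that by (auto simp: X' toric_point_iff[OF E])
        hence a: "a \<in> {..<n} \<rightarrow> carrier E" by auto
        have "a \<in> variety_of n ?P E \<longleftrightarrow> eval_dpoly E (monomial (\<Sum>i<n. unit_vec i)) a = \<zero>\<^bsub>E\<^esub>"
          using that E by (auto simp: X' variety_of_def)
        also have "eval_dpoly E (monomial (\<Sum>i<n. unit_vec i)) a = vec_pow E a (\<Sum>i<n. unit_vec i)"
          using E.admissible_Nx[OF a] sum_Nx by (intro E.eval_monomial[OF a]) auto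
        finally have "a \<in> variety_of n ?P E \<longleftrightarrow> (\<exists>i<n. a i = \<zero>\<^bsub>E\<^esub>)"
          using vec_pow_product_zero_iff[OF E a] by simp
        thus ?thesis using aE E by (auto simp: torus_points_def)
      qed
      thus ?thesis by (auto simp: T)
    qed (simp add: T torus_points_def variety_of_non_field X')
  qed
  moreover have act: "act n (mult_action n) E a b = torus_mult n E a b"
    if "difference_field_over_Q E" "a \<in> X E" "b \<in> X E" for a b and E :: "'e difference_ring"
    using that by (intro act_mult_action) (auto simp: X' toric_point_iff)
  moreover have "torus_action n T X (mult_action n)" unfolding torus_action_def
  proof (intro conjI allI impI ballI)
    show "mult_action n i \<in> carrier (dpoly_ring (2 * n))" if "i < n" for i
      using that by (simp add: mult_action_def)
    fix E :: "'e difference_ring" assume E: "difference_field_over_Q E"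
    interpret E: difference_Q_algebra E by (rule difference_Q_algebra_field[OF E])
    fix h assume h: "h \<in> X E"
    have hE: "h \<in> {..<n} \<rightarrow>\<^sub>E carrier E" using h by (auto simp: X' toric_point_iff[OF E])
    have one: "torus_one n E \<in> X E"
      using E.vec_pow_one[OF Nx_subset_Zx[THEN subsetD], of _ n "torus_one n E"]
      by (auto simp: X' toric_point_iff[OF E] torus_one_def)
    have "torus_mult n E (torus_one n E) h = h"
      by (rule ext) (use hE in \<open>auto simp: torus_mult_def torus_one_def PiE_def extensional_def Pi_iff\<close>)
    thus "act n (mult_action n) E (torus_one n E) h = h" by (simp only: act[OF E one h])
    fix a assume "a \<in> T E"
    hence a: "a \<in> X E" by (simp add: T)
    show "act n (mult_action n) E a h \<in> X E" unfolding act[OF E a h] by (rule mult_X[OF E a h])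
    fix b assume "b \<in> T E"
    hence b: "b \<in> X E" by (simp add: T)
    have "a \<in> {..<n} \<rightarrow>\<^sub>E carrier E" "b \<in> {..<n} \<rightarrow>\<^sub>E carrier E"
      using a b by (auto simp: X' toric_point_iff[OF E])
    thus "act n (mult_action n) E (torus_mult n E a b) h =
        act n (mult_action n) E a (act n (mult_action n) E b h)"
      using hE unfolding act[OF E b h] act[OF E mult_X[OF E a b] h] act[OF E a mult_X[OF E b h]]
      by (auto simp: torus_mult_def E.m_assoc PiE_def Pi_def intro!: restrict_ext)
  qed
  moreover have "extends_torus_mult n T (mult_action n)"
    unfolding extends_torus_mult_def using act field_T T by blast
  ultimately show thesis using that by blast
qed

section \<open>A variety with a dense torus is toric\<close>

text \<open>
  The product of the leading terms of \<open>f\<close> and \<open>g\<close> cannot cancel in \<open>f g\<close>, nor can the product of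
  the trailing terms.  As \<open>f g\<close> has only the exponent 0, both products have exponent 0, which
  forces the leading and the trailing exponent of \<open>f\<close> to coincide.
\<close>

lemma laurent_unit_is_term:
  fixes f g :: laurent
  assumes "f * g = 1"
  obtains v c where "f = Poly_Mapping.single v c" "c \<noteq> 0"
proof -
  have nz: "f \<noteq> 0" "g \<noteq> 0" using assms by auto
  hence K: "keys f \<noteq> {}" "keys g \<noteq> {}" by auto
  define a b where "a = Max (keys f)" and "b = Max (keys g)"
  define a' b' where "a' = Min (keys f)" and "b' = Min (keys g)"
  have ab: "a \<in> keys f" "b \<in> keys g" "a' \<in> keys f" "b' \<in> keys g"
    using K by (auto simp: a_def b_def a'_def b'_def)
  have corner: "lookup (f * g) (u + v) = lookup f u * lookup g v"
    if u: "u \<in> keys f" and v: "v \<in> keys g"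
      and only: "\<And>u' v'. u' \<in> keys f \<Longrightarrow> v' \<in> keys g \<Longrightarrow> u' + v' = u + v \<Longrightarrow> u' = u \<and> v' = v" for u v
  proof -
    have "f * g = (\<Sum>u'\<in>keys f. \<Sum>v'\<in>keys g. Poly_Mapping.single (u' + v') (lookup f u' * lookup g v'))"
      by (subst laurent_expand[of f], subst laurent_expand[of g]) (simp add: sum_product mult_single)
    hence "lookup (f * g) (u + v) =
        (\<Sum>u'\<in>keys f. \<Sum>v'\<in>keys g. if u' = u \<and> v' = v then lookup f u' * lookup g v' else 0)"
      using only by (auto simp: lookup_sum lookup_single when_def intro!: sum.cong)
    also have "\<dots> = (\<Sum>u'\<in>keys f. if u' = u then lookup f u * lookup g v else 0)"
      using v by (intro sum.cong) auto
    finally show ?thesis using u by simp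
  qed
  have "lookup (f * g) (a + b) \<noteq> 0"
  proof -
    have "u' = a \<and> v' = b" if "u' \<in> keys f" "v' \<in> keys g" "u' + v' = a + b" for u' v'
    proof -
      have "u' \<le> a" "v' \<le> b" using that by (auto simp: a_def b_def)
      thus ?thesis using that(3) by (metis add_le_cancel_left add_le_cancel_right antisym add_right_mono add_left_mono)
    qed
    thus ?thesis using ab by (subst corner) (auto simp: in_keys_iff)
  qed
  moreover have "lookup (f * g) (a' + b') \<noteq> 0"
  proof -
    have "u' = a' \<and> v' = b'" if "u' \<in> keys f" "v' \<in> keys g" "u' + v' = a' + b'" for u' v'
    proof -
      have "a' \<le> u'" "b' \<le> v'" using that by (auto simp: a'_def b'_def)
      thus ?thesis using that(3) by (metis add_le_cancel_left add_le_cancel_right antisym add_right_mono add_left_mono)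
    qed
    thus ?thesis using ab by (subst corner) (auto simp: in_keys_iff)
  qed
  ultimately have "a + b = 0" "a' + b' = 0" using assms by (auto simp: lookup_one when_def split: if_splits)
  moreover have "a' \<le> a" "b' \<le> b" using ab by (auto simp: a_def b_def)
  ultimately have "a = a'" by (metis add_le_cancel_left add_le_cancel_right antisym add_right_mono add_left_mono)
  have "u = a" if "u \<in> keys f" for u
  proof (rule antisym)
    show "u \<le> a" using that by (simp add: a_def)
    show "a \<le> u" unfolding \<open>a = a'\<close> using that by (simp add: a'_def)
  qed
  hence "f = Poly_Mapping.single a (lookup f a)"
    by (intro poly_mapping_eqI) (auto simp: lookup_single when_def in_keys_iff)
  moreover have "lookup f a \<noteq> 0" using ab by (simp add: in_keys_iff)
  ultimately show thesis using that by blast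
qed

text \<open>
  Setting all \<open>\<T>\<^sup>e\<close> equal to 1 is a homomorphism of difference rings that fixes the constants
  \<open>c\<^sub>i\<close>.  Hence it fixes every monomial in them, and its image consists of constants.
\<close>

lemma vec_pow_constants:
  assumes c: "\<And>i. i < n \<Longrightarrow> c i \<noteq> 0" and e: "e \<in> Zx n"
  shows "\<exists>\<kappa>. \<kappa> \<noteq> 0 \<and> vec_pow laurent_ring (\<lambda>i. Poly_Mapping.single 0 (c i)) e = Poly_Mapping.single 0 \<kappa>"
proof -
  let ?u = "\<lambda>i. Poly_Mapping.single 0 (c i) :: laurent"
  have u: "?u \<in> {..<n} \<rightarrow> Units laurent_ring"
  proof
    fix i assume "i \<in> {..<n}"
    hence "?u i * Poly_Mapping.single 0 (1 / c i) = 1" using c by (simp add: mult_single)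
    thus "?u i \<in> Units laurent_ring" unfolding laurent_Units by blast
  qed
  interpret aug: difference_Q_hom laurent_ring laurent_ring "expmap (\<lambda>_. 0)"
    by unfold_locales (auto intro!: ring_hom_memI simp: expmap_add expmap_mult laurent_shift_expmap expmap_comp
      expmap_single[of _ 0 1, simplified])
  let ?w = "vec_pow laurent_ring ?u e"
  have "expmap (\<lambda>_. 0) ?w = ?w"
    using aug.hom_vec_pow[of e n ?u] laurent.admissible_Zx[OF u] e by auto
  hence "keys ?w \<subseteq> {0}" using keys_expmap[of "\<lambda>_. 0" ?w] by auto
  hence w: "?w = Poly_Mapping.single 0 (lookup ?w 0)"
    by (intro poly_mapping_eqI) (auto simp: lookup_single when_def in_keys_iff)
  have "?w \<noteq> 0"
    using laurent.vec_pow_Units[OF u e] by (auto simp: laurent_Units)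
  hence "lookup ?w 0 \<noteq> 0" using w by (metis single_zero)
  thus ?thesis using w by blast
qed

text \<open>
  All terms that \<open>A\<close> sends to the same exponent are multiplied by the same nonzero factor.
\<close>

lemma expmap_twisted_zero_iff:
  assumes f: "keys f \<subseteq> N" and nz: "\<And>e. e \<in> N \<Longrightarrow> \<kappa> e \<noteq> 0"
    and eq: "\<And>e e'. e \<in> N \<Longrightarrow> e' \<in> N \<Longrightarrow> A e = A e' \<Longrightarrow> \<kappa> e = \<kappa> e'"
  shows "(\<Sum>e\<in>keys f. Poly_Mapping.single (A e) (lookup f e * \<kappa> e)) = 0 \<longleftrightarrow> expmap A f = (0 :: laurent)"
proof -
  let ?s = "\<Sum>e\<in>keys f. Poly_Mapping.single (A e) (lookup f e * \<kappa> e)"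
  have "lookup ?s v = 0 \<longleftrightarrow> lookup (expmap A f) v = 0" for v
  proof -
    have s: "lookup ?s v = (\<Sum>e\<in>{e \<in> keys f. A e = v}. lookup f e * \<kappa> e)"
      by (simp add: lookup_sum lookup_single when_def sum.inter_filter)
    show ?thesis
    proof (cases "\<exists>e0\<in>keys f. A e0 = v")
      case True
      then obtain e0 where e0: "e0 \<in> keys f" "A e0 = v" by blast
      have "(\<Sum>e\<in>{e \<in> keys f. A e = v}. lookup f e * \<kappa> e) = (\<Sum>e\<in>{e \<in> keys f. A e = v}. lookup f e * \<kappa> e0)"
        using f e0 by (intro sum.cong) (auto intro: arg_cong[OF eq])
      hence "lookup ?s v = lookup (expmap A f) v * \<kappa> e0"
        unfolding s lookup_expmap by (simp add: sum_distrib_right)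
      thus ?thesis using nz[of e0] e0 f by auto
    next
      case False
      hence "{e \<in> keys f. A e = v} = {}" by blast
      thus ?thesis unfolding s lookup_expmap by (simp only: sum.empty)
    qed
  qed
  thus ?thesis by (simp add: poly_mapping_eq_iff fun_eq_iff)
qed

text \<open>
  Let \<open>p\<close> vanish on the complement \<open>Z\<close> but not on \<open>X\<close>.  If \<open>f\<close> vanishes on \<open>T\<close>, then \<open>f p\<close>
  vanishes on \<open>X = T \<union> Z\<close>, and \<open>f\<close> lies in the prime ideal of \<open>X\<close>.
\<close>

lemma defining_ideal_open_subset:
  assumes X: "difference_variety n (X :: 'e subfunctor)" and irr: "irreducible_variety n X"
    and op: "Cohn_open_in n X T" and ne: "T E0 \<noteq> {}"
  shows "defining_ideal n T = defining_ideal n X"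
proof
  obtain Z where Z: "difference_variety n Z" "\<And>E. T E = X E - Z E"
    using op by (auto simp: Cohn_open_in_def)
  show "defining_ideal n X \<subseteq> defining_ideal n T" by (rule defining_ideal_mono) (auto simp: Z)
  obtain P where P: "P \<subseteq> carrier (dpoly_ring n)" "Z = variety_of n P"
    using Z(1) by (auto simp: difference_variety_def)
  obtain a0 where a0: "a0 \<in> X E0" "a0 \<notin> Z E0" using ne Z(2) by auto
  note E0 = difference_variety_points[OF X a0(1)]
  obtain p where p: "p \<in> P" "eval_dpoly E0 p a0 \<noteq> \<zero>\<^bsub>E0\<^esub>"
    using a0(2) E0 by (auto simp: P(2) variety_of_def)
  have pN: "keys p \<subseteq> Nx n" using p P(1) by auto
  show "defining_ideal n T \<subseteq> defining_ideal n X"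
  proof
    fix f assume f: "f \<in> defining_ideal n T"
    hence fN: "keys f \<subseteq> Nx n" by (simp add: defining_ideal_def)
    have fp: "keys (f * p) \<subseteq> Nx n" by (rule keys_laurent_mult[OF fN pN]) simp
    have "eval_dpoly E (f * p) a = \<zero>\<^bsub>E\<^esub>" if a: "a \<in> X E" for a E
    proof -
      note E = difference_variety_points[OF X a]
      interpret E: difference_Q_algebra E by (rule difference_Q_algebra_field[OF E(1)])
      have a': "a \<in> {..<n} \<rightarrow> carrier E" using E(2) by auto
      interpret h: difference_Q_hom "dpoly_ring n" E "\<lambda>f. eval_dpoly E f a"
        by (rule eval_dpoly_hom[OF E.difference_Q_algebra_axioms a'])
      have "eval_dpoly E (f * p) a = eval_dpoly E f a \<otimes>\<^bsub>E\<^esub> eval_dpoly E p a"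
        using h.hom_mult[of f p] fN pN by simp
      moreover have "eval_dpoly E f a \<in> carrier E" "eval_dpoly E p a \<in> carrier E"
        using h.hom_closed fN pN by auto
      moreover have "eval_dpoly E f a = \<zero>\<^bsub>E\<^esub> \<or> eval_dpoly E p a = \<zero>\<^bsub>E\<^esub>"
      proof (cases "a \<in> Z E")
        case True thus ?thesis using p(1) E(1) by (auto simp: P(2) variety_of_def)
      next
        case False thus ?thesis using a f by (auto simp: Z(2) defining_ideal_def)
      qed
      ultimately show ?thesis by auto
    qed
    hence "f * p \<in> defining_ideal n X" using fp by (simp add: defining_ideal_def)
    moreover have "p \<notin> defining_ideal n X" using a0(1) p(2) by (auto simp: defining_ideal_def)
    ultimately show "f \<in> defining_ideal n X"
      using irr primeideal.I_prime[of "defining_ideal n X" "dpoly_ring n" f p] fN pN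
      by (auto simp: irreducible_variety_def)
  qed
qed

lemma theta_coordinates_inverse:
  assumes E: "difference_field_over_Q E" and a: "a \<in> torus_points n E" and i: "i < n"
  shows "theta n E a i \<otimes>\<^bsub>E\<^esub> theta n E a (n + i) = \<one>\<^bsub>E\<^esub>"
proof -
  interpret difference_Q_algebra E by (rule difference_Q_algebra_field[OF E])
  have "a i \<in> Units E" using a i by (auto simp: torus_points_Units[OF E])
  thus ?thesis using i by (simp add: theta_def)
qed

text \<open>
  The torus \<open>T\<close> is dense in \<open>X\<close>, so it suffices to find vectors \<open>\<gamma>\<^sub>i\<close> whose toric ideal is the
  defining ideal of \<open>T\<close>.  The isomorphism of \<open>\<theta>(T)\<close> with the star closure of a quasi torus
  presents the coordinate ring of \<open>\<theta>(T)\<close> inside the Laurent ring.  There the coordinates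
  \<open>y\<^sub>1, \<dots>, y\<^sub>n\<close> are units, because \<open>\<theta>(T)\<close> also has their inverses as coordinates; hence they are
  terms \<open>c\<^sub>i \<T>\<^bsup>\<gamma>\<^sub>i\<^esup>\<close>.  The constants are harmless because \<open>T\<close> is a group: \<open>c\<^bsup>e'\<^esup> \<Y>\<^sup>e - c\<^sup>e \<Y>\<^bsup>e'\<^esup>\<close>
  vanishes on \<open>T\<close> whenever \<open>\<Y>\<^sup>e\<close> and \<open>\<Y>\<^bsup>e'\<^esup>\<close> give the same power of \<open>\<T>\<close>, and evaluation at the
  neutral element yields \<open>c\<^sup>e = c\<^bsup>e'\<^esup>\<close>.
\<close>

theorem toric_variety_if_torus:
  assumes inf: "infinite (UNIV :: 'e set)" and X: "difference_variety n (X :: 'e subfunctor)"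
    and unit: "no_unit_coordinate n X" and irr: "irreducible_variety n X"
    and T: "difference_torus n T" and op: "Cohn_open_in n X T"
  shows "toric_variety n X"
proof -
  let ?y = "\<lambda>i. monomial (unit_vec i)"
  \<comment> \<open>At the neutral element of \<open>T(E0)\<close> rational constants can be compared.\<close>
  obtain E0 :: "'e difference_ring" and h0 where E0: "difference_field_over_Q E0"
    and h0: "difference_Q_hom laurent_ring E0 h0" and h0_inj: "\<And>f. h0 f = \<zero>\<^bsub>E0\<^esub> \<longleftrightarrow> f = 0"
    using generic_point[OF inf] by metis
  interpret h0: difference_Q_hom laurent_ring E0 h0 by (rule h0)
  have TP: "T E \<subseteq> torus_points n E" for E using T by (simp add: difference_torus_def)
  have one: "torus_one n E0 \<in> T E0" using T E0 by (simp add: difference_torus_def)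
  have I_T: "defining_ideal n T = defining_ideal n X"
    using defining_ideal_open_subset[OF X irr op] one by blast
  have \<theta>T: "difference_variety (2 * n) (theta_image n T)" using T by (simp add: difference_torus_def)
  obtain m k \<beta> where \<beta>: "defining_vector m k \<beta>" and
    iso: "isomorphic_varieties (2 * n) (theta_image n T) (2 * k) (theta_image k (star_closure k (quasi_torus m k \<beta>)))"
    using T unfolding difference_torus_def by blast
  have \<beta>m: "\<And>i. i < k \<Longrightarrow> \<beta> i \<in> Zx m" using \<beta> by (simp add: defining_vector_def)
  define \<beta>' where "\<beta>' = (\<lambda>i. lincomb k \<beta> (theta_vec k i))"
  define W where "W = (variety_of (2 * k) (toric_ideal (2 * k) \<beta>') :: 'e subfunctor)"
  have W: "theta_image k (star_closure k (quasi_torus m k \<beta>)) = W"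
    unfolding W_def \<beta>'_def by (rule star_closure_quasi_torus(2)[OF inf \<beta>m])
  have "defining_ideal (2 * k) W = toric_ideal (2 * k) \<beta>'"
    unfolding W_def \<beta>'_def by (rule theta_quasi_torus_closure(2)[OF inf \<beta>m])
  hence pW: "presents (2 * k) W laurent_ring (expmap (lincomb (2 * k) \<beta>'))"
    using toric_hom by (simp add: presents_def toric_ideal_def)
  have W_var: "difference_variety (2 * k) W" unfolding W_def difference_variety_def
    by (intro exI conjI) (auto simp: toric_ideal_def)
  obtain h where h: "presents (2 * n) (theta_image n T) laurent_ring h"
    and "h ` carrier (dpoly_ring (2 * n)) = expmap (lincomb (2 * k) \<beta>') ` carrier (dpoly_ring (2 * k))"
    by (rule presents_isomorphic[OF \<theta>T W_var iso[unfolded W] pW])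
  interpret h: difference_Q_hom "dpoly_ring (2 * n)" laurent_ring h using h by (simp add: presents_def)
  have \<theta>T_point: "\<exists>a\<in>T E. b = theta n E a" if "b \<in> theta_image n T E" for b E
    using that by (auto simp: theta_image_def)

  have "\<exists>v c. h (?y i) = Poly_Mapping.single v c \<and> c \<noteq> 0" if i: "i < n" for i
  proof -
    have y: "keys (?y i) \<subseteq> Nx (2 * n)" "keys (?y (n + i)) \<subseteq> Nx (2 * n)" using i by auto
    have yy: "keys (?y i * ?y (n + i)) \<subseteq> Nx (2 * n)" by (rule keys_laurent_mult[OF y]) simp
    have "eval_dpoly E (?y i * ?y (n + i)) b = eval_dpoly E 1 b" if b: "b \<in> theta_image n T E" for E b
    proof -
      note E = difference_variety_points[OF \<theta>T b]
      obtain a where a: "a \<in> torus_points n E" "b = theta n E a" using \<theta>T_point[OF b] TP by blast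
      have b': "b \<in> {..<2 * n} \<rightarrow> carrier E" using E(2) by auto
      note alg = difference_Q_algebra_field[OF E(1)]
      interpret g: difference_Q_hom "dpoly_ring (2 * n)" E "\<lambda>f. eval_dpoly E f b"
        by (rule eval_dpoly_hom[OF alg b'])
      have "eval_dpoly E (?y i * ?y (n + i)) b = b i \<otimes>\<^bsub>E\<^esub> b (n + i)"
        using g.hom_mult[of "?y i" "?y (n + i)"] y i by (simp add: eval_dpoly_unit_vec[OF alg b'])
      also have "\<dots> = \<one>\<^bsub>E\<^esub>" unfolding a(2) by (rule theta_coordinates_inverse[OF E(1) a(1) i])
      finally show ?thesis using g.hom_one by simp
    qed
    hence "h (?y i * ?y (n + i)) = h 1"
      using presents_eq_iff[OF \<theta>T h yy, of 1] by simp
    hence "h (?y i) * h (?y (n + i)) = 1"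
      using h.hom_mult[of "?y i" "?y (n + i)"] h.hom_one y by simp
    thus ?thesis by (rule laurent_unit_is_term) blast
  qed
  then obtain \<gamma> c where \<gamma>: "\<And>i. i < n \<Longrightarrow> h (?y i) = Poly_Mapping.single (\<gamma> i) (c i)"
    and c: "\<And>i. i < n \<Longrightarrow> c i \<noteq> 0" by metis

  \<comment> \<open>The factor \<open>\<kappa>\<close> is the monomial \<open>c\<^sup>e\<close> in the constants \<open>c\<^sub>i\<close>.\<close>
  have "\<exists>\<kappa>. \<kappa> \<noteq> 0 \<and> vec_pow laurent_ring (\<lambda>i. h (?y i)) e = Poly_Mapping.single (lincomb n \<gamma> e) \<kappa>"
    if e: "e \<in> Nx n" for e
  proof -
    have eZ: "e \<in> Zx n" using e Nx_subset_Zx by blast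
    obtain \<kappa> where \<kappa>: "\<kappa> \<noteq> 0" "vec_pow laurent_ring (\<lambda>i. Poly_Mapping.single 0 (c i)) e = Poly_Mapping.single 0 \<kappa>"
      using vec_pow_constants[of n c e] c eZ by blast
    have split: "monomial (\<gamma> i) * Poly_Mapping.single 0 (c i) = Poly_Mapping.single (\<gamma> i) (c i)" for i
      by (simp add: monomial_def mult_single)
    have adm: "e \<in> laurent.admissible n a" for a
      using laurent.admissible_Nx[of a n] e by auto
    have "vec_pow laurent_ring (\<lambda>i. h (?y i)) e =
        vec_pow laurent_ring (\<lambda>i. monomial (\<gamma> i)) e \<otimes>\<^bsub>laurent_ring\<^esub>
        vec_pow laurent_ring (\<lambda>i. Poly_Mapping.single 0 (c i)) e"
      by (rule laurent.vec_pow_mult[OF adm adm]) (simp only: \<gamma> module_ring_simps split)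
    also have "\<dots> = Poly_Mapping.single (lincomb n \<gamma> e) \<kappa>"
      by (simp add: vec_pow_monomials[OF eZ] \<kappa>(2)) (simp add: monomial_def mult_single)
    finally show ?thesis using \<kappa>(1) by blast
  qed
  then obtain \<kappa> where \<kappa>: "\<And>e. e \<in> Nx n \<Longrightarrow> \<kappa> e \<noteq> 0"
    "\<And>e. e \<in> Nx n \<Longrightarrow> vec_pow laurent_ring (\<lambda>i. h (?y i)) e = Poly_Mapping.single (lincomb n \<gamma> e) (\<kappa> e)"
    by metis

  have h_eq: "h f = (\<Sum>e\<in>keys f. Poly_Mapping.single (lincomb n \<gamma> e) (lookup f e * \<kappa> e))"
    if f: "keys f \<subseteq> Nx n" for f
  proof -
    have f2: "keys f \<subseteq> Nx (2 * n)" using f Nx_mono[of n "2 * n"] by auto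
    have "h f = eval_dpoly laurent_ring f (\<lambda>i. h (?y i))"
      by (rule hom_dpoly_eq_eval[OF h.difference_Q_hom_axioms f2])
    also have "\<dots> = (\<Sum>e\<in>keys f. Poly_Mapping.single (lincomb n \<gamma> e) (lookup f e * \<kappa> e))"
      using f \<kappa>(2) by (intro eval_laurent) auto
    finally show ?thesis .
  qed

  have T_iff: "f \<in> defining_ideal n T \<longleftrightarrow> h f = 0" if f: "keys f \<subseteq> Nx n" for f
  proof -
    have f2: "keys f \<subseteq> Nx (2 * n)" using f Nx_mono[of n "2 * n"] by auto
    have ev: "eval_dpoly E f (theta n E a) = eval_dpoly E f a" if a: "a \<in> T E" for E a
    proof -
      have E: "difference_field_over_Q E" using TP[of E] a by (auto simp: torus_points_def split: if_splits)
      interpret E: difference_Q_algebra E by (rule difference_Q_algebra_field[OF E])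
      have "a \<in> {..<n} \<rightarrow> carrier E" using TP[of E] a by (auto simp: torus_points_Units[OF E])
      from E.admissible_Nx[OF this] f show ?thesis
        by (intro E.eval_cong[of _ n, symmetric]) (auto simp: theta_def)
    qed
    have "f \<in> defining_ideal n T \<longleftrightarrow> f \<in> defining_ideal (2 * n) (theta_image n T)"
      using f f2 ev by (auto simp: defining_ideal_def theta_image_def)
    also have "\<dots> \<longleftrightarrow> h f = 0" using h f2 by (simp add: presents_def)
    finally show ?thesis .
  qed

  have \<kappa>_eq: "\<kappa> e = \<kappa> e'" if e: "e \<in> Nx n" "e' \<in> Nx n" "lincomb n \<gamma> e = lincomb n \<gamma> e'" for e e'
  proof -
    let ?f = "Poly_Mapping.single e (\<kappa> e')" and ?f' = "Poly_Mapping.single e' (\<kappa> e)"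
    have k: "keys ?f \<subseteq> Nx n" "keys ?f' \<subseteq> Nx n" using e by auto
    have NN: "Nx n \<subseteq> Nx (2 * n)" by (rule Nx_mono) simp
    have k2: "keys ?f \<subseteq> Nx (2 * n)" "keys ?f' \<subseteq> Nx (2 * n)" by (rule subset_trans[OF _ NN], fact k)+
    have "h ?f = h ?f'"
      unfolding h_eq[OF k(1)] h_eq[OF k(2)] using e \<kappa>(1) by (simp add: mult.commute)
    moreover have "h ?f = h (?f - ?f') + h ?f'"
      using h.hom_add[of "?f - ?f'" ?f'] k2 by (simp add: keys_laurent_diff)
    ultimately have "?f - ?f' \<in> defining_ideal n T"
      using T_iff[OF keys_laurent_diff[OF k]] by simp
    hence zero: "eval_dpoly E0 (?f - ?f') (torus_one n E0) = \<zero>\<^bsub>E0\<^esub>" using one by (simp add: defining_ideal_def)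
    have o: "torus_one n E0 \<in> {..<n} \<rightarrow> carrier E0" by (auto simp: torus_one_def)
    have "eval_dpoly E0 ?f (torus_one n E0) = eval_dpoly E0 ?f' (torus_one n E0)"
      using zero eval_diff_zero_iff[OF h0.S.difference_Q_algebra_axioms o k] by simp
    moreover have "eval_dpoly E0 (Poly_Mapping.single e q) (torus_one n E0) = rat_embed E0 q"
      if "e \<in> Nx n" for e q
    proof -
      have "vec_pow E0 (torus_one n E0) e = \<one>\<^bsub>E0\<^esub>"
        using that Nx_subset_Zx by (intro h0.S.vec_pow_one[of e n]) (auto simp: torus_one_def)
      thus ?thesis using h0.S.admissible_Nx[OF o] that by (auto simp: h0.S.eval_single[OF o])
    qed
    ultimately have "rat_embed E0 (\<kappa> e') = rat_embed E0 (\<kappa> e)" using e by simp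
    hence "h0 (Poly_Mapping.single 0 (\<kappa> e')) = h0 (Poly_Mapping.single 0 (\<kappa> e))"
      using h0.hom_rat_embed by (simp add: laurent_rat_embed)
    moreover have "h0 (Poly_Mapping.single 0 (\<kappa> e')) =
        h0 (Poly_Mapping.single 0 (\<kappa> e') - Poly_Mapping.single 0 (\<kappa> e)) \<oplus>\<^bsub>E0\<^esub> h0 (Poly_Mapping.single 0 (\<kappa> e))"
      using h0.hom_add[of "Poly_Mapping.single 0 (\<kappa> e') - Poly_Mapping.single 0 (\<kappa> e)" "Poly_Mapping.single 0 (\<kappa> e)"]
      by simp
    ultimately have "h0 (Poly_Mapping.single 0 (\<kappa> e') - Poly_Mapping.single 0 (\<kappa> e)) = \<zero>\<^bsub>E0\<^esub>"
      using h0.hom_closed by (metis UNIV_I h0.S.add.r_cancel_one module_ring_simps(1) mem_Collect_eq subset_UNIV)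
    hence "Poly_Mapping.single (0::zvec) (\<kappa> e') - Poly_Mapping.single 0 (\<kappa> e) = 0" by (simp only: h0_inj)
    thus ?thesis by (metis eq_iff_diff_eq_0 lookup_single_eq)
  qed

  have "defining_ideal n X = toric_ideal n \<gamma>"
  proof -
    have "f \<in> defining_ideal n X \<longleftrightarrow> f \<in> toric_ideal n \<gamma>" if f: "keys f \<subseteq> Nx n" for f
    proof -
      have "f \<in> defining_ideal n X \<longleftrightarrow> h f = 0" unfolding I_T[symmetric] by (rule T_iff[OF f])
      also have "\<dots> \<longleftrightarrow> expmap (lincomb n \<gamma>) f = 0"
        unfolding h_eq[OF f] by (rule expmap_twisted_zero_iff[OF f \<kappa>(1) \<kappa>_eq])
      also have "\<dots> \<longleftrightarrow> f \<in> toric_ideal n \<gamma>" using f by (simp add: toric_ideal_def)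
      finally show ?thesis .
    qed
    moreover have "keys f \<subseteq> Nx n" if "f \<in> defining_ideal n X \<or> f \<in> toric_ideal n \<gamma>" for f
      using that by (auto simp: defining_ideal_def toric_ideal_def)
    ultimately show ?thesis by blast
  qed
  thus ?thesis by (rule toric_variety_if_toric_ideal[OF inf X unit])
qed

theorem toric_variety_iff_torus:
  assumes inf: "infinite (UNIV :: 'e set)" and X: "difference_variety n (X :: 'e subfunctor)"
  shows "toric_variety n X \<longleftrightarrow> no_unit_coordinate n X \<and> irreducible_variety n X \<and>
    (\<exists>T \<phi>. difference_torus n T \<and> Cohn_open_in n X T \<and>
       torus_action n T X \<phi> \<and> extends_torus_mult n T \<phi>)"
    (is "_ \<longleftrightarrow> ?torus")
proof
  assume toric: "toric_variety n X"
  obtain \<alpha> where "defining_ideal n X = toric_ideal n \<alpha>" "no_unit_coordinate n X"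
    by (rule toric_varietyE[OF inf toric])
  moreover obtain T \<phi> where "difference_torus n T" "Cohn_open_in n X T" "torus_action n T X \<phi>"
    "extends_torus_mult n T \<phi>"
    by (rule toric_variety_has_torus[OF inf toric])
  ultimately show ?torus
    using primeideal_toric_ideal[of n \<alpha>] unfolding irreducible_variety_def by auto
qed (use toric_variety_if_torus[OF inf X] in blast)

theorem theorem1p3:
  fixes n :: nat and X :: "'e subfunctor"
  assumes "infinite (UNIV :: 'e set)"
    and "difference_variety n X"
  shows
    "((\<exists>n' X'. toric_variety n' (X' :: 'e subfunctor) \<and> isomorphic_varieties n X n' X') \<longleftrightarrow>
        (\<exists>m M. affine_Nx_module m M \<and>
           difference_isomorphic (coordinate_ring n X) (module_ring M)))
     \<and> (toric_variety n X \<longleftrightarrow>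
          no_unit_coordinate n X \<and>
          (\<exists>L. Zx_lattice n L \<and> Zx_saturated n L \<and>
             defining_ideal n X =
               gen_difference_ideal (dpoly_ring n)
                 {monomial (pos_part f) - monomial (neg_part f) | f. f \<in> L}))
     \<and> (toric_variety n X \<longleftrightarrow>
          no_unit_coordinate n X \<and> irreducible_variety n X \<and>
          (\<exists>T \<phi>. difference_torus n T \<and> Cohn_open_in n X T \<and>
             torus_action n T X \<phi> \<and> extends_torus_mult n T \<phi>))"
  using isomorphic_to_toric_iff[OF assms] toric_variety_iff_torus[OF assms]
    toric_variety_iff_toric_ideal[OF assms, unfolded lattice_binomials_def]
  by (intro conjI)

end
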